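(* Let $(M,g)$ be a connected homogeneous Riemannian manifold with $\lambda_g(M)=\infty$, let $\delta,t>0$, and let $G$ be the random graph of the threshold model on $(M,g)$ with density $\delta$ and threshold $t$. Let $E_1,E_2,\dots$ be Borel subsets of $M$ with $\lambda_g(E_n)<\infty$ for all $n$ and $E_n\uparrow M$. Set $v_n:=\#\{v(G)\cap E_n\}$ and $e_n:=\#\{\{x,y\}\in e(G)\mid x,y\in E_n\}$. Then, for every $\varepsilon>0$, $$\lim_{n\to\infty}\mathbb{P}\left(e_n>\left(\frac{\delta V_t}{2}+\varepsilon\right)v_n\right)=0.$$ If $\sum_{n=1}^\infty \frac{1}{\lambda_g(E_n)}<\infty$, then almost surely $$\limsup_{n\to\infty}\frac{e_n}{v_n}\le\frac{\delta V_t}{2}.$$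
   Context: $d_g$ and $\lambda_g$ are the Riemannian distance and Riemannian volume measure. $(M,g)$ is homogeneous if its isometry group acts transitively (this implies geodesic completeness). $V_t:=\lambda_g(B_t(x_0))$ is the volume of the closed ball of radius $t$, which does not depend on the centre $x_0\in M$. $E_n\uparrow M$ means $E_1\subseteq E_2\subseteq\cdots$ and $\bigcup_n E_n=M$. The threshold model with density $\delta$ and threshold $t$: the vertex set $v(G)$ is the set of atoms of a Poisson process $\nu$ on $M$ with intensity measure $\delta\lambda_g$, and $e(G)$ consists of all $\{x,y\}$ with $x,y\in v(G)$, $x\ne y$ and $d_g(x,y)\le t$. The ratio $e_n/v_n$ is considered for $n$ with $v_n>0$. *)

theory Defs
  imports "HOL-Probability.Probability"
begin

section \<open>Smooth manifolds\<close>

text \<open>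
  The manifold is the whole of a second countable Hausdorff type \<open>'m\<close>, modelled on \<open>real ^ 'n\<close>.
  A chart is a pair of its domain and its coordinate map, the latter arbitrary outside the domain.
\<close>

type_synonym ('m, 'n) chart = "'m set \<times> ('m \<Rightarrow> real ^ 'n)"

definition chart_inv :: "('m, 'n::finite) chart \<Rightarrow> real ^ 'n \<Rightarrow> 'm" where
  "chart_inv c = inv_into (fst c) (snd c)"

definition is_chart :: "('m::topological_space, 'n::finite) chart \<Rightarrow> bool" where
  "is_chart c \<longleftrightarrow> open (fst c) \<and> open (snd c ` fst c) \<and>
     homeomorphism (fst c) (snd c ` fst c) (snd c) (chart_inv c)"

text \<open>
  \<open>C\<^sup>k\<close> and smooth maps on an open subset \<open>S\<close> of a normed space; on sets that are not open
  the definition is not meaningful.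
\<close>

primrec Ck_on :: "nat \<Rightarrow> 'a::real_normed_vector set \<Rightarrow> ('a \<Rightarrow> 'b::real_normed_vector) \<Rightarrow> bool" where
  "Ck_on 0 S f \<longleftrightarrow> continuous_on S f"
| "Ck_on (Suc k) S f \<longleftrightarrow> (\<forall>x\<in>S. f differentiable (at x)) \<and>
     (\<forall>v. Ck_on k S (\<lambda>x. frechet_derivative f (at x) v))"

definition smooth_on :: "'a::real_normed_vector set \<Rightarrow> ('a \<Rightarrow> 'b::real_normed_vector) \<Rightarrow> bool" where
  "smooth_on S f \<longleftrightarrow> (\<forall>k. Ck_on k S f)"

definition coord_rep ::
  "('m, 'n::finite) chart \<Rightarrow> ('m, 'n) chart \<Rightarrow> ('m \<Rightarrow> 'm) \<Rightarrow> real ^ 'n \<Rightarrow> real ^ 'n" where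
  "coord_rep c c' F = snd c' \<circ> F \<circ> chart_inv c"

definition coord_jacobian ::
  "('m, 'n::finite) chart \<Rightarrow> ('m, 'n) chart \<Rightarrow> ('m \<Rightarrow> 'm) \<Rightarrow> 'm \<Rightarrow> real ^ 'n ^ 'n" where
  "coord_jacobian c c' F p = matrix (frechet_derivative (coord_rep c c' F) (at (snd c p)))"

definition smooth_map ::
  "('m::topological_space, 'n::finite) chart set \<Rightarrow> ('m \<Rightarrow> 'm) \<Rightarrow> bool" where
  "smooth_map A F \<longleftrightarrow> continuous_on UNIV F \<and>
     (\<forall>c\<in>A. \<forall>c'\<in>A. smooth_on (snd c ` (fst c \<inter> F -` fst c')) (coord_rep c c' F))"

text \<open>For \<open>F = id\<close> the coordinate representations are the transition maps.\<close>

definition smooth_atlas :: "('m::topological_space, 'n::finite) chart set \<Rightarrow> bool" where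
  "smooth_atlas A \<longleftrightarrow> (\<forall>c\<in>A. is_chart c) \<and> (\<Union>c\<in>A. fst c) = UNIV \<and> smooth_map A id"

section \<open>Riemannian metrics, isometries\<close>

text \<open>
  A metric tensor is given by its Gram matrices: \<open>g c p\<close> is the matrix of the inner product on the
  tangent space at \<open>p\<close> with respect to the coordinate basis of the chart \<open>c\<close> (relevant only
  for \<open>p \<in> fst c\<close>). \<open>pullback_eq A g F\<close> says that \<open>F\<close> pulls \<open>g\<close> back to \<open>g\<close>; for \<open>F = id\<close> it is
  the transformation law of a covariant 2-tensor under change of charts.
\<close>

type_synonym ('m, 'n) metric_tensor = "('m, 'n) chart \<Rightarrow> 'm \<Rightarrow> real ^ 'n ^ 'n"

definition pullback_eq ::
  "('m, 'n::finite) chart set \<Rightarrow> ('m, 'n) metric_tensor \<Rightarrow> ('m \<Rightarrow> 'm) \<Rightarrow> bool" where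
  "pullback_eq A g F \<longleftrightarrow> (\<forall>c\<in>A. \<forall>c'\<in>A. \<forall>p. p \<in> fst c \<and> F p \<in> fst c' \<longrightarrow>
     g c p = transpose (coord_jacobian c c' F p) ** g c' (F p) ** coord_jacobian c c' F p)"

definition riemannian_metric ::
  "('m, 'n::finite) chart set \<Rightarrow> ('m, 'n) metric_tensor \<Rightarrow> bool" where
  "riemannian_metric A g \<longleftrightarrow>
     (\<forall>c\<in>A. smooth_on (snd c ` fst c) (\<lambda>x. g c (chart_inv c x))) \<and>
     (\<forall>c\<in>A. \<forall>p\<in>fst c. transpose (g c p) = g c p \<and> (\<forall>v. v \<noteq> 0 \<longrightarrow> 0 < v \<bullet> (g c p *v v))) \<and>
     pullback_eq A g id"

definition riemannian_manifold ::
  "('m::{t2_space, second_countable_topology}, 'n::finite) chart set \<Rightarrow>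
   ('m, 'n) metric_tensor \<Rightarrow> bool" where
  "riemannian_manifold A g \<longleftrightarrow> smooth_atlas A \<and> riemannian_metric A g"

definition riemannian_isometry ::
  "('m::topological_space, 'n::finite) chart set \<Rightarrow> ('m, 'n) metric_tensor \<Rightarrow> ('m \<Rightarrow> 'm) \<Rightarrow> bool" where
  "riemannian_isometry A g F \<longleftrightarrow>
     bij F \<and> smooth_map A F \<and> smooth_map A (inv F) \<and> pullback_eq A g F"

definition homogeneous ::
  "('m::topological_space, 'n::finite) chart set \<Rightarrow> ('m, 'n) metric_tensor \<Rightarrow> bool" where
  "homogeneous A g \<longleftrightarrow> (\<forall>x y. \<exists>F. riemannian_isometry A g F \<and> F x = y)"

section \<open>Riemannian distance\<close>

definition C1_curve ::
  "('m::topological_space, 'n::finite) chart set \<Rightarrow> (real \<Rightarrow> 'm) \<Rightarrow> real \<Rightarrow> real \<Rightarrow> bool" where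
  "C1_curve A \<gamma> a b \<longleftrightarrow> continuous_on {a..b} \<gamma> \<and>
     (\<forall>c\<in>A. \<exists>D. continuous_on {s\<in>{a..b}. \<gamma> s \<in> fst c} D \<and>
        (\<forall>s\<in>{a..b}. \<gamma> s \<in> fst c \<longrightarrow>
           ((snd c \<circ> \<gamma>) has_vector_derivative D s) (at s within {a..b})))"

text \<open>\<open>T\<close> is the finite set of break points.\<close>

definition piecewise_C1_curve ::
  "('m::topological_space, 'n::finite) chart set \<Rightarrow> (real \<Rightarrow> 'm) \<Rightarrow> real \<Rightarrow> real \<Rightarrow> bool" where
  "piecewise_C1_curve A \<gamma> a b \<longleftrightarrow> continuous_on {a..b} \<gamma> \<and>
     (\<exists>T. finite T \<and>
        (\<forall>u v. a \<le> u \<and> u < v \<and> v \<le> b \<and> {u<..<v} \<inter> T = {} \<longrightarrow> C1_curve A \<gamma> u v))"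

text \<open>
  By the transformation law the speed does not depend on the chart chosen around the point. At break
  points its value is arbitrary, which does not affect the length.
\<close>

definition speed ::
  "('m, 'n::finite) chart set \<Rightarrow> ('m, 'n) metric_tensor \<Rightarrow> (real \<Rightarrow> 'm) \<Rightarrow> real \<Rightarrow> real" where
  "speed A g \<gamma> s =
     (let c = (SOME c. c \<in> A \<and> \<gamma> s \<in> fst c);
          w = vector_derivative (snd c \<circ> \<gamma>) (at s)
      in sqrt (w \<bullet> (g c (\<gamma> s) *v w)))"

definition curve_length ::
  "('m, 'n::finite) chart set \<Rightarrow> ('m, 'n) metric_tensor \<Rightarrow> (real \<Rightarrow> 'm) \<Rightarrow> real \<Rightarrow> real \<Rightarrow> ennreal" where
  "curve_length A g \<gamma> a b = (\<integral>\<^sup>+ s \<in> {a..b}. ennreal (speed A g \<gamma> s) \<partial>lborel)"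

text \<open>Finite on a connected manifold; the distance between different components is \<open>\<infinity>\<close>.\<close>

definition riem_dist ::
  "('m::topological_space, 'n::finite) chart set \<Rightarrow> ('m, 'n) metric_tensor \<Rightarrow> 'm \<Rightarrow> 'm \<Rightarrow> ennreal" where
  "riem_dist A g x y = Inf {curve_length A g \<gamma> a b | \<gamma> a b.
     a \<le> b \<and> piecewise_C1_curve A \<gamma> a b \<and> \<gamma> a = x \<and> \<gamma> b = y}"

section \<open>Riemannian volume\<close>

text \<open>
  The unique Borel measure that has the density \<open>sqrt (det g)\<close> with respect to Lebesgue measure in
  every chart.
\<close>

definition riem_volume ::
  "('m::topological_space, 'n::finite) chart set \<Rightarrow> ('m, 'n) metric_tensor \<Rightarrow> 'm measure" where
  "riem_volume A g = (THE \<mu>. sets \<mu> = sets borel \<and>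
     (\<forall>c\<in>A. \<forall>B\<in>sets borel. B \<subseteq> fst c \<longrightarrow>
        emeasure \<mu> B = (\<integral>\<^sup>+ x \<in> snd c ` B. ennreal (sqrt (det (g c (chart_inv c x)))) \<partial>lborel)))"

definition ball_volume ::
  "('m::topological_space, 'n::finite) chart set \<Rightarrow> ('m, 'n) metric_tensor \<Rightarrow> real \<Rightarrow> 'm \<Rightarrow> ennreal" where
  "ball_volume A g t x0 = emeasure (riem_volume A g) {y. riem_dist A g x0 y \<le> ennreal t}"

section \<open>Poisson processes and the threshold model\<close>

text \<open>
  A point process is a random Borel measure that is finite on compact sets and has values in
  \<open>{0, 1, 2, \<dots>, \<infinity>}\<close>.
\<close>

definition point_process :: "'w measure \<Rightarrow> ('w \<Rightarrow> 'm::topological_space measure) \<Rightarrow> bool" where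
  "point_process P N \<longleftrightarrow> prob_space P \<and>
     (\<forall>\<omega>\<in>space P. sets (N \<omega>) = sets borel \<and>
        (\<forall>B\<in>sets borel. emeasure (N \<omega>) B \<in> insert \<infinity> (range of_nat)) \<and>
        (\<forall>K. compact K \<longrightarrow> emeasure (N \<omega>) K < \<infinity>)) \<and>
     (\<forall>B\<in>sets borel. (\<lambda>\<omega>. emeasure (N \<omega>) B) \<in> borel_measurable P)"

definition poisson_process ::
  "'w measure \<Rightarrow> ('w \<Rightarrow> 'm::topological_space measure) \<Rightarrow> 'm measure \<Rightarrow> bool" where
  "poisson_process P N \<mu> \<longleftrightarrow> point_process P N \<and>
     (\<forall>B\<in>sets borel. emeasure \<mu> B < \<infinity> \<longrightarrow>
        (\<forall>k::nat. measure P {\<omega>\<in>space P. emeasure (N \<omega>) B = of_nat k} =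
           measure \<mu> B ^ k / fact k * exp (- measure \<mu> B))) \<and>
     (\<forall>B\<in>sets borel. emeasure \<mu> B = \<infinity> \<longrightarrow> (AE \<omega> in P. emeasure (N \<omega>) B = \<infinity>)) \<and>
     (\<forall>(I::nat set) B. finite I \<and> disjoint_family_on B I \<and> (\<forall>i\<in>I. B i \<in> sets borel) \<longrightarrow>
        prob_space.indep_vars P (\<lambda>_. borel) (\<lambda>i \<omega>. emeasure (N \<omega>) (B i)) I)"

definition graph_vertices :: "'m measure \<Rightarrow> 'm set" where
  "graph_vertices \<nu> = {x. 0 < emeasure \<nu> {x}}"

definition graph_edges ::
  "('m::topological_space, 'n::finite) chart set \<Rightarrow> ('m, 'n) metric_tensor \<Rightarrow> real \<Rightarrow>
   'm measure \<Rightarrow> 'm set set" where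
  "graph_edges A g t \<nu> = {{x, y} | x y. x \<in> graph_vertices \<nu> \<and> y \<in> graph_vertices \<nu> \<and>
     x \<noteq> y \<and> riem_dist A g x y \<le> ennreal t}"

text \<open>Cardinality in \<open>{0, 1, 2, \<dots>, \<infinity>}\<close>, unlike \<open>card\<close>, which is \<open>0\<close> on infinite sets.\<close>

definition ecount :: "'a set \<Rightarrow> ennreal" where
  "ecount X = emeasure (count_space UNIV) X"

definition vertex_count :: "'m measure \<Rightarrow> 'm set \<Rightarrow> ennreal" where
  "vertex_count \<nu> S = ecount (graph_vertices \<nu> \<inter> S)"

definition edge_count ::
  "('m::topological_space, 'n::finite) chart set \<Rightarrow> ('m, 'n) metric_tensor \<Rightarrow> real \<Rightarrow>
   'm measure \<Rightarrow> 'm set \<Rightarrow> ennreal" where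
  "edge_count A g t \<nu> S = ecount {e \<in> graph_edges A g t \<nu>. e \<subseteq> S}"

text \<open>
  In \<open>ennreal\<close> one has \<open>0 / 0 = 0\<close>. Since there are no edges in \<open>S\<close> without vertices in \<open>S\<close>, the
  ratio is \<open>0\<close> if the vertex count is \<open>0\<close>, so that such sets never increase an upper limit of ratios.
\<close>

definition edge_vertex_ratio ::
  "('m::topological_space, 'n::finite) chart set \<Rightarrow> ('m, 'n) metric_tensor \<Rightarrow> real \<Rightarrow>
   'm measure \<Rightarrow> 'm set \<Rightarrow> ennreal" where
  "edge_vertex_ratio A g t \<nu> S = edge_count A g t \<nu> S / vertex_count \<nu> S"

end

theory Submission
  imports Defs
begin

text \<open>
  Let \<open>m = \<delta> \<lambda>(E)\<close> be the mean number of vertices in a set \<open>E\<close> of finite volume. Twice the number of edges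
  inside \<open>E\<close> is the number \<open>T\<close> of ordered pairs of distinct Poisson points in \<open>E\<close> at distance at most \<open>t\<close>. The
  mean of \<open>T\<close> is the integral of \<open>\<delta> \<lambda>(B\<^sub>t(x) \<inter> E)\<close> over \<open>E\<close> with respect to \<open>\<delta> \<lambda>\<close>. By homogeneity all balls of radius \<open>t\<close>
  have the same volume, so the mean of \<open>T\<close> is at most \<open>c m\<close> with \<open>c = \<delta> V\<^sub>t\<close>; the
  restriction to \<open>E\<close> can only make it smaller. Moreover, the variance of \<open>T\<close> is of order \<open>m\<close>, because two pairs of points
  without a common point are uncorrelated. Chebyshev's inequality, applied to \<open>T\<close> and to the number of
  vertices (whose variance is \<open>m\<close>), shows that the number of edges exceeds \<open>c / 2 + \<epsilon>\<close> times the number of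
  vertices only with probability of order \<open>1 / m\<close> (\<open>edge_count_deviation\<close>). As \<open>\<lambda>(E\<^sub>n)\<close> tends to infinity,
  this gives convergence in probability, and the Borel-Cantelli lemma gives the almost sure statement if
  the numbers \<open>1 / \<lambda>(E\<^sub>n)\<close> are summable. If \<open>V\<^sub>t\<close> is infinite there is nothing to prove.
  
  The probabilistic core is \<open>factorial_moments\<close>: the mean number of \<open>k\<close>-tuples of distinct points in a set
  is its measure under the \<open>k\<close>-th power of the intensity. For boxes with disjoint sides this is the
  independence in the definition of a Poisson process, and such boxes cover all tuples of distinct
  points. The orders 2, 3 and 4 are what the second moment of \<open>T\<close> requires. In addition, the process has
  to be a finite set of points of mass 1 inside \<open>E\<close>, which follows from \<open>integer_measure_atomic\<close> and from a
  comparison of moments (\<open>simple_points\<close>).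
  
  The geometric part establishes what is used above of the Riemannian volume and distance: the volume
  exists, is unique, gives no mass to points and is invariant under isometries
  (\<open>is_volume_riem_volume\<close>, \<open>volume_unique\<close>, \<open>riem_volume_singleton\<close>, \<open>isometry_volume\<close>); the distance is symmetric,
  isometries do not increase it, and the pairs of points at distance at most \<open>t\<close> form a closed set
  (\<open>riem_dist_sym\<close>, \<open>isometry_riem_dist_le\<close>, \<open>closed_riem_dist_le\<close>).
\<close>

section \<open>Change of variables for an arbitrary finite index type\<close>

text \<open>
  The change-of-variables theorem for Lebesgue measure is stated for coordinates indexed by a finite
  well-order. The initial segment \<open>idx\<close> of the natural numbers is such an index type with the same number
  of elements as \<open>'n\<close>; a bijection between the two only permutes the coordinates, which changes neither
  Lebesgue measure nor determinants, so that the theorem carries over to \<open>real ^ 'n\<close>.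
\<close>

typedef (overloaded) 'n idx = "{..<CARD('n::finite)} :: nat set"
  by (rule exI[of _ 0]) (simp add: card_gt_0_iff)

instance idx :: (finite) finite
proof
  show "finite (UNIV :: 'a idx set)"
    using type_definition.Abs_image[OF type_definition_idx, where ?'n1='a] by (metis finite_imageI finite_lessThan)
qed

instantiation idx :: (finite) linorder
begin
definition less_eq_idx :: "'a idx \<Rightarrow> 'a idx \<Rightarrow> bool" where "less_eq_idx i j \<longleftrightarrow> Rep_idx i \<le> Rep_idx j"
definition less_idx :: "'a idx \<Rightarrow> 'a idx \<Rightarrow> bool" where "less_idx i j \<longleftrightarrow> Rep_idx i < Rep_idx j"
instance
  by standard (auto simp: less_eq_idx_def less_idx_def Rep_idx_inject)
end

instance idx :: (finite) wellorder
proof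
  fix P :: "'a idx \<Rightarrow> bool" and a :: "'a idx"
  assume step: "\<And>x. (\<And>y. y < x \<Longrightarrow> P y) \<Longrightarrow> P x"
  show "P a"
    by (induction a rule: measure_induct_rule[of Rep_idx]) (auto intro: step simp: less_idx_def)
qed

lemma card_idx: "CARD('n::finite idx) = CARD('n)"
  using type_definition.card[OF type_definition_idx, where ?'n1='n] by simp

lemma exists_idx_bij: "\<exists>b :: 'n::finite idx \<Rightarrow> 'n. bij b"
  by (metis card_idx finite_same_card_bij finite)

text \<open>
  Conjugation by the bijection \<open>b\<close> maps the permutations in the Leibniz formula onto each other and
  preserves their signs.
\<close>

lemma det_reindex:
  fixes A :: "real ^ 'n ^ 'n" and b :: "'k::finite \<Rightarrow> 'n::finite"
  assumes b: "bij b"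
  shows "det (\<chi> i j. A $ b i $ b j) = det A"
proof -
  have inj: "inj_on b UNIV" using b bij_is_inj by blast
  have bb: "bij_betw b UNIV UNIV" using b by simp
  have "bij_betw (map_permutation UNIV b) {p. p permutes (UNIV::'k set)} {p. p permutes (UNIV::'n set)}"
  proof (rule bij_betw_byWitness[where f' = "map_permutation UNIV (inv b)"])
    show "\<forall>p\<in>{p. p permutes UNIV}. map_permutation UNIV (inv b) (map_permutation UNIV b p) = p"
      using b by (auto intro!: map_permutation_compose_inv[of b UNIV UNIV] simp: bij_is_inj)
    show "\<forall>p\<in>{p. p permutes UNIV}. map_permutation UNIV b (map_permutation UNIV (inv b) p) = p"
      using b by (auto intro!: map_permutation_compose_inv[of "inv b" UNIV UNIV] simp: bij_imp_bij_inv bij_is_surj surj_f_inv_f bij_is_inj)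
    show "map_permutation UNIV b ` {p. p permutes UNIV} \<subseteq> {p. p permutes UNIV}"
      using bb by (auto intro: map_permutation_permutes)
    show "map_permutation UNIV (inv b) ` {p. p permutes UNIV} \<subseteq> {p. p permutes UNIV}"
      using bij_imp_bij_inv[OF b] by (auto intro: map_permutation_permutes)
  qed
  moreover have "of_int (sign p) * (\<Prod>i\<in>UNIV. A $ b i $ b (p i)) =
      of_int (sign (map_permutation UNIV b p)) * (\<Prod>i\<in>UNIV. A $ i $ map_permutation UNIV b p i)"
    if "p \<in> {p. p permutes UNIV}" for p
  proof -
    have "(\<Prod>i\<in>UNIV. A $ i $ map_permutation UNIV b p i) =
        (\<Prod>i\<in>UNIV. A $ b i $ map_permutation UNIV b p (b i))"
      using prod.reindex_bij_betw[OF bb, of "\<lambda>i. A $ i $ map_permutation UNIV b p i"] by simp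
    then show ?thesis
      using that inj by (simp add: sign_map_permutation map_permutation_apply)
  qed
  ultimately show ?thesis
    unfolding det_def by (subst sum.reindex_bij_betw[symmetric]) auto
qed

definition reindex :: "('k::finite \<Rightarrow> 'n::finite) \<Rightarrow> real ^ 'n \<Rightarrow> real ^ 'k" where
  "reindex b x = (\<chi> i. x $ b i)"

lemma linear_reindex: "linear (reindex b)"
  by (rule linearI) (auto simp: reindex_def vec_eq_iff)

lemma bounded_linear_reindex: "bounded_linear (reindex b)"
  using linear_reindex linear_conv_bounded_linear by blast

lemma measurable_reindex [measurable]: "reindex b \<in> borel_measurable borel"
  using bounded_linear_reindex borel_measurable_continuous_onI linear_continuous_on by blast

lemma reindex_inverse: "bij b \<Longrightarrow> reindex (inv b) (reindex b x) = x" 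
  "bij b \<Longrightarrow> reindex b (reindex (inv b) y) = y"
  by (auto simp: reindex_def vec_eq_iff bij_is_surj surj_f_inv_f bij_is_inj)

text \<open>
  The preimage of a box is the box with permuted side lengths, and Lebesgue measure is determined by its values on boxes.
\<close>

lemma lborel_reindex:
  fixes b :: "'k::finite \<Rightarrow> 'n::finite"
  assumes b: "bij b"
  shows "distr lborel borel (reindex b) = lborel"
proof (rule lborel_eqI[symmetric])
  fix l u :: "real ^ 'k"
  assume le: "\<And>b. b \<in> Basis \<Longrightarrow> l \<bullet> b \<le> u \<bullet> b"
  have le': "l $ i \<le> u $ i" for i
    using le[of "axis i 1"] by (simp add: inner_axis axis_in_Basis_iff)
  have s: "surj b" "inj b" using b by (auto simp: bij_is_surj bij_is_inj)
  have "reindex b -` box l u = box (reindex (inv b) l) (reindex (inv b) u)"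
  proof -
    have "(\<forall>i. l $ i < x $ b i \<and> x $ b i < u $ i) \<longleftrightarrow> (\<forall>j. l $ inv b j < x $ j \<and> x $ j < u $ inv b j)" for x
      by (metis s surj_f_inv_f inv_f_f)
    then show ?thesis by (auto simp: mem_box_cart reindex_def vimage_def)
  qed
  then have "emeasure (distr lborel borel (reindex b)) (box l u) =
      emeasure lborel (box (reindex (inv b) l) (reindex (inv b) u))"
    by (subst emeasure_distr) auto
  also have "\<dots> = (\<Prod>c\<in>Basis. (reindex (inv b) u - reindex (inv b) l) \<bullet> c)"
    by (rule emeasure_lborel_box) (auto simp: Basis_vec_def inner_axis reindex_def le')
  also have "(\<Prod>c\<in>Basis. (reindex (inv b) u - reindex (inv b) l) \<bullet> c) = (\<Prod>i\<in>UNIV. u $ inv b i - l $ inv b i)"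
  proof -
    have "bij_betw (\<lambda>i. axis i (1::real)) (UNIV::'n set) (Basis :: (real^'n) set)"
      by (auto simp: bij_betw_def inj_on_def axis_eq_axis Basis_vec_def)
    from prod.reindex_bij_betw[OF this, of "\<lambda>c. (reindex (inv b) u - reindex (inv b) l) \<bullet> c", symmetric]
    show ?thesis by (simp add: inner_axis reindex_def)
  qed
  also have "\<dots> = (\<Prod>i\<in>UNIV. u $ i - l $ i)"
    using prod.reindex_bij_betw[OF bij_imp_bij_inv[OF b]] by (auto simp: )
  also have "\<dots> = (\<Prod>c\<in>Basis. (u - l) \<bullet> c)"
  proof -
    have "bij_betw (\<lambda>i. axis i (1::real)) (UNIV::'k set) (Basis :: (real^'k) set)"
      by (auto simp: bij_betw_def inj_on_def axis_eq_axis Basis_vec_def)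
    from prod.reindex_bij_betw[OF this, of "\<lambda>c. (u - l) \<bullet> c", symmetric]
    show ?thesis by (simp add: inner_axis)
  qed
  finally show "emeasure (distr lborel borel (reindex b)) (box l u) = (\<Prod>c\<in>Basis. (u - l) \<bullet> c)" .
qed simp

lemma emeasure_reindex_image:
  assumes b: "bij b" and B: "B \<in> sets borel"
  shows "emeasure lborel (reindex b ` B) = emeasure lborel B" "reindex b ` B \<in> sets borel"
proof -
  have eq: "reindex b ` B = reindex (inv b) -` B \<inter> space borel"
    using reindex_inverse[OF b] by (auto simp: image_iff) metis
  show m: "reindex b ` B \<in> sets borel"
    unfolding eq using B by (rule measurable_sets[OF measurable_reindex])
  have eq': "reindex b -` (reindex b ` B) = B"
    using reindex_inverse[OF b] by (auto simp: image_iff) metis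
  have "emeasure lborel (reindex b ` B) = emeasure (distr lborel borel (reindex b)) (reindex b ` B)"
    by (simp add: lborel_reindex[OF b])
  also have "\<dots> = emeasure lborel B"
    using m by (subst emeasure_distr) (auto simp: eq')
  finally show "emeasure lborel (reindex b ` B) = emeasure lborel B" .
qed

text \<open>
  For images of finite measure the claim is a statement about gauge integrals of nonnegative functions,
  which agree with the Lebesgue integral. The restriction to finite measure disappears in
  \<open>emeasure_diffeo_image\<close> by exhaustion.
\<close>

lemma emeasure_image_finite_aux:
  fixes f :: "real ^ 'k::{finite,wellorder} \<Rightarrow> real ^ 'k::_"
  assumes B: "B \<in> sets borel" and fB: "f ` B \<in> sets borel" and fin: "emeasure lborel (f ` B) < \<infinity>"
    and der: "\<And>x. x \<in> B \<Longrightarrow> (f has_derivative f' x) (at x)" and inj: "inj_on f B"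
  shows "emeasure lborel (f ` B) = (\<integral>\<^sup>+x\<in>B. ennreal \<bar>det (matrix (f' x))\<bar> \<partial>lborel)"
proof -
  have "f ` B \<in> lmeasurable"
    using fB fin by (intro fmeasurableI) auto
  then have "((\<lambda>x. \<bar>det (matrix (f' x))\<bar>) has_integral measure lebesgue (f ` B)) B"
    using has_measure_differentiable_image[of B f f' "measure lebesgue (f ` B)"] B der inj
    by (auto intro: has_derivative_at_withinI)
  then have "(\<integral>\<^sup>+x\<in>B. ennreal \<bar>det (matrix (f' x))\<bar> \<partial>lborel) = ennreal (measure lebesgue (f ` B))"
    by (intro nn_integral_has_integral_lebesgue') auto
  also have "\<dots> = emeasure lborel (f ` B)"
    using fin fB by (subst emeasure_eq_ennreal_measure[symmetric]) auto
  finally show ?thesis ..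
qed

lemma emeasure_image_finite:
  fixes f :: "real ^ 'n::finite \<Rightarrow> real ^ 'n"
  assumes B: "B \<in> sets borel" and fB: "f ` B \<in> sets borel" and fin: "emeasure lborel (f ` B) < \<infinity>"
    and der: "\<And>x. x \<in> B \<Longrightarrow> (f has_derivative f' x) (at x)" and inj: "inj_on f B"
    and [measurable]: "(\<lambda>x. ennreal \<bar>det (matrix (f' x))\<bar> * indicator B x) \<in> borel_measurable borel"
  shows "emeasure lborel (f ` B) = (\<integral>\<^sup>+x\<in>B. ennreal \<bar>det (matrix (f' x))\<bar> \<partial>lborel)"
proof -
  obtain b :: "'n idx \<Rightarrow> 'n" where b: "bij b" using exists_idx_bij by blast
  define p where "p = (reindex b :: real ^ 'n \<Rightarrow> real ^ 'n idx)"
  define q where "q = (reindex (inv b) :: real ^ 'n idx \<Rightarrow> real ^ 'n)"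
  have qp [simp]: "q (p x) = x" and pq [simp]: "p (q y) = y" for x y
    using reindex_inverse[OF b] by (auto simp: p_def q_def)
  have [measurable]: "q \<in> borel_measurable borel" by (simp add: q_def)
  define F where "F = p \<circ> f \<circ> q"
  define F' where "F' y = p \<circ> f' (q y) \<circ> q" for y
  have img: "F ` (p ` B) = p ` (f ` B)" by (auto simp: F_def image_iff)
  have "emeasure lborel (F ` (p ` B)) = (\<integral>\<^sup>+x\<in>p ` B. ennreal \<bar>det (matrix (F' x))\<bar> \<partial>lborel)"
  proof (rule emeasure_image_finite_aux)
    show "p ` B \<in> sets borel" "F ` p ` B \<in> sets borel" "emeasure lborel (F ` p ` B) < \<infinity>"
      unfolding img using emeasure_reindex_image[OF b B] emeasure_reindex_image[OF b fB] fin by (auto simp: p_def)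
    show "(F has_derivative F' y) (at y)" if y: "y \<in> p ` B" for y
    proof -
      have bl: "bounded_linear p" "bounded_linear q" by (auto simp: p_def q_def bounded_linear_reindex)
      have "(f has_derivative f' (q y)) (at (q y))" using y der by auto
      from diff_chain_at[OF bounded_linear_imp_has_derivative[OF bl(2), of "at y"] this]
      have "(f \<circ> q has_derivative f' (q y) \<circ> q) (at y)" .
      from diff_chain_at[OF this bounded_linear_imp_has_derivative[OF bl(1)]]
      show ?thesis by (simp add: F_def F'_def o_assoc)
    qed
    show "inj_on F (p ` B)"
      using inj unfolding F_def by (auto simp: inj_on_def) (metis qp)
  qed
  also have "emeasure lborel (F ` (p ` B)) = emeasure lborel (f ` B)"
    unfolding img using emeasure_reindex_image[OF b fB] by (simp add: p_def)
  also have "(\<integral>\<^sup>+x\<in>p ` B. ennreal \<bar>det (matrix (F' x))\<bar> \<partial>lborel) =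
     (\<integral>\<^sup>+y. (ennreal \<bar>det (matrix (f' (q y)))\<bar> * indicator B (q y)) \<partial>lborel)"
  proof (intro nn_integral_cong)
    fix y :: "real ^ 'n idx"
    show "ennreal \<bar>det (matrix (F' y))\<bar> * indicator (p ` B) y = ennreal \<bar>det (matrix (f' (q y)))\<bar> * indicator B (q y)"
    proof (cases "q y \<in> B")
      case True
      have "matrix (F' y) = (\<chi> i j. matrix (f' (q y)) $ b i $ b j)"
      proof -
        have "q (axis j 1) = axis (b j) 1" for j
          using b by (auto simp: q_def reindex_def vec_eq_iff axis_def bij_is_inj bij_is_surj surj_f_inv_f)
        then show ?thesis
          by (auto simp: matrix_def F'_def p_def reindex_def intro!: vec_eq_iff[THEN iffD2])
      qed
      then have "det (matrix (F' y)) = det (matrix (f' (q y)))" by (simp add: det_reindex[OF b])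
      moreover have "y \<in> p ` B" using True pq by (metis image_eqI)
      ultimately show ?thesis using True by simp
    next
      case False
      then have "y \<notin> p ` B" by auto
      with False show ?thesis by simp
    qed
  qed
  also have "\<dots> = (\<integral>\<^sup>+x. (ennreal \<bar>det (matrix (f' x))\<bar> * indicator B x) \<partial>(distr lborel borel q))"
    by (subst nn_integral_distr) auto
  also have "\<dots> = (\<integral>\<^sup>+x\<in>B. ennreal \<bar>det (matrix (f' x))\<bar> \<partial>lborel)"
    unfolding q_def by (subst lborel_reindex[OF bij_imp_bij_inv[OF b]]) simp
  finally show ?thesis .
qed

lemma emeasure_diffeo_image:
  fixes f :: "real ^ 'n::finite \<Rightarrow> real ^ 'n"
  assumes S: "open S" and T: "open T" and hom: "homeomorphism S T f h"
    and der: "\<And>x. x \<in> S \<Longrightarrow> (f has_derivative f' x) (at x)"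
    and cont: "continuous_on S (\<lambda>x. det (matrix (f' x)))"
    and B: "B \<in> sets borel" "B \<subseteq> S"
  shows "f ` B \<in> sets borel"
    "emeasure lborel (f ` B) = (\<integral>\<^sup>+x\<in>B. ennreal \<bar>det (matrix (f' x))\<bar> \<partial>lborel)"
proof -
  have inj: "inj_on f S" by (rule inj_on_inverseI[of _ h]) (rule homeomorphism_apply1[OF hom])
  have img: "f ` B' = T \<inter> h -` B'" if "B' \<subseteq> S" for B'
  proof -
    have "\<forall>x\<in>S. h (f x) = x" and T: "T = f ` S"
      using homeomorphism_apply1[OF hom] homeomorphism_image1[OF hom] by auto
    then show ?thesis using that unfolding T by (auto simp: subset_iff)
  qed
  have hm: "h \<in> borel_measurable (restrict_space borel T)"
    using hom by (intro borel_measurable_continuous_on_restrict) (rule homeomorphism_cont2)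
  have imgB: "f ` B' \<in> sets borel" if "B' \<in> sets borel" "B' \<subseteq> S" for B'
  proof -
    have "h -` B' \<inter> space (restrict_space borel T) \<in> sets (restrict_space borel T)"
      using hm that(1) by (rule measurable_sets)
    then show ?thesis
      unfolding img[OF that(2)] using T by (simp add: sets_restrict_space_iff space_restrict_space Int_commute)
  qed
  show "f ` B \<in> sets borel" using imgB B by blast
  have dm: "(\<lambda>x. ennreal \<bar>det (matrix (f' x))\<bar> * indicator B' x) \<in> borel_measurable borel"
    if "B' \<in> sets borel" "B' \<subseteq> S" for B'
  proof -
    have "(\<lambda>x. det (matrix (f' x))) \<in> borel_measurable (restrict_space borel S)"
      using cont by (rule borel_measurable_continuous_on_restrict)
    then have "(\<lambda>x. det (matrix (f' x)) * indicator S x) \<in> borel_measurable borel"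
      using S by (subst (asm) borel_measurable_restrict_space_iff) (auto simp: mult.commute)
    then have "(\<lambda>x. ennreal \<bar>det (matrix (f' x)) * indicator S x\<bar> * indicator B' x) \<in> borel_measurable borel"
      using that by measurable
    also have "(\<lambda>x. ennreal \<bar>det (matrix (f' x)) * indicator S x\<bar> * indicator B' x) =
        (\<lambda>x. ennreal \<bar>det (matrix (f' x))\<bar> * indicator B' x)"
      using that(2) by (auto simp: indicator_def fun_eq_iff)
    finally show ?thesis .
  qed
  \<comment> \<open>exhaust \<open>B\<close> by sets whose images lie in balls and therefore have finite measure\<close>
  define C where "C n = B \<inter> f -` ball 0 (real n)" for n
  have C_sub: "C n \<subseteq> S" for n using B by (auto simp: C_def)
  have C_sets: "C n \<in> sets borel" for n
  proof -
    have "open (S \<inter> f -` ball 0 (real n))"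
      using hom S by (intro continuous_open_preimage) (auto intro: homeomorphism_cont1)
    then have "B \<inter> (S \<inter> f -` ball 0 (real n)) \<in> sets borel" using B by auto
    also have "B \<inter> (S \<inter> f -` ball 0 (real n)) = C n" using B by (auto simp: C_def)
    finally show ?thesis .
  qed
  have incC: "incseq C" by (auto simp: C_def incseq_def)
  have UC: "(\<Union>n. C n) = B"
    unfolding C_def by (auto simp: reals_Archimedean2)
  have step: "emeasure lborel (f ` C n) = (\<integral>\<^sup>+x\<in>C n. ennreal \<bar>det (matrix (f' x))\<bar> \<partial>lborel)" for n
  proof (rule emeasure_image_finite)
    have "emeasure lborel (f ` C n) \<le> emeasure lborel (ball (0::real^'n) (real n))"
      using imgB[OF C_sets C_sub] by (intro emeasure_mono) (auto simp: C_def)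
    also have "\<dots> < \<infinity>" using emeasure_bounded_finite[of "ball (0::real^'n) (real n)"] by simp
    finally show "emeasure lborel (f ` C n) < \<infinity>" .
    show "inj_on f (C n)" using inj C_sub by (rule inj_on_subset)
    show "(f has_derivative f' x) (at x)" if "x \<in> C n" for x
      using that C_sub der by blast
  qed (use C_sets imgB[OF C_sets C_sub] dm[OF C_sets C_sub] in auto)
  have "emeasure lborel (f ` B) = emeasure lborel (\<Union>n. f ` C n)" by (simp add: UC flip: image_UN)
  also have "\<dots> = (SUP n. emeasure lborel (f ` C n))"
    using imgB[OF C_sets C_sub] incC
    by (intro SUP_emeasure_incseq[symmetric]) (auto simp: incseq_def intro!: imageI)
  also have "\<dots> = (SUP n. \<integral>\<^sup>+x\<in>C n. ennreal \<bar>det (matrix (f' x))\<bar> \<partial>lborel)" by (simp add: step)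
  also have "\<dots> = (\<integral>\<^sup>+x. (SUP n. ennreal \<bar>det (matrix (f' x))\<bar> * indicator (C n) x) \<partial>lborel)"
    using dm[OF C_sets C_sub] incC
    by (intro nn_integral_monotone_convergence_SUP[symmetric])
       (auto simp: incseq_def le_fun_def indicator_def)
  also have "\<dots> = (\<integral>\<^sup>+x\<in>B. ennreal \<bar>det (matrix (f' x))\<bar> \<partial>lborel)"
  proof (intro nn_integral_cong)
    fix x
    have "(SUP n. indicator (C n) x) = (indicator (\<Union>n. C n) x :: ennreal)"
    proof (cases "x \<in> (\<Union>n. C n)")
      case True
      then obtain n where "x \<in> C n" by auto
      then have "(1::ennreal) \<le> (SUP n. indicator (C n) x)" by (intro SUP_upper2[of n]) auto
      with True show ?thesis by (auto intro!: antisym SUP_least simp: indicator_def)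
    qed auto
    then show "(SUP n. ennreal \<bar>det (matrix (f' x))\<bar> * indicator (C n) x) = ennreal \<bar>det (matrix (f' x))\<bar> * indicator B x"
      by (simp add: UC SUP_mult_left_ennreal[symmetric])
  qed
  finally show "emeasure lborel (f ` B) = (\<integral>\<^sup>+x\<in>B. ennreal \<bar>det (matrix (f' x))\<bar> \<partial>lborel)" .
qed

text \<open>
  \<open>emeasure_diffeo_image\<close> says that \<open>f\<close> pushes the measure with density \<open>\<bar>det f'\<bar>\<close> on \<open>S\<close> forward to Lebesgue
  measure on \<open>T\<close>; integrating \<open>k\<close> against both sides gives the substitution rule.
\<close>

lemma nn_integral_diffeo_image:
  fixes f :: "real ^ 'n::finite \<Rightarrow> real ^ 'n" and k :: "real ^ 'n \<Rightarrow> ennreal"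
  assumes S: "open S" and T: "open T" and hom: "homeomorphism S T f h"
    and der: "\<And>x. x \<in> S \<Longrightarrow> (f has_derivative f' x) (at x)"
    and cont: "continuous_on S (\<lambda>x. det (matrix (f' x)))"
    and B: "B \<in> sets borel" "B \<subseteq> S"
    and k: "k \<in> borel_measurable (restrict_space borel T)"
  shows "(\<integral>\<^sup>+y\<in>f ` B. k y \<partial>lborel) = (\<integral>\<^sup>+x\<in>B. k (f x) * ennreal \<bar>det (matrix (f' x))\<bar> \<partial>lborel)"
proof -
  define J where "J x = ennreal \<bar>det (matrix (f' x))\<bar> * indicator S x" for x
  have fT: "f ` S = T" using hom by (simp add: homeomorphism_def)
  have Sb [measurable]: "S \<in> sets borel" "T \<in> sets borel" using S T by auto
  have Jm [measurable]: "J \<in> borel_measurable borel"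
  proof -
    have "(\<lambda>x. det (matrix (f' x))) \<in> borel_measurable (restrict_space borel S)"
      using cont by (rule borel_measurable_continuous_on_restrict)
    then have "(\<lambda>x. ennreal \<bar>det (matrix (f' x))\<bar>) \<in> borel_measurable (restrict_space borel S)" by measurable
    then show ?thesis
      unfolding J_def using Sb by (subst (asm) borel_measurable_restrict_space_iff_ennreal) (auto simp: mult.commute)
  qed
  \<comment> \<open>a Borel measurable extension of \<open>f\<close> to the whole space\<close>
  define F where "F x = (if x \<in> S then f x else 0)" for x
  have [measurable]: "F \<in> borel_measurable borel"
    unfolding F_def
    using S hom by (intro borel_measurable_continuous_on_if) (auto intro: homeomorphism_cont1)
  have eq: "distr (density lborel J) borel F = density lborel (indicator T)"
  proof (rule measure_eqI)
    fix X assume "X \<in> sets (distr (density lborel J) borel F)"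
    then have X [measurable]: "X \<in> sets borel" by simp
    have b: "S \<inter> F -` X \<in> sets borel" using measurable_sets[OF \<open>F \<in> _\<close> X] by auto
    have "emeasure (distr (density lborel J) borel F) X = (\<integral>\<^sup>+x\<in>F -` X. J x \<partial>lborel)"
      using measurable_sets[OF \<open>F \<in> _\<close> X] by (simp add: emeasure_distr emeasure_density)
    also have "\<dots> = (\<integral>\<^sup>+x\<in>S \<inter> F -` X. ennreal \<bar>det (matrix (f' x))\<bar> \<partial>lborel)"
      by (intro nn_integral_cong) (auto simp: J_def indicator_def)
    also have "\<dots> = emeasure lborel (f ` (S \<inter> F -` X))"
      using emeasure_diffeo_image[OF S T hom der cont b] by auto
    also have "f ` (S \<inter> F -` X) = T \<inter> X" using fT by (auto simp: F_def)
    also have "emeasure lborel (T \<inter> X) = emeasure (density lborel (indicator T)) X"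
      by (subst emeasure_density) (auto simp: nn_integral_indicator[symmetric] indicator_inter_arith simp del: nn_integral_indicator)
    finally show "emeasure (distr (density lborel J) borel F) X = emeasure (density lborel (indicator T)) X" .
  qed simp
  have fB: "f ` B \<in> sets borel" using emeasure_diffeo_image(1)[OF S T hom der cont B] by auto
  define K where "K y = k y * indicator (f ` B) y" for y
  have [measurable]: "K \<in> borel_measurable borel"
  proof -
    have "(\<lambda>y. k y * indicator T y) \<in> borel_measurable borel"
      using k Sb by (subst (asm) borel_measurable_restrict_space_iff_ennreal) (auto simp: mult.commute)
    then have "(\<lambda>y. k y * indicator T y * indicator (f ` B) y) \<in> borel_measurable borel" using fB by measurable
    also have "(\<lambda>y. k y * indicator T y * indicator (f ` B) y) = K"
      using fT B by (auto simp: K_def indicator_def fun_eq_iff)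
    finally show ?thesis .
  qed
  have "(\<integral>\<^sup>+y\<in>f ` B. k y \<partial>lborel) = (\<integral>\<^sup>+y. K y \<partial>density lborel (indicator T))"
  proof -
    have "k y * indicator (f ` B) y = indicator T y * K y" for y
      using fT B by (auto simp: K_def indicator_def)
    then show ?thesis by (subst nn_integral_density) auto
  qed
  also have "\<dots> = (\<integral>\<^sup>+x. J x * K (F x) \<partial>lborel)"
    by (subst eq[symmetric]) (simp add: nn_integral_distr nn_integral_density)
  also have "\<dots> = (\<integral>\<^sup>+x\<in>B. k (f x) * ennreal \<bar>det (matrix (f' x))\<bar> \<partial>lborel)"
  proof (intro nn_integral_cong)
    fix x
    have "inj_on f S" by (rule inj_on_inverseI[of _ h]) (rule homeomorphism_apply1[OF hom])
    then have "x \<in> S \<Longrightarrow> f x \<in> f ` B \<longleftrightarrow> x \<in> B" using B by (simp add: inj_on_image_mem_iff)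
    then show "J x * K (F x) = k (f x) * ennreal \<bar>det (matrix (f' x))\<bar> * indicator B x"
      using B by (auto simp: J_def K_def F_def indicator_def mult.commute)
  qed
  finally show ?thesis .
qed

section \<open>Riemannian volume\<close>

locale riemannian =
  fixes A :: "('m::{t2_space, second_countable_topology}, 'n::finite) chart set"
    and g :: "('m, 'n) metric_tensor"
  assumes manifold: "riemannian_manifold A g"
begin

text \<open>
  \<open>chart_vol c B\<close> is the value that a Riemannian volume must assign to \<open>B\<close> if \<open>B\<close> lies in the domain of \<open>c\<close>;
  \<open>chart_measure c\<close> is a measure on the manifold with these values.
\<close>

definition chart_vol :: "('m, 'n) chart \<Rightarrow> 'm set \<Rightarrow> ennreal" where
  "chart_vol c B = (\<integral>\<^sup>+x\<in>snd c ` B. ennreal (sqrt (det (g c (chart_inv c x)))) \<partial>lborel)"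

definition chart_measure :: "('m, 'n) chart \<Rightarrow> 'm measure" where
  "chart_measure c = distr (density lborel
      (\<lambda>x. ennreal (sqrt (det (g c (chart_inv c x)))) * indicator (snd c ` fst c) x)) borel
      (\<lambda>x. if x \<in> snd c ` fst c then chart_inv c x else undefined)"

lemma chart: assumes "c \<in> A"
  shows open_chart: "open (fst c)" and open_chart_image: "open (snd c ` fst c)"
    and chart_homeomorphism: "homeomorphism (fst c) (snd c ` fst c) (snd c) (chart_inv c)"
    and chart_inv: "\<And>p. p \<in> fst c \<Longrightarrow> chart_inv c (snd c p) = p"
proof -
  have "is_chart c" using manifold assms by (auto simp: riemannian_manifold_def smooth_atlas_def)
  then show 1: "open (fst c)" "open (snd c ` fst c)"
    and 2: "homeomorphism (fst c) (snd c ` fst c) (snd c) (chart_inv c)"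
    by (auto simp: is_chart_def)
  show "chart_inv c (snd c p) = p" if "p \<in> fst c" for p
    using homeomorphism_apply1[OF 2 that] .
qed

lemma charts_cover: "\<exists>c\<in>A. p \<in> fst c"
  using manifold by (auto simp: riemannian_manifold_def smooth_atlas_def)

lemma smooth_id: "smooth_map A id" and pullback_id: "pullback_eq A g id"
  using manifold by (auto simp: riemannian_manifold_def smooth_atlas_def riemannian_metric_def)

lemma continuous_gram: "c \<in> A \<Longrightarrow> continuous_on (snd c ` fst c) (\<lambda>x. g c (chart_inv c x))"
  using manifold unfolding riemannian_manifold_def riemannian_metric_def smooth_on_def
  by (metis Ck_on.simps(1))

lemma continuous_on_det:
  fixes M :: "'x::topological_space \<Rightarrow> real ^ 'k ^ 'k::finite"
  assumes "continuous_on S M"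
  shows "continuous_on S (\<lambda>x. det (M x))"
  unfolding det_def using assms by (intro continuous_intros)

lemma borel_chart_image:
  assumes c: "c \<in> A" and B: "B \<in> sets borel" "B \<subseteq> fst c"
  shows "snd c ` B \<in> sets borel"
proof -
  have "snd c ` B = chart_inv c -` B \<inter> snd c ` fst c"
    using B(2) chart_inv[OF c] by (auto simp: subset_iff)
  also have "\<dots> = chart_inv c -` B \<inter> space (restrict_space borel (snd c ` fst c))"
    by (simp add: space_restrict_space)
  also have "\<dots> \<in> sets (restrict_space borel (snd c ` fst c))"
    using chart_homeomorphism[OF c] B(1)
    by (intro measurable_sets[OF borel_measurable_continuous_on_restrict]) (rule homeomorphism_cont2)
  finally show ?thesis
    using open_chart_image[OF c] by (subst (asm) sets_restrict_space_iff) auto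
qed

lemma volume_density_measurable:
  assumes c: "c \<in> A"
  shows "(\<lambda>x. ennreal (sqrt (det (g c (chart_inv c x))))) \<in> borel_measurable (restrict_space borel (snd c ` fst c))"
proof -
  have "continuous_on (snd c ` fst c) (\<lambda>x. sqrt (det (g c (chart_inv c x))))"
    by (intro continuous_intros continuous_on_det continuous_gram c)
  then show ?thesis
    by (intro measurable_compose[OF borel_measurable_continuous_on_restrict measurable_ennreal])
qed

lemma volume_density_measurable':
  assumes c: "c \<in> A"
  shows "(\<lambda>x. ennreal (sqrt (det (g c (chart_inv c x)))) * indicator (snd c ` fst c) x) \<in> borel_measurable borel"
  using volume_density_measurable[OF c] open_chart_image[OF c]
  by (subst (asm) borel_measurable_restrict_space_iff_ennreal) (auto simp: mult.commute)

lemma sets_chart_measure [simp]: "sets (chart_measure c) = sets borel"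
  by (simp add: chart_measure_def)

lemma emeasure_chart_measure:
  assumes c: "c \<in> A" and B: "B \<in> sets borel" "B \<subseteq> fst c"
  shows "emeasure (chart_measure c) B = chart_vol c B"
proof -
  let ?h = "\<lambda>x. if x \<in> snd c ` fst c then chart_inv c x else undefined"
  have h: "?h \<in> borel_measurable borel"
    using open_chart_image[OF c] chart_homeomorphism[OF c]
    by (intro borel_measurable_continuous_on_if) (auto intro: homeomorphism_cont2)
  have m: "?h -` B \<in> sets borel" using measurable_sets[OF h B(1)] by simp
  have "emeasure (chart_measure c) B = (\<integral>\<^sup>+x\<in>?h -` B. (ennreal (sqrt (det (g c (chart_inv c x)))) * indicator (snd c ` fst c) x) \<partial>lborel)"
    unfolding chart_measure_def using h B m volume_density_measurable'[OF c]
    by (subst emeasure_distr) (auto simp: emeasure_density)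
  also have "\<dots> = chart_vol c B"
    unfolding chart_vol_def
  proof (intro nn_integral_cong)
    fix x
    have "x \<in> snd c ` fst c \<and> ?h x \<in> B \<longleftrightarrow> x \<in> snd c ` B"
      using B(2) chart_inv[OF c] by auto
    then show "ennreal (sqrt (det (g c (chart_inv c x)))) * indicator (snd c ` fst c) x * indicator (?h -` B) x =
       ennreal (sqrt (det (g c (chart_inv c x)))) * indicator (snd c ` B) x"
      by (auto simp: indicator_def)
  qed
  finally show ?thesis .
qed

text \<open>
  The coordinate representation of a diffeomorphism \<open>F\<close> is a diffeomorphism between open sets, so that
  the substitution rule applies to it. The case \<open>F = id\<close> covers the changes of charts.
\<close>

lemma coord_rep_diffeo:
  assumes F: "bij F" "smooth_map A F" "smooth_map A (inv F)" and c: "c \<in> A" "c' \<in> A"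
  defines "S \<equiv> snd c ` (fst c \<inter> F -` fst c')"
    and "T \<equiv> snd c' ` (fst c' \<inter> inv F -` fst c)"
  shows "open S" "open T" "homeomorphism S T (coord_rep c c' F) (coord_rep c' c (inv F))"
    "\<And>x. x \<in> S \<Longrightarrow> (coord_rep c c' F has_derivative frechet_derivative (coord_rep c c' F) (at x)) (at x)"
    "\<And>v. continuous_on S (\<lambda>x. frechet_derivative (coord_rep c c' F) (at x) v)"
proof -
  have opn: "open (snd d ` (fst d \<inter> G -` fst d'))" if "d \<in> A" "d' \<in> A" "smooth_map A G" for d d' G
  proof -
    have "open (G -` fst d')"
      using that open_chart[OF \<open>d' \<in> A\<close>] by (auto simp: smooth_map_def intro: open_vimage)
    then have "openin (top_of_set (fst d)) (fst d \<inter> G -` fst d')"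
      by (auto simp: openin_open)
    then have "openin (top_of_set (snd d ` fst d)) (snd d ` (fst d \<inter> G -` fst d'))"
      using homeomorphism_imp_open_map[OF chart_homeomorphism[OF \<open>d \<in> A\<close>]] by blast
    then show ?thesis
      using open_chart_image[OF \<open>d \<in> A\<close>] openin_open_trans by blast
  qed
  show "open S" "open T" using opn[OF c F(2)] opn[OF c(2,1) F(3)] by (auto simp: S_def T_def)
  have sm: "smooth_on S (coord_rep c c' F)" "smooth_on T (coord_rep c' c (inv F))"
    using F c unfolding smooth_map_def S_def T_def by blast+
  then have C0: "continuous_on S (coord_rep c c' F)" "continuous_on T (coord_rep c' c (inv F))"
    unfolding smooth_on_def by (metis Ck_on.simps(1))+
  have "Ck_on (Suc 0) S (coord_rep c c' F)" using sm by (auto simp: smooth_on_def)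
  then show "\<And>x. x \<in> S \<Longrightarrow> (coord_rep c c' F has_derivative frechet_derivative (coord_rep c c' F) (at x)) (at x)"
    "\<And>v. continuous_on S (\<lambda>x. frechet_derivative (coord_rep c c' F) (at x) v)"
    by (auto simp: frechet_derivative_works[symmetric])
  have inv: "inv F (F p) = p" "F (inv F p) = p" for p
    using F(1) by (auto simp: bij_is_inj bij_is_surj surj_f_inv_f)
  show "homeomorphism S T (coord_rep c c' F) (coord_rep c' c (inv F))"
  proof (rule homeomorphismI[OF C0])
    show "coord_rep c c' F ` S \<subseteq> T"
      using chart_inv[OF c(1)] chart_inv[OF c(2)] inv by (auto simp: S_def T_def coord_rep_def)
    show "coord_rep c' c (inv F) ` T \<subseteq> S"
      using chart_inv[OF c(1)] chart_inv[OF c(2)] inv by (auto simp: S_def T_def coord_rep_def)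
  qed (use chart_inv[OF c(1)] chart_inv[OF c(2)] inv in \<open>auto simp: S_def T_def coord_rep_def\<close>)
qed

text \<open>
  Taking determinants in the pullback equation gives \<open>det g = (det J)\<^sup>2 det g'\<close>, so the factor \<open>\<bar>det J\<bar>\<close> in the
  substitution rule turns one volume density into the other. For \<open>F = id\<close> this says that the volume does
  not depend on the chart, for an isometry that it is invariant.
\<close>

lemma chart_vol_image:
  assumes F: "bij F" "smooth_map A F" "smooth_map A (inv F)" "pullback_eq A g F"
    and c: "c \<in> A" "c' \<in> A" and X: "X \<in> sets borel" "X \<subseteq> fst c" "X \<subseteq> F -` fst c'"
  shows "chart_vol c' (F ` X) = chart_vol c X"
proof -
  define S where "S = snd c ` (fst c \<inter> F -` fst c')"
  define T where "T = snd c' ` (fst c' \<inter> inv F -` fst c)"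
  define f where "f = coord_rep c c' F"
  define f' where "f' x = frechet_derivative f (at x)" for x
  note d = coord_rep_diffeo[OF F(1-3) c, folded S_def T_def f_def, folded f'_def]
  have cdet: "continuous_on S (\<lambda>x. det (matrix (f' x)))"
    unfolding matrix_def using d(5) by (intro continuous_on_det continuous_intros) 
  have XS: "snd c ` X \<subseteq> S" using X by (auto simp: S_def)
  have im: "f ` (snd c ` X) = snd c' ` (F ` X)"
    using X(2) chart_inv[OF c(1)] by (force simp: f_def coord_rep_def image_image subset_iff)
  have "T \<subseteq> snd c' ` fst c'" by (auto simp: T_def)
  then have km: "(\<lambda>x. ennreal (sqrt (det (g c' (chart_inv c' x))))) \<in> borel_measurable (restrict_space borel T)"
    using volume_density_measurable[OF c(2)] by (rule measurable_restrict_mono[rotated])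
  have "chart_vol c' (F ` X) = (\<integral>\<^sup>+y\<in>f ` (snd c ` X). ennreal (sqrt (det (g c' (chart_inv c' y)))) \<partial>lborel)"
    unfolding im chart_vol_def ..
  also have "\<dots> = (\<integral>\<^sup>+x\<in>snd c ` X. ennreal (sqrt (det (g c' (chart_inv c' (f x))))) * ennreal \<bar>det (matrix (f' x))\<bar> \<partial>lborel)"
    by (rule nn_integral_diffeo_image[OF d(1-3) _ cdet borel_chart_image[OF c(1) X(1,2)] XS km]) (rule d(4))
  also have "\<dots> = chart_vol c X"
    unfolding chart_vol_def
  proof (intro nn_integral_cong)
    fix x
    show "ennreal (sqrt (det (g c' (chart_inv c' (f x))))) * ennreal \<bar>det (matrix (f' x))\<bar> * indicator (snd c ` X) x =
       ennreal (sqrt (det (g c (chart_inv c x)))) * indicator (snd c ` X) x"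
    proof (cases "x \<in> snd c ` X")
      case True
      then obtain p where p: "p \<in> X" "x = snd c p" by auto
      have pc: "p \<in> fst c" "F p \<in> fst c'" using p X by auto
      have fx: "chart_inv c' (f x) = F p"
        using pc chart_inv[OF c(1)] chart_inv[OF c(2)] by (simp add: f_def coord_rep_def p(2))
      have J: "coord_jacobian c c' F p = matrix (f' x)"
        by (simp add: coord_jacobian_def f_def f'_def p(2))
      have "g c p = transpose (matrix (f' x)) ** g c' (F p) ** matrix (f' x)"
        using F(4) c pc unfolding pullback_eq_def J[symmetric] by blast
      then have "det (g c p) = (det (matrix (f' x)))\<^sup>2 * det (g c' (F p))"
        by (simp add: det_mul power2_eq_square)
      then have "sqrt (det (g c p)) = \<bar>det (matrix (f' x))\<bar> * sqrt (det (g c' (F p)))"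
        by (simp add: real_sqrt_mult)
      then show ?thesis
        unfolding fx using pc chart_inv[OF c(1)] by (simp add: p(2) ennreal_mult'' mult.commute)
    qed simp
  qed
  finally show ?thesis .
qed

definition is_volume :: "'m measure \<Rightarrow> bool" where
  "is_volume \<mu> \<longleftrightarrow> sets \<mu> = sets borel \<and> (\<forall>c\<in>A. \<forall>B\<in>sets borel. B \<subseteq> fst c \<longrightarrow> emeasure \<mu> B = chart_vol c B)"

text \<open>
  By second countability countably many charts suffice; making their domains disjoint gives a partition
  of the manifold into Borel cells, on each of which one chart determines the volume. Uniqueness follows
  at once, and existence by adding up the chart measures on the cells.
\<close>

lemma ex_countable_charts: "\<exists>f :: nat \<Rightarrow> ('m, 'n) chart. range f \<subseteq> A \<and> (\<Union>i. fst (f i)) = UNIV"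
proof -
  obtain \<F> where \<F>: "\<F> \<subseteq> fst ` A" "countable \<F>" "\<Union>\<F> = \<Union>(fst ` A)"
    using Lindelof[of "fst ` A"] open_chart by blast
  obtain A' where A': "A' \<subseteq> A" "countable A'" "fst ` A' = \<F>"
    using countable_subset_image \<F>(1,2) by metis
  have cov: "(\<Union>c\<in>A'. fst c) = UNIV" using \<F>(3) A'(3) charts_cover by auto
  then have "A' \<noteq> {}" by auto
  then have r: "range (from_nat_into A') = A'" by (rule range_from_nat_into[OF _ A'(2)])
  have "(\<Union>i. fst (from_nat_into A' i)) = \<Union> (fst ` range (from_nat_into A'))" by auto
  then show ?thesis using A'(1) cov r by (intro exI[of _ "from_nat_into A'"]) auto
qed

definition cover_chart :: "nat \<Rightarrow> ('m, 'n) chart" where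
  "cover_chart = (SOME f. range f \<subseteq> A \<and> (\<Union>i. fst (f i)) = UNIV)"

definition cell :: "nat \<Rightarrow> 'm set" where "cell = disjointed (\<lambda>i. fst (cover_chart i))"

lemma cover_chart: "cover_chart i \<in> A" "(\<Union>i. fst (cover_chart i)) = UNIV"
  using someI_ex[OF ex_countable_charts] unfolding cover_chart_def by blast+

lemma cell: "disjoint_family cell" "(\<Union>i. cell i) = UNIV" "cell i \<in> sets borel" "cell i \<subseteq> fst (cover_chart i)"
proof -
  show "disjoint_family cell" "(\<Union>i. cell i) = UNIV"
    by (simp_all add: cell_def disjoint_family_disjointed UN_disjointed_eq cover_chart)
  show "cell i \<subseteq> fst (cover_chart i)" unfolding cell_def by (rule disjointed_subset)
  have "range (\<lambda>i. fst (cover_chart i)) \<subseteq> sets borel" using open_chart[OF cover_chart(1)] by auto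
  then show "cell i \<in> sets borel" unfolding cell_def by (meson range_subsetD sets.range_disjointed_sets)
qed

lemma emeasure_split_cells:
  assumes "sets \<mu> = sets borel" "B \<in> sets borel"
  shows "emeasure \<mu> B = (\<Sum>i. emeasure \<mu> (B \<inter> cell i))"
proof -
  have "emeasure \<mu> (\<Union>i. B \<inter> cell i) = (\<Sum>i. emeasure \<mu> (B \<inter> cell i))"
    using assms cell by (intro suminf_emeasure[symmetric]) (auto simp: disjoint_family_on_def)
  also have "(\<Union>i. B \<inter> cell i) = B" using cell(2) by auto
  finally show ?thesis .
qed

lemma volume_unique: assumes "is_volume \<mu>" "is_volume \<nu>" shows "\<mu> = \<nu>"
proof (rule measure_eqI)
  show "sets \<mu> = sets \<nu>" using assms by (auto simp: is_volume_def)
  fix B assume "B \<in> sets \<mu>"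
  then have B: "B \<in> sets borel" using assms by (auto simp: is_volume_def)
  have "emeasure \<mu> (B \<inter> cell i) = emeasure \<nu> (B \<inter> cell i)" for i
  proof -
    have "B \<inter> cell i \<in> sets borel" "B \<inter> cell i \<subseteq> fst (cover_chart i)" using B cell(3,4)[of i] by auto
    then show ?thesis using assms cover_chart(1)[of i] unfolding is_volume_def by metis
  qed
  then show "emeasure \<mu> B = emeasure \<nu> B"
    using emeasure_split_cells[OF _ B] assms by (metis (no_types, lifting) is_volume_def suminf_cong)
qed

text \<open>
  This one computation is used twice: for \<open>F = id\<close> it shows that the measure glued together from the cells
  has the right values in every chart, and for an isometry \<open>F\<close> that the pushed forward volume has them.
\<close>

lemma sum_chart_vol_image:
  assumes F: "bij F" "smooth_map A F" "smooth_map A (inv F)" "pullback_eq A g F"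
    and c: "c \<in> A" and B: "B \<in> sets borel" "B \<subseteq> fst c"
  shows "(\<Sum>i. chart_vol (cover_chart i) (F ` B \<inter> cell i)) = chart_vol c B"
proof -
  have contF: "F \<in> borel_measurable borel"
    using F(2) by (intro borel_measurable_continuous_onI) (simp add: smooth_map_def)
  have m: "B \<inter> F -` cell i \<in> sets borel" for i
    using measurable_sets[OF contF cell(3)[of i]] B by auto
  have "chart_vol (cover_chart i) (F ` B \<inter> cell i) = emeasure (chart_measure c) (B \<inter> F -` cell i)" for i
  proof -
    have "chart_vol (cover_chart i) (F ` (B \<inter> F -` cell i)) = chart_vol c (B \<inter> F -` cell i)"
      using B cell(4)[of i] by (intro chart_vol_image[OF F c cover_chart(1) m]) auto
    moreover have "F ` B \<inter> cell i = F ` (B \<inter> F -` cell i)" by auto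
    ultimately show ?thesis
      using B by (subst emeasure_chart_measure[OF c m]) auto
  qed
  then have "(\<Sum>i. chart_vol (cover_chart i) (F ` B \<inter> cell i)) = (\<Sum>i. emeasure (chart_measure c) (B \<inter> F -` cell i))"
    by simp
  also have "\<dots> = emeasure (chart_measure c) (\<Union>i. B \<inter> F -` cell i)"
    using cell m by (intro suminf_emeasure) (auto simp: disjoint_family_on_def)
  also have "(\<Union>i. B \<inter> F -` cell i) = B"
  proof -
    have "F p \<in> (\<Union>i. cell i)" for p using cell(2) by simp
    then show ?thesis by auto
  qed
  finally show ?thesis using emeasure_chart_measure[OF c B] by simp
qed

lemma volume_exists: "\<exists>\<mu>. is_volume \<mu>"
proof -
  define v where "v B = (\<Sum>i. emeasure (chart_measure (cover_chart i)) (B \<inter> cell i))" for B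
  define \<mu> where "\<mu> = measure_of UNIV (sets borel) v"
  have sets: "sets \<mu> = sets (borel :: 'm measure)"
    unfolding \<mu>_def using sets.sigma_sets_eq[of "borel :: 'm measure"] by (simp add: sets_measure_of)
  have ca: "countably_additive (sets \<mu>) v"
  proof (rule countably_additiveI)
    fix X :: "nat \<Rightarrow> 'm set"
    assume X: "range X \<subseteq> sets \<mu>" "disjoint_family X"
    have 1: "emeasure (chart_measure (cover_chart i)) (\<Union> (range X) \<inter> cell i) = (\<Sum>j. emeasure (chart_measure (cover_chart i)) (X j \<inter> cell i))" for i
    proof -
      have "(\<Sum>j. emeasure (chart_measure (cover_chart i)) (X j \<inter> cell i)) = emeasure (chart_measure (cover_chart i)) (\<Union>j. X j \<inter> cell i)"
        using X cell sets by (intro suminf_emeasure) (auto simp: disjoint_family_on_def)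
      moreover have "\<Union> (range X) \<inter> cell i = (\<Union>j. X j \<inter> cell i)" by blast
      ultimately show ?thesis by metis
    qed
    show "(\<Sum>i. v (X i)) = v (\<Union> (range X))"
      unfolding v_def 1
      by (subst (1 3) nn_integral_count_space_nat[symmetric]) (simp add: nn_integral_suminf)
  qed
  have em: "emeasure \<mu> B = v B" if "B \<in> sets borel" for B
    using that ca sets
    by (intro emeasure_measure_of[OF \<mu>_def]) (auto simp: positive_def v_def sets.sets_into_space)
  have "emeasure \<mu> B = chart_vol c B" if c: "c \<in> A" and B: "B \<in> sets borel" "B \<subseteq> fst c" for c B
  proof -
    have "emeasure \<mu> B = (\<Sum>i. chart_vol (cover_chart i) (id ` B \<inter> cell i))"
      unfolding em[OF B(1)] v_def using B cell
      by (intro suminf_cong) (simp add: emeasure_chart_measure cover_chart le_infI2)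
    also have "\<dots> = chart_vol c B"
      by (rule sum_chart_vol_image) (use smooth_id pullback_id c B in \<open>auto simp: inv_id\<close>)
    finally show ?thesis .
  qed
  then have "is_volume \<mu>" using sets by (auto simp: is_volume_def)
  then show ?thesis ..
qed

lemma is_volume_riem_volume: "is_volume (riem_volume A g)"
proof -
  have "riem_volume A g = (THE \<mu>. is_volume \<mu>)"
    unfolding riem_volume_def is_volume_def chart_vol_def ..
  moreover obtain \<mu> where \<mu>: "is_volume \<mu>" using volume_exists ..
  then have "is_volume (THE \<mu>. is_volume \<mu>)"
    by (rule theI) (rule volume_unique[OF _ \<mu>])
  ultimately show ?thesis by simp
qed

lemma sets_riem_volume: "sets (riem_volume A g) = sets borel"
  using is_volume_riem_volume by (simp add: is_volume_def)

lemma space_riem_volume: "space (riem_volume A g) = UNIV"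
  using sets_eq_imp_space_eq[OF sets_riem_volume] by simp

lemma riem_volume_singleton: "emeasure (riem_volume A g) {p} = 0"
proof -
  obtain c where c: "c \<in> A" "p \<in> fst c" using charts_cover by blast
  then have "emeasure (riem_volume A g) {p} = chart_vol c {p}"
    using is_volume_riem_volume by (auto simp: is_volume_def)
  also have "\<dots> = 0"
  proof -
    have "AE x in lborel. ennreal (sqrt (det (g c (chart_inv c x)))) * indicator (snd c ` {p}) x = 0"
      by (rule AE_I'[of "{snd c p}"]) (auto simp: indicator_def)
    then show ?thesis unfolding chart_vol_def by (simp add: nn_integral_0_iff_AE nn_integral_cong_AE)
  qed
  finally show ?thesis .
qed

text \<open>
  The image measure of the volume under \<open>inv F\<close> has the same densities in all charts as the volume itself.
\<close>

lemma isometry_volume: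
  assumes F: "riemannian_isometry A g F" and B: "B \<in> sets borel"
  shows "F ` B \<in> sets borel" "emeasure (riem_volume A g) (F ` B) = emeasure (riem_volume A g) B"
proof -
  have F': "bij F" "smooth_map A F" "smooth_map A (inv F)" "pullback_eq A g F"
    using F unfolding riemannian_isometry_def by blast+
  have m: "inv F \<in> borel_measurable borel"
    using F'(3) by (intro borel_measurable_continuous_onI) (simp add: smooth_map_def)
  have im: "F ` X = inv F -` X" for X 
  proof -
    have "inv F (F p) = p" "F (inv F p) = p" for p
      using F'(1) by (auto simp: bij_is_inj bij_is_surj surj_f_inv_f)
    note inv = this
    show ?thesis
    proof (intro subset_antisym subsetI)
      show "q \<in> F ` X" if "q \<in> inv F -` X" for q
        using that inv(2)[of q] by (intro image_eqI[of _ _ "inv F q"]) auto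
    qed (auto simp: inv)
  qed
  have imB: "F ` X \<in> sets borel" if "X \<in> sets borel" for X unfolding im using measurable_sets[OF m that] by simp
  define \<mu> where "\<mu> = distr (riem_volume A g) borel (inv F)"
  have em: "emeasure \<mu> X = emeasure (riem_volume A g) (F ` X)" if "X \<in> sets borel" for X
    unfolding \<mu>_def im using that m
    by (subst emeasure_distr) (auto simp: space_riem_volume measurable_cong_sets[OF sets_riem_volume])
  have "is_volume \<mu>"
    unfolding is_volume_def
  proof (intro conjI ballI impI)
    show "sets \<mu> = sets borel" by (simp add: \<mu>_def)
    fix c X assume c: "c \<in> A" and X: "X \<in> sets (borel :: 'm measure)" "X \<subseteq> fst c"
    have "emeasure \<mu> X = (\<Sum>i. emeasure (riem_volume A g) (F ` X \<inter> cell i))"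
      unfolding em[OF X(1)] using imB[OF X(1)] by (rule emeasure_split_cells[OF sets_riem_volume])
    also have "\<dots> = (\<Sum>i. chart_vol (cover_chart i) (F ` X \<inter> cell i))"
      using is_volume_riem_volume imB[OF X(1)] cover_chart cell by (intro suminf_cong) (auto simp: is_volume_def le_infI2)
    also have "\<dots> = chart_vol c X" by (rule sum_chart_vol_image[OF F' c X])
    finally show "emeasure \<mu> X = chart_vol c X" .
  qed
  then have "\<mu> = riem_volume A g" using volume_unique is_volume_riem_volume by blast
  then show "emeasure (riem_volume A g) (F ` B) = emeasure (riem_volume A g) B"
    using em[OF B] by simp
  show "F ` B \<in> sets borel" using imB B .
qed

end

section \<open>Lengths of curves and isometries\<close>

text \<open>
  Lengths of curves are integrals of the speed, which is only controlled away from the break points.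
  Since integrals of nonnegative functions are suprema over simple functions, the inequalities needed
  for reparametrising and splitting the domain hold for arbitrary integrands, in particular for the speed.
\<close>

lemma nn_integral_distr_le:
  assumes T: "T \<in> measurable N M"
  shows "nn_integral (distr N M T) f \<le> nn_integral N (\<lambda>x. f (T x))"
  unfolding nn_integral_def[of "distr N M T"]
proof (rule SUP_least)
  fix h assume "h \<in> {g. simple_function (distr N M T) g \<and> g \<le> f}"
  then have h: "simple_function (distr N M T) h" "h \<le> f" by auto
  have hm: "h \<in> borel_measurable M" using borel_measurable_simple_function[OF h(1)] by simp
  have "integral\<^sup>S (distr N M T) h = nn_integral (distr N M T) h"
    by (rule nn_integral_eq_simple_integral[symmetric, OF h(1)])
  also have "\<dots> = nn_integral N (\<lambda>x. h (T x))" using T hm by (subst nn_integral_distr) auto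
  also have "\<dots> \<le> nn_integral N (\<lambda>x. f (T x))"
    using h(2) by (intro nn_integral_mono) (auto simp: le_fun_def)
  finally show "integral\<^sup>S (distr N M T) h \<le> nn_integral N (\<lambda>x. f (T x))" .
qed

lemma nn_integral_split_le:
  assumes A: "A \<in> sets M"
  shows "nn_integral M f \<le> (\<integral>\<^sup>+x\<in>A. f x \<partial>M) + (\<integral>\<^sup>+x\<in>space M - A. f x \<partial>M)"
  unfolding nn_integral_def[of M f]
proof (rule SUP_least)
  fix h assume "h \<in> {g. simple_function M g \<and> g \<le> f}"
  then have h: "simple_function M h" "h \<le> f" by auto
  have hm [measurable]: "h \<in> borel_measurable M" using borel_measurable_simple_function[OF h(1)] .
  have "integral\<^sup>S M h = nn_integral M h"
    by (rule nn_integral_eq_simple_integral[symmetric, OF h(1)])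
  also have "\<dots> = (\<integral>\<^sup>+x. h x * indicator A x + h x * indicator (space M - A) x \<partial>M)"
    by (intro nn_integral_cong) (auto simp: indicator_def)
  also have "\<dots> = (\<integral>\<^sup>+x\<in>A. h x \<partial>M) + (\<integral>\<^sup>+x\<in>space M - A. h x \<partial>M)"
    using A by (intro nn_integral_add) auto
  also have "\<dots> \<le> (\<integral>\<^sup>+x\<in>A. f x \<partial>M) + (\<integral>\<^sup>+x\<in>space M - A. f x \<partial>M)"
    using h(2) by (intro add_mono nn_integral_mono mult_right_mono) (auto simp: le_fun_def)
  finally show "integral\<^sup>S M h \<le> (\<integral>\<^sup>+x\<in>A. f x \<partial>M) + (\<integral>\<^sup>+x\<in>space M - A. f x \<partial>M)" .
qed

lemma AE_lborel_finite: "finite (T :: real set) \<Longrightarrow> AE s in lborel. s \<notin> T"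
  by (rule AE_not_in) (simp add: finite_imp_null_set_lborel)

context riemannian
begin

definition qform :: "('m, 'n) chart \<Rightarrow> 'm \<Rightarrow> real ^ 'n \<Rightarrow> real" where
  "qform c p w = w \<bullet> (g c p *v w)"

definition chart_deriv :: "('m, 'n) chart \<Rightarrow> ('m, 'n) chart \<Rightarrow> ('m \<Rightarrow> 'm) \<Rightarrow> 'm \<Rightarrow> real ^ 'n \<Rightarrow> real ^ 'n" where
  "chart_deriv c c' F p = frechet_derivative (coord_rep c c' F) (at (snd c p))"

lemma qform_pullback:
  assumes F: "bij F" "smooth_map A F" "smooth_map A (inv F)" "pullback_eq A g F"
    and c: "c \<in> A" "c' \<in> A" and p: "p \<in> fst c" "F p \<in> fst c'"
  shows "qform c' (F p) (chart_deriv c c' F p w) = qform c p w"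
proof -
  define M where "M = coord_jacobian c c' F p"
  have "snd c p \<in> snd c ` (fst c \<inter> F -` fst c')" using p by auto
  then have "linear (chart_deriv c c' F p)"
    unfolding chart_deriv_def using coord_rep_diffeo(4)[OF F(1-3) c] has_derivative_linear by blast
  then have M: "M *v w = chart_deriv c c' F p w"
    unfolding M_def coord_jacobian_def chart_deriv_def[symmetric] by (rule fun_cong[OF matrix_vector_mul(2)])
  have "g c p = transpose M ** g c' (F p) ** M"
    using F(4) c p unfolding pullback_eq_def M_def by blast
  then have "qform c p w = w \<bullet> (transpose M *v (g c' (F p) *v (M *v w)))"
    by (simp add: qform_def matrix_vector_mul_assoc matrix_mul_assoc)
  also have "\<dots> = (M *v w) \<bullet> (g c' (F p) *v (M *v w))"
    by (metis dot_lmul_matrix inner_commute transpose_matrix_vector)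
  finally show ?thesis by (simp add: qform_def M)
qed

lemma qform_scale: "qform c p (r *\<^sub>R w) = r\<^sup>2 * qform c p w"
  by (simp add: qform_def matrix_vector_mult_scaleR power2_eq_square)

text \<open>
  Chain rule for the image of a curve, one-sided at the end points of an interval.
\<close>

lemma chart_deriv_curve:
  assumes F: "bij F" "smooth_map A F" "smooth_map A (inv F)"
    and c: "c \<in> A" "c' \<in> A" and p: "\<gamma> s \<in> fst c" "F (\<gamma> s) \<in> fst c'"
    and cont: "continuous (at s within I) \<gamma>" and s: "s \<in> I"
    and der: "((snd c \<circ> \<gamma>) has_vector_derivative w) (at s within I)"
  shows "((snd c' \<circ> (F \<circ> \<gamma>)) has_vector_derivative chart_deriv c c' F (\<gamma> s) w) (at s within I)"
proof -
  have x: "snd c (\<gamma> s) \<in> snd c ` (fst c \<inter> F -` fst c')" using p by auto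
  have d: "(coord_rep c c' F has_derivative chart_deriv c c' F (\<gamma> s)) (at ((snd c \<circ> \<gamma>) s))"
    unfolding chart_deriv_def using coord_rep_diffeo(4)[OF F c x] by simp
  have lin: "linear (chart_deriv c c' F (\<gamma> s))" using d has_derivative_linear by blast
  have "((coord_rep c c' F \<circ> (snd c \<circ> \<gamma>)) has_derivative (chart_deriv c c' F (\<gamma> s) \<circ> (\<lambda>h. h *\<^sub>R w))) (at s within I)"
    using der unfolding has_vector_derivative_def
    by (rule diff_chain_within) (rule has_derivative_at_withinI[OF d])
  then have "((coord_rep c c' F \<circ> (snd c \<circ> \<gamma>)) has_vector_derivative chart_deriv c c' F (\<gamma> s) w) (at s within I)"
    using lin by (simp add: has_vector_derivative_def o_def linear_scale)
  moreover have "\<forall>\<^sub>F u in at s within I. (coord_rep c c' F \<circ> (snd c \<circ> \<gamma>)) u = (snd c' \<circ> (F \<circ> \<gamma>)) u"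
  proof -
    have "\<forall>\<^sub>F u in at s within I. \<gamma> u \<in> fst c"
      using cont open_chart[OF c(1)] p(1) unfolding continuous_within by (rule topological_tendstoD)
    then show ?thesis
      by eventually_elim (simp add: coord_rep_def chart_inv[OF c(1)])
  qed
  moreover have "(coord_rep c c' F \<circ> (snd c \<circ> \<gamma>)) s = (snd c' \<circ> (F \<circ> \<gamma>)) s"
    using p(1) by (simp add: coord_rep_def chart_inv[OF c(1)])
  ultimately show ?thesis
    unfolding has_vector_derivative_def by (rule has_derivative_transform_eventually[OF _ _ _ s])
qed

text \<open>
  The choice of a chart in the definition of the speed is immaterial by \<open>qform_pullback\<close> with \<open>F = id\<close>.
\<close>

lemma speed_eq:
  assumes c: "c \<in> A" "\<gamma> s \<in> fst c" and cont: "isCont \<gamma> s"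
    and der: "((snd c \<circ> \<gamma>) has_vector_derivative w) (at s)"
  shows "speed A g \<gamma> s = sqrt (qform c (\<gamma> s) w)"
proof -
  define c0 where "c0 = (SOME c. c \<in> A \<and> \<gamma> s \<in> fst c)"
  have c0: "c0 \<in> A" "\<gamma> s \<in> fst c0"
    using someI_ex[of "\<lambda>c. c \<in> A \<and> \<gamma> s \<in> fst c"] charts_cover[of "\<gamma> s"] unfolding c0_def by blast+
  have id: "bij id" "smooth_map A id" "smooth_map A (inv id)" "pullback_eq A g id"
    using smooth_id pullback_id by (auto simp: inv_id)
  have "((snd c0 \<circ> (id \<circ> \<gamma>)) has_vector_derivative chart_deriv c c0 id (\<gamma> s) w) (at s)"
    by (rule chart_deriv_curve[OF id(1-3) c(1) c0(1)]) (use c c0 cont der in auto)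
  then have "vector_derivative (snd c0 \<circ> \<gamma>) (at s) = chart_deriv c c0 id (\<gamma> s) w"
    by (intro vector_derivative_at) simp
  then have "speed A g \<gamma> s = sqrt (qform c0 (id (\<gamma> s)) (chart_deriv c c0 id (\<gamma> s) w))"
    by (simp add: speed_def qform_def Let_def flip: c0_def)
  also have "\<dots> = sqrt (qform c (\<gamma> s) w)"
    using c c0 by (subst qform_pullback[OF id c(1) c0(1)]) auto
  finally show ?thesis .
qed

definition regular_at :: "(real \<Rightarrow> 'm) \<Rightarrow> real \<Rightarrow> bool" where
  "regular_at \<gamma> s \<longleftrightarrow> isCont \<gamma> s \<and> (\<forall>c\<in>A. \<gamma> s \<in> fst c \<longrightarrow> (\<exists>w. ((snd c \<circ> \<gamma>) has_vector_derivative w) (at s)))"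

lemma C1_curve_velocity:
  assumes "C1_curve A \<gamma> a b" "c \<in> A"
  obtains D where "continuous_on {s\<in>{a..b}. \<gamma> s \<in> fst c} D"
    "\<forall>s\<in>{a..b}. \<gamma> s \<in> fst c \<longrightarrow> ((snd c \<circ> \<gamma>) has_vector_derivative D s) (at s within {a..b})"
proof -
  have "\<exists>D. continuous_on {s\<in>{a..b}. \<gamma> s \<in> fst c} D \<and>
    (\<forall>s\<in>{a..b}. \<gamma> s \<in> fst c \<longrightarrow> ((snd c \<circ> \<gamma>) has_vector_derivative D s) (at s within {a..b}))"
    using assms unfolding C1_curve_def by simp
  then show ?thesis by (elim exE conjE) (rule that)
qed

lemma piecewise_C1_breaks:
  assumes "piecewise_C1_curve A \<gamma> a b"
  obtains T where "finite T"
    "\<forall>u v. a \<le> u \<and> u < v \<and> v \<le> b \<and> {u<..<v} \<inter> T = {} \<longrightarrow> C1_curve A \<gamma> u v"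
  using assms unfolding piecewise_C1_curve_def by (elim conjE exE) (rule that)

lemma C1_regular_at:
  assumes "C1_curve A \<gamma> a b" "a < s" "s < b"
  shows "regular_at \<gamma> s"
proof -
  have at: "at s within {a..b} = at s"
    using assms by (intro at_within_interior) auto
  have s: "s \<in> {a..b}" using assms by auto
  have cont: "continuous_on {a..b} \<gamma>"
    and der: "\<And>c. c \<in> A \<Longrightarrow> \<exists>D. \<forall>s\<in>{a..b}. \<gamma> s \<in> fst c \<longrightarrow> ((snd c \<circ> \<gamma>) has_vector_derivative D s) (at s within {a..b})"
    using assms(1) unfolding C1_curve_def by blast+
  have "continuous (at s within {a..b}) \<gamma>"
    using cont s by (simp add: continuous_on_eq_continuous_within)
  then have "isCont \<gamma> s" by (simp add: at)
  moreover have "\<exists>w. ((snd c \<circ> \<gamma>) has_vector_derivative w) (at s)" if "c \<in> A" "\<gamma> s \<in> fst c" for c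
    using der[OF that(1)] s that(2) unfolding at[symmetric] by blast
  ultimately show ?thesis by (simp add: regular_at_def)
qed

lemma piecewise_regular_at:
  assumes "piecewise_C1_curve A \<gamma> a b"
  obtains T where "finite T" "\<And>s. s \<in> {a..b} \<Longrightarrow> s \<notin> T \<Longrightarrow> a < s \<and> s < b \<and> regular_at \<gamma> s"
proof -
  obtain T where T: "finite T"
    "\<And>u v. a \<le> u \<Longrightarrow> u < v \<Longrightarrow> v \<le> b \<Longrightarrow> {u<..<v} \<inter> T = {} \<Longrightarrow> C1_curve A \<gamma> u v"
    using assms unfolding piecewise_C1_curve_def by blast
  show ?thesis
  proof (rule that[of "insert a (insert b T)"])
    show "finite (insert a (insert b T))" using T by simp
    fix s assume s: "s \<in> {a..b}" "s \<notin> insert a (insert b T)"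
    then have ab: "a < s" "s < b" by auto
    have "open ({a<..<b} - T)" using T(1) by (intro open_Diff finite_imp_closed) auto
    moreover have "s \<in> {a<..<b} - T" using s ab by auto
    ultimately obtain e where e: "e > 0" "ball s e \<subseteq> {a<..<b} - T" using openE by blast
    have sub: "{s - e/2..s + e/2} \<subseteq> ball s e" using e(1) by (auto simp: dist_real_def)
    have "s - e/2 \<in> ball s e" "s + e/2 \<in> ball s e" using e(1) by (auto simp: dist_real_def)
    then have "s - e/2 \<in> {a<..<b}" "s + e/2 \<in> {a<..<b}" using e by blast+
    moreover have "{s - e/2<..<s + e/2} \<subseteq> {s - e/2..s + e/2}" by auto
    then have "{s - e/2<..<s + e/2} \<inter> T = {}" using sub e(2) by blast
    ultimately have "C1_curve A \<gamma> (s - e/2) (s + e/2)" using e(1) by (intro T(2)) auto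
    then have "regular_at \<gamma> s" by (rule C1_regular_at) (use e(1) in auto)
    with ab show "a < s \<and> s < b \<and> regular_at \<gamma> s" by simp
  qed
qed

text \<open>
  A curve that is \<open>C\<^sup>1\<close> in one chart around each parameter is \<open>C\<^sup>1\<close> in all charts, also after applying a
  diffeomorphism: locally the new velocity is the Jacobian applied to the old one. The assumption is local
  so that the lemma also applies to segments in a single chart.
\<close>

lemma C1_curve_image:
  assumes F: "bij F" "smooth_map A F" "smooth_map A (inv F)"
    and ab: "a < b" and cont: "continuous_on {a..b} \<gamma>"
    and loc: "\<And>s0. s0 \<in> {a..b} \<Longrightarrow> \<exists>c\<in>A. \<exists>V D. open V \<and> s0 \<in> V \<and> continuous_on (V \<inter> {a..b}) D \<and>
       (\<forall>s\<in>V \<inter> {a..b}. \<gamma> s \<in> fst c \<and> ((snd c \<circ> \<gamma>) has_vector_derivative D s) (at s within {a..b}))"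
  shows "C1_curve A (F \<circ> \<gamma>) a b"
  unfolding C1_curve_def
proof (intro conjI ballI)
  have contF: "continuous_on UNIV F" using F(2) by (simp add: smooth_map_def)
  show "continuous_on {a..b} (F \<circ> \<gamma>)"
    using cont contF by (meson continuous_on_compose continuous_on_subset subset_UNIV)
  fix c' assume c': "c' \<in> A"
  \<comment> \<open>defined without reference to a chart, so that the local formulas fit together\<close>
  define D' where "D' s = vector_derivative (snd c' \<circ> (F \<circ> \<gamma>)) (at s within {a..b})" for s
  define W where "W = {s \<in> {a..b}. (F \<circ> \<gamma>) s \<in> fst c'}"
  have cw: "continuous (at s within {a..b}) \<gamma>" if "s \<in> {a..b}" for s
    using cont that by (simp add: continuous_on_eq_continuous_within)
  have main: "((snd c' \<circ> (F \<circ> \<gamma>)) has_vector_derivative D' s0) (at s0 within {a..b}) \<and> continuous (at s0 within W) D'"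
    if s0: "s0 \<in> W" for s0
  proof -
    have "s0 \<in> {a..b}" using s0 by (simp add: W_def)
    define Q where "Q c V D \<longleftrightarrow> open V \<and> s0 \<in> V \<and> continuous_on (V \<inter> {a..b}) D \<and>
       (\<forall>s\<in>V \<inter> {a..b}. \<gamma> s \<in> fst c \<and> ((snd c \<circ> \<gamma>) has_vector_derivative D s) (at s within {a..b}))" for c :: "('m, 'n) chart" and V D
    have "\<exists>c\<in>A. \<exists>V D. Q c V D"
      unfolding Q_def by (rule loc) fact
    then obtain c V D where c: "c \<in> A" and Q: "Q c V D" by auto
    have V: "open V" "s0 \<in> V" and D: "continuous_on (V \<inter> {a..b}) D"
      using Q by (simp_all add: Q_def)
    have der: "\<gamma> s \<in> fst c" "((snd c \<circ> \<gamma>) has_vector_derivative D s) (at s within {a..b})"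
      if "s \<in> V \<inter> {a..b}" for s
      using Q that unfolding Q_def by simp_all
    have pd: "((snd c' \<circ> (F \<circ> \<gamma>)) has_vector_derivative chart_deriv c c' F (\<gamma> s) (D s)) (at s within {a..b})"
      if "s \<in> V \<inter> W" for s
      using that by (intro chart_deriv_curve[OF F c c' _ _ cw] der) (auto simp: W_def der)
    have D'_eq: "D' s = chart_deriv c c' F (\<gamma> s) (D s)" if "s \<in> V \<inter> W" for s
      unfolding D'_def using pd[OF that] that ab
      by (intro vector_derivative_within_closed_interval) (auto simp: W_def)
    have lin: "linear (chart_deriv c c' F (\<gamma> s))" if "s \<in> V \<inter> W" for s
    proof -
      have "snd c (\<gamma> s) \<in> snd c ` (fst c \<inter> F -` fst c')" using that der(1)[of s] by (auto simp: W_def)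
      then show ?thesis unfolding chart_deriv_def
        using coord_rep_diffeo(4)[OF F c c'] has_derivative_linear by blast
    qed
    have expand: "D' s = (\<Sum>i\<in>UNIV. (D s $ i) *\<^sub>R chart_deriv c c' F (\<gamma> s) (axis i 1))" if "s \<in> V \<inter> W" for s
    proof -
      have "D s = (\<Sum>i\<in>UNIV. (D s $ i) *\<^sub>R axis i 1)"
        by (simp add: basis_expansion scalar_mult_eq_scaleR[symmetric])
      then have "chart_deriv c c' F (\<gamma> s) (D s) = chart_deriv c c' F (\<gamma> s) (\<Sum>i\<in>UNIV. (D s $ i) *\<^sub>R axis i 1)"
        by simp
      also have "\<dots> = (\<Sum>i\<in>UNIV. (D s $ i) *\<^sub>R chart_deriv c c' F (\<gamma> s) (axis i 1))"
        using lin[OF that] by (simp add: linear_sum linear_scale)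
      finally show ?thesis using D'_eq[OF that] by simp
    qed
    have "continuous_on (V \<inter> W) (\<lambda>s. snd c (\<gamma> s))"
    proof (rule continuous_on_compose2[of "fst c" "snd c"])
      show "continuous_on (fst c) (snd c)" using chart_homeomorphism[OF c] by (rule homeomorphism_cont1)
      show "continuous_on (V \<inter> W) \<gamma>" using cont by (rule continuous_on_subset) (auto simp: W_def)
    qed (use der in \<open>auto simp: W_def\<close>)
    then have "continuous_on (V \<inter> W) (\<lambda>s. chart_deriv c c' F (\<gamma> s) v)" for v
      unfolding chart_deriv_def
      by (rule continuous_on_compose2[OF coord_rep_diffeo(5)[OF F c c', of v]]) (use der in \<open>auto simp: W_def\<close>)
    moreover have "continuous_on (V \<inter> W) D" using D by (rule continuous_on_subset) (auto simp: W_def)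
    ultimately have "continuous_on (V \<inter> W) (\<lambda>s. \<Sum>i\<in>UNIV. (D s $ i) *\<^sub>R chart_deriv c c' F (\<gamma> s) (axis i 1))"
      by (intro continuous_intros)
    then have "continuous_on (V \<inter> W) D'" by (subst continuous_on_cong[OF refl expand]) auto
    then have "continuous (at s0 within V \<inter> W) D'"
      using s0 V by (simp add: continuous_on_eq_continuous_within)
    moreover have "at s0 within V \<inter> W = at s0 within W"
      using V by (intro at_within_nhd[of _ V]) auto
    moreover have "((snd c' \<circ> (F \<circ> \<gamma>)) has_vector_derivative D' s0) (at s0 within {a..b})"
      using pd[of s0] D'_eq[of s0] s0 V by simp
    ultimately show ?thesis by simp
  qed
  show "\<exists>D. continuous_on {s \<in> {a..b}. (F \<circ> \<gamma>) s \<in> fst c'} D \<and>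
      (\<forall>s\<in>{a..b}. (F \<circ> \<gamma>) s \<in> fst c' \<longrightarrow> ((snd c' \<circ> (F \<circ> \<gamma>)) has_vector_derivative D s) (at s within {a..b}))"
  proof (intro exI[of _ D'] conjI ballI impI)
    show "continuous_on {s \<in> {a..b}. (F \<circ> \<gamma>) s \<in> fst c'} D'"
      unfolding W_def[symmetric] continuous_on_eq_continuous_within using main by blast
    show "((snd c' \<circ> (F \<circ> \<gamma>)) has_vector_derivative D' s) (at s within {a..b})"
      if "s \<in> {a..b}" "(F \<circ> \<gamma>) s \<in> fst c'" for s
      using main[of s] that unfolding W_def by blast
  qed
qed

lemma C1_curve_compose:
  assumes F: "bij F" "smooth_map A F" "smooth_map A (inv F)"
    and ab: "a < b" and \<gamma>: "C1_curve A \<gamma> a b"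
  shows "C1_curve A (F \<circ> \<gamma>) a b"
proof (rule C1_curve_image[OF F ab])
  show cont: "continuous_on {a..b} \<gamma>" using \<gamma> by (simp add: C1_curve_def)
  fix s0 assume s0: "s0 \<in> {a..b}"
  obtain c where c: "c \<in> A" "\<gamma> s0 \<in> fst c" using charts_cover by blast
  obtain V where V: "open V" "V \<inter> {a..b} = \<gamma> -` fst c \<inter> {a..b}"
    using cont open_chart[OF c(1)] unfolding continuous_on_open_invariant by blast
  obtain D where D: "continuous_on {s\<in>{a..b}. \<gamma> s \<in> fst c} D"
    "\<forall>s\<in>{a..b}. \<gamma> s \<in> fst c \<longrightarrow> ((snd c \<circ> \<gamma>) has_vector_derivative D s) (at s within {a..b})"
    by (rule C1_curve_velocity[OF \<gamma> c(1)]) (rule that)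
  have W: "{s\<in>{a..b}. \<gamma> s \<in> fst c} = V \<inter> {a..b}" using V(2) by blast
  have mem: "s \<in> {a..b} \<and> \<gamma> s \<in> fst c" if "s \<in> V \<inter> {a..b}" for s using that W by blast
  show "\<exists>c\<in>A. \<exists>V D. open V \<and> s0 \<in> V \<and> continuous_on (V \<inter> {a..b}) D \<and>
       (\<forall>s\<in>V \<inter> {a..b}. \<gamma> s \<in> fst c \<and> ((snd c \<circ> \<gamma>) has_vector_derivative D s) (at s within {a..b}))"
  proof (intro bexI[of _ c] exI[of _ V] exI[of _ D] conjI ballI)
    show "s0 \<in> V" using W s0 c(2) by blast
    show "continuous_on (V \<inter> {a..b}) D" using D(1) unfolding W .
    show "\<gamma> s \<in> fst c" "((snd c \<circ> \<gamma>) has_vector_derivative D s) (at s within {a..b})"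
      if "s \<in> V \<inter> {a..b}" for s
      using mem[OF that] D(2) by blast+
  qed (fact V c)+
qed

lemma isometry_curve:
  assumes F: "riemannian_isometry A g F" and \<gamma>: "piecewise_C1_curve A \<gamma> a b"
  shows "piecewise_C1_curve A (F \<circ> \<gamma>) a b" "curve_length A g (F \<circ> \<gamma>) a b = curve_length A g \<gamma> a b"
proof -
  have F': "bij F" "smooth_map A F" "smooth_map A (inv F)" "pullback_eq A g F"
    using F by (auto simp: riemannian_isometry_def)
  have contF: "continuous_on UNIV F" using F'(2) by (simp add: smooth_map_def)
  show "piecewise_C1_curve A (F \<circ> \<gamma>) a b"
    unfolding piecewise_C1_curve_def
  proof
    show "continuous_on {a..b} (F \<circ> \<gamma>)"
      using \<gamma> contF unfolding piecewise_C1_curve_def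
      by (meson continuous_on_compose continuous_on_subset subset_UNIV)
    obtain T where T: "finite T"
      "\<forall>u v. a \<le> u \<and> u < v \<and> v \<le> b \<and> {u<..<v} \<inter> T = {} \<longrightarrow> C1_curve A \<gamma> u v"
      by (rule piecewise_C1_breaks[OF \<gamma>]) (rule that)
    have "C1_curve A (F \<circ> \<gamma>) u v" if "a \<le> u \<and> u < v \<and> v \<le> b \<and> {u<..<v} \<inter> T = {}" for u v
      using C1_curve_compose[OF F'(1-3), of u v \<gamma>] T(2) that by simp
    with T(1) show "\<exists>T. finite T \<and>
        (\<forall>u v. a \<le> u \<and> u < v \<and> v \<le> b \<and> {u<..<v} \<inter> T = {} \<longrightarrow> C1_curve A (F \<circ> \<gamma>) u v)"
      by (intro exI[of _ T]) simp
  qed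
  obtain T where T: "finite T" "\<And>s. s \<in> {a..b} \<Longrightarrow> s \<notin> T \<Longrightarrow> a < s \<and> s < b \<and> regular_at \<gamma> s"
    by (rule piecewise_regular_at[OF \<gamma>]) (rule that)
  have "speed A g (F \<circ> \<gamma>) s = speed A g \<gamma> s" if reg: "regular_at \<gamma> s" for s
  proof -
    obtain c where c: "c \<in> A" "\<gamma> s \<in> fst c" using charts_cover by blast
    obtain c' where c': "c' \<in> A" "F (\<gamma> s) \<in> fst c'" using charts_cover by blast
    obtain w where w: "((snd c \<circ> \<gamma>) has_vector_derivative w) (at s)" using reg c unfolding regular_at_def by blast
    have cont: "isCont \<gamma> s" using reg by (simp add: regular_at_def)
    have contF': "isCont (F \<circ> \<gamma>) s"
      using cont contF unfolding o_def by (intro isCont_o2[OF cont]) (simp add: continuous_on_eq_continuous_at)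
    have "((snd c' \<circ> (F \<circ> \<gamma>)) has_vector_derivative chart_deriv c c' F (\<gamma> s) w) (at s)"
      by (rule chart_deriv_curve[OF F'(1-3) c(1) c'(1)]) (use c c' w cont in auto)
    then have "speed A g (F \<circ> \<gamma>) s = sqrt (qform c' (F (\<gamma> s)) (chart_deriv c c' F (\<gamma> s) w))"
      using speed_eq[OF c'(1) _ contF'] c' by simp
    also have "\<dots> = speed A g \<gamma> s"
      using qform_pullback[OF F' c(1) c'(1) c(2) c'(2)] speed_eq[OF c cont w] by simp
    finally show ?thesis .
  qed
  note speed_image = this
  show "curve_length A g (F \<circ> \<gamma>) a b = curve_length A g \<gamma> a b"
    unfolding curve_length_def
  proof (rule nn_integral_cong_AE, rule eventually_mono[OF AE_lborel_finite[OF T(1)]])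
    fix s assume "s \<notin> T"
    then show "ennreal (speed A g (F \<circ> \<gamma>) s) * indicator {a..b} s = ennreal (speed A g \<gamma> s) * indicator {a..b} s"
      using T(2)[of s] speed_image[of s] by (cases "s \<in> {a..b}") simp_all
  qed
qed

text \<open>
  An isometry maps a curve to one of the same length. The inequality is all that the comparison of balls
  requires, since homogeneity provides isometries in both directions.
\<close>

lemma isometry_riem_dist_le:
  assumes F: "riemannian_isometry A g F"
  shows "riem_dist A g (F x) (F y) \<le> riem_dist A g x y"
  unfolding riem_dist_def[of A g x y]
proof (rule Inf_greatest, clarify)
  fix \<gamma> a b assume *: "a \<le> b" "piecewise_C1_curve A \<gamma> a b" "x = \<gamma> a" "y = \<gamma> b"
  then show "riem_dist A g (F (\<gamma> a)) (F (\<gamma> b)) \<le> curve_length A g \<gamma> a b"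
    using isometry_curve[OF F *(2)] unfolding riem_dist_def
    by (intro Inf_lower CollectI exI[of _ "F \<circ> \<gamma>"] exI[of _ a] exI[of _ b]) auto
qed

lemma riem_dist_le:
  "a \<le> b \<Longrightarrow> piecewise_C1_curve A \<gamma> a b \<Longrightarrow> \<gamma> a = x \<Longrightarrow> \<gamma> b = y \<Longrightarrow> riem_dist A g x y \<le> curve_length A g \<gamma> a b"
  unfolding riem_dist_def by (intro Inf_lower) auto

section \<open>Riemannian distance\<close>

text \<open>
  Reversal and translation of the parameter are treated together as \<open>s \<mapsto> \<sigma> s + \<tau>\<close> with \<open>\<bar>\<sigma>\<bar> = 1\<close>: the first
  gives the symmetry of the distance, the second allows curves to be joined for the triangle inequality.
\<close>

lemma C1_curve_affine:
  assumes \<gamma>: "C1_curve A \<gamma> a b" and \<phi>: "\<And>s. s \<in> {a'..b'} \<Longrightarrow> \<sigma> * s + \<tau> \<in> {a..b}"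
  shows "C1_curve A (\<lambda>s. \<gamma> (\<sigma> * s + \<tau>)) a' b'"
  unfolding C1_curve_def
proof (intro conjI ballI)
  let ?\<phi> = "\<lambda>s. \<sigma> * s + \<tau>"
  have cont\<phi>: "continuous_on I ?\<phi>" for I by (intro continuous_intros)
  show "continuous_on {a'..b'} (\<lambda>s. \<gamma> (\<sigma> * s + \<tau>))"
    by (rule continuous_on_compose2[OF _ cont\<phi>, of "{a..b}"]) (use \<gamma> \<phi> in \<open>auto simp: C1_curve_def\<close>)
  fix c assume c: "c \<in> A"
  obtain D where D: "continuous_on {s\<in>{a..b}. \<gamma> s \<in> fst c} D"
    "\<forall>s\<in>{a..b}. \<gamma> s \<in> fst c \<longrightarrow> ((snd c \<circ> \<gamma>) has_vector_derivative D s) (at s within {a..b})"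
    by (rule C1_curve_velocity[OF \<gamma> c]) (rule that)
  show "\<exists>D. continuous_on {s \<in> {a'..b'}. \<gamma> (?\<phi> s) \<in> fst c} D \<and>
      (\<forall>s\<in>{a'..b'}. \<gamma> (?\<phi> s) \<in> fst c \<longrightarrow>
         ((snd c \<circ> (\<lambda>s. \<gamma> (?\<phi> s))) has_vector_derivative D s) (at s within {a'..b'}))"
  proof (intro exI[of _ "\<lambda>s. \<sigma> *\<^sub>R D (?\<phi> s)"] conjI ballI impI)
    have "continuous_on {s \<in> {a'..b'}. \<gamma> (?\<phi> s) \<in> fst c} (\<lambda>s. D (?\<phi> s))"
      by (rule continuous_on_compose2[OF D(1) cont\<phi>]) (use \<phi> in auto)
    then show "continuous_on {s \<in> {a'..b'}. \<gamma> (?\<phi> s) \<in> fst c} (\<lambda>s. \<sigma> *\<^sub>R D (?\<phi> s))"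
      by (intro continuous_intros)
    fix s assume s: "s \<in> {a'..b'}" "\<gamma> (?\<phi> s) \<in> fst c"
    have "((snd c \<circ> \<gamma>) has_vector_derivative D (?\<phi> s)) (at (?\<phi> s) within {a..b})"
      using D(2) \<phi>[OF s(1)] s(2) by blast
    then have "((snd c \<circ> \<gamma>) has_vector_derivative D (?\<phi> s)) (at (?\<phi> s) within ?\<phi> ` {a'..b'})"
      by (rule has_vector_derivative_within_subset) (use \<phi> in blast)
    moreover have "(?\<phi> has_vector_derivative \<sigma>) (at s within {a'..b'})"
      by (auto intro!: derivative_eq_intros simp: has_real_derivative_iff_has_vector_derivative[symmetric])
    ultimately have "((snd c \<circ> \<gamma>) \<circ> ?\<phi> has_vector_derivative \<sigma> *\<^sub>R D (?\<phi> s)) (at s within {a'..b'})"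
      by (intro vector_diff_chain_within)
    then show "((snd c \<circ> (\<lambda>s. \<gamma> (?\<phi> s))) has_vector_derivative \<sigma> *\<^sub>R D (?\<phi> s)) (at s within {a'..b'})"
      by (simp add: o_def)
  qed
qed

lemma piecewise_C1_curve_affine:
  assumes \<gamma>: "piecewise_C1_curve A \<gamma> a b" and \<sigma>: "\<bar>\<sigma>\<bar> = 1"
    and \<phi>: "\<And>s. s \<in> {a'..b'} \<longleftrightarrow> \<sigma> * s + \<tau> \<in> {a..b}"
  shows "piecewise_C1_curve A (\<lambda>s. \<gamma> (\<sigma> * s + \<tau>)) a' b'"
  unfolding piecewise_C1_curve_def
proof
  show "continuous_on {a'..b'} (\<lambda>s. \<gamma> (\<sigma> * s + \<tau>))"
    by (rule continuous_on_compose2[of "{a..b}" \<gamma>])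
      (use \<gamma> \<phi> in \<open>auto simp: piecewise_C1_curve_def intro!: continuous_intros\<close>)
  obtain T where T: "finite T"
    "\<forall>u v. a \<le> u \<and> u < v \<and> v \<le> b \<and> {u<..<v} \<inter> T = {} \<longrightarrow> C1_curve A \<gamma> u v"
    by (rule piecewise_C1_breaks[OF \<gamma>]) (rule that)
  let ?T = "(\<lambda>r. \<sigma> * (r - \<tau>)) ` T"
  have "C1_curve A (\<lambda>s. \<gamma> (\<sigma> * s + \<tau>)) u v"
    if uv: "a' \<le> u \<and> u < v \<and> v \<le> b' \<and> {u<..<v} \<inter> ?T = {}" for u v
  proof -
    let ?p = "min (\<sigma> * u + \<tau>) (\<sigma> * v + \<tau>)" and ?q = "max (\<sigma> * u + \<tau>) (\<sigma> * v + \<tau>)"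
    have pm: "\<sigma> = 1 \<or> \<sigma> = -1" using \<sigma> by linarith
    have "r \<notin> T" if "r \<in> {?p<..<?q}" for r
    proof
      assume "r \<in> T"
      then have "\<sigma> * (r - \<tau>) \<in> ?T" by blast
      moreover have "\<sigma> * (r - \<tau>) \<in> {u<..<v}" using that uv pm by auto
      ultimately show False using uv by blast
    qed
    then have 1: "?p < ?q \<and> {?p<..<?q} \<inter> T = {} \<and> (\<forall>s\<in>{u..v}. \<sigma> * s + \<tau> \<in> {?p..?q})"
      using uv pm by auto
    have "u \<in> {a'..b'}" "v \<in> {a'..b'}" using uv by auto
    then have "a \<le> ?p" "?q \<le> b" using \<phi>[of u] \<phi>[of v] by auto
    then have "C1_curve A \<gamma> ?p ?q" using T(2) 1 by blast
    then show ?thesis by (rule C1_curve_affine) (use 1 in blast)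
  qed
  then show "\<exists>T. finite T \<and> (\<forall>u v. a' \<le> u \<and> u < v \<and> v \<le> b' \<and> {u<..<v} \<inter> T = {} \<longrightarrow>
      C1_curve A (\<lambda>s. \<gamma> (\<sigma> * s + \<tau>)) u v)"
    using T(1) by (intro exI[of _ ?T]) simp
qed

lemma curve_length_affine_le:
  assumes \<gamma>: "piecewise_C1_curve A \<gamma> a b" and \<sigma>: "\<bar>\<sigma>\<bar> = 1"
    and \<phi>: "\<And>s. s \<in> {a'..b'} \<longleftrightarrow> \<sigma> * s + \<tau> \<in> {a..b}"
  shows "curve_length A g (\<lambda>s. \<gamma> (\<sigma> * s + \<tau>)) a' b' \<le> curve_length A g \<gamma> a b"
proof -
  let ?\<phi> = "\<lambda>s. \<sigma> * s + \<tau>" and ?\<psi> = "\<lambda>r. - \<sigma> * \<tau> + \<sigma> * r"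
  have \<sigma>2: "\<sigma> * \<sigma> = 1" using \<sigma> by (metis abs_mult_self_eq mult_1)
  have \<psi>\<phi>: "?\<phi> (?\<psi> r) = r" "?\<psi> (?\<phi> r) = r" for r
  proof -
    have "?\<phi> (?\<psi> r) = - (\<sigma> * \<sigma>) * \<tau> + (\<sigma> * \<sigma>) * r + \<tau>" by (simp add: algebra_simps)
    then show "?\<phi> (?\<psi> r) = r" by (simp add: \<sigma>2)
    have "?\<psi> (?\<phi> r) = (\<sigma> * \<sigma>) * r" by (simp add: algebra_simps)
    then show "?\<psi> (?\<phi> r) = r" by (simp add: \<sigma>2)
  qed
  obtain T where T: "finite T" "\<And>s. s \<in> {a..b} \<Longrightarrow> s \<notin> T \<Longrightarrow> a < s \<and> s < b \<and> regular_at \<gamma> s"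
    by (rule piecewise_regular_at[OF \<gamma>]) (rule that)
  have sp: "speed A g (\<lambda>s. \<gamma> (?\<phi> s)) s = speed A g \<gamma> (?\<phi> s)" if reg: "regular_at \<gamma> (?\<phi> s)" for s
  proof -
    obtain c where c: "c \<in> A" "\<gamma> (?\<phi> s) \<in> fst c" using charts_cover by blast
    obtain w where w: "((snd c \<circ> \<gamma>) has_vector_derivative w) (at (?\<phi> s))"
      using reg c unfolding regular_at_def by blast
    have cont: "isCont \<gamma> (?\<phi> s)" using reg by (simp add: regular_at_def)
    have "(?\<phi> has_vector_derivative \<sigma>) (at s)"
      by (auto intro!: derivative_eq_intros simp: has_real_derivative_iff_has_vector_derivative[symmetric])
    from vector_diff_chain_at[OF this w]
    have d: "((snd c \<circ> (\<lambda>s. \<gamma> (?\<phi> s))) has_vector_derivative \<sigma> *\<^sub>R w) (at s)" by (simp add: o_def)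
    have c': "isCont (\<lambda>s. \<gamma> (?\<phi> s)) s" 
    proof (rule isCont_o2[of s ?\<phi> \<gamma>])
      show "isCont ?\<phi> s" by (intro continuous_intros)
    qed (rule cont)
    have "speed A g (\<lambda>s. \<gamma> (?\<phi> s)) s = sqrt (qform c (\<gamma> (?\<phi> s)) (\<sigma> *\<^sub>R w))"
      using speed_eq[OF c(1) _ c' d] c(2) by simp
    also have "\<dots> = speed A g \<gamma> (?\<phi> s)"
      using speed_eq[OF c cont w] by (simp add: qform_scale \<sigma>2 power2_eq_square)
    finally show ?thesis .
  qed
  define f where "f r = ennreal (speed A g \<gamma> r) * indicator {a..b} r" for r
  have fin: "finite (?\<psi> ` T)" using T by simp
  have "curve_length A g (\<lambda>s. \<gamma> (?\<phi> s)) a' b' = (\<integral>\<^sup>+s. f (?\<phi> s) \<partial>lborel)"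
    unfolding curve_length_def
  proof (rule nn_integral_cong_AE, rule eventually_mono[OF AE_lborel_finite[OF fin]])
    fix s assume "s \<notin> ?\<psi> ` T"
    then have "?\<phi> s \<notin> T" using \<psi>\<phi>(2)[of s] by (metis image_eqI)
    then show "ennreal (speed A g (\<lambda>s. \<gamma> (?\<phi> s)) s) * indicator {a'..b'} s = f (?\<phi> s)"
      using T(2)[of "?\<phi> s"] \<phi>[of s] sp[of s] by (auto simp: f_def indicator_def)
  qed
  also have "\<dots> = (\<integral>\<^sup>+s. f (?\<phi> s) \<partial>distr lborel borel ?\<psi>)"
  proof -
    have "lborel = density (distr lborel borel ?\<psi>) (\<lambda>_. ennreal \<bar>\<sigma>\<bar>)"
      using lborel_real_affine[of \<sigma> "- \<sigma> * \<tau>"] \<sigma> by auto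
    also have "\<dots> = distr lborel borel ?\<psi>" by (simp add: \<sigma> density_1)
    finally show ?thesis by simp
  qed
  also have "\<dots> \<le> (\<integral>\<^sup>+r. f (?\<phi> (?\<psi> r)) \<partial>lborel)"
    by (rule nn_integral_distr_le) simp
  also have "\<dots> = curve_length A g \<gamma> a b"
    unfolding \<psi>\<phi> by (simp add: f_def curve_length_def)
  finally show ?thesis .
qed

lemma riem_dist_sym_le: "riem_dist A g y x \<le> riem_dist A g x y"
  unfolding riem_dist_def[of A g x y]
proof (rule Inf_greatest, clarify)
  fix \<gamma> a b assume *: "a \<le> b" "piecewise_C1_curve A \<gamma> a b" "x = \<gamma> a" "y = \<gamma> b"
  \<comment> \<open>run through the curve backwards\<close>
  have \<phi>: "s \<in> {a..b} \<longleftrightarrow> -1 * s + (a + b) \<in> {a..b}" for s by auto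
  have "riem_dist A g (\<gamma> b) (\<gamma> a) \<le> curve_length A g (\<lambda>s. \<gamma> (-1 * s + (a + b))) a b"
    by (rule riem_dist_le[OF *(1) piecewise_C1_curve_affine[OF *(2) _ \<phi>]]) auto
  also have "\<dots> \<le> curve_length A g \<gamma> a b"
    by (rule curve_length_affine_le[OF *(2) _ \<phi>]) simp
  finally show "riem_dist A g (\<gamma> b) (\<gamma> a) \<le> curve_length A g \<gamma> a b" .
qed

lemma riem_dist_sym: "riem_dist A g x y = riem_dist A g y x"
  by (intro antisym riem_dist_sym_le)

lemma C1_curve_cong:
  assumes "\<And>s. s \<in> {a..b} \<Longrightarrow> \<gamma> s = \<gamma>' s" and \<gamma>: "C1_curve A \<gamma> a b"
  shows "C1_curve A \<gamma>' a b"
  unfolding C1_curve_def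
proof (intro conjI ballI)
  show "continuous_on {a..b} \<gamma>'"
    using \<gamma> assms(1) unfolding C1_curve_def by (metis continuous_on_cong)
  fix c assume c: "c \<in> A"
  obtain D where D: "continuous_on {s\<in>{a..b}. \<gamma> s \<in> fst c} D"
    "\<forall>s\<in>{a..b}. \<gamma> s \<in> fst c \<longrightarrow> ((snd c \<circ> \<gamma>) has_vector_derivative D s) (at s within {a..b})"
    by (rule C1_curve_velocity[OF \<gamma> c]) (rule that)
  have e: "{s\<in>{a..b}. \<gamma> s \<in> fst c} = {s\<in>{a..b}. \<gamma>' s \<in> fst c}" using assms(1) by auto
  show "\<exists>D. continuous_on {s\<in>{a..b}. \<gamma>' s \<in> fst c} D \<and>
    (\<forall>s\<in>{a..b}. \<gamma>' s \<in> fst c \<longrightarrow> ((snd c \<circ> \<gamma>') has_vector_derivative D s) (at s within {a..b}))"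
  proof (intro exI[of _ D] conjI ballI impI)
    show "continuous_on {s\<in>{a..b}. \<gamma>' s \<in> fst c} D" using D(1) unfolding e .
    fix s assume s: "s \<in> {a..b}" "\<gamma>' s \<in> fst c"
    then have "((snd c \<circ> \<gamma>) has_vector_derivative D s) (at s within {a..b})" using D(2) assms(1) by simp
    then show "((snd c \<circ> \<gamma>') has_vector_derivative D s) (at s within {a..b})"
      by (rule has_vector_derivative_transform[OF s(1), rotated]) (simp add: assms(1))
  qed
qed

lemma speed_cong:
  assumes "\<forall>\<^sub>F u in nhds s. \<gamma> u = \<gamma>' u"
  shows "speed A g \<gamma> s = speed A g \<gamma>' s"
proof -
  have "\<gamma> s = \<gamma>' s" using assms by (rule eventually_nhds_x_imp_x)
  moreover have "vector_derivative (snd c \<circ> \<gamma>) (at s) = vector_derivative (snd c \<circ> \<gamma>') (at s)" for c :: "('m, 'n) chart"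
  proof (rule vector_derivative_cong_eq)
    show "\<forall>\<^sub>F u in nhds s. u \<in> UNIV \<longrightarrow> (snd c \<circ> \<gamma>) u = (snd c \<circ> \<gamma>') u"
      using assms by eventually_elim simp
  qed simp_all
  ultimately show ?thesis by (simp add: speed_def)
qed

lemma riem_dist_concat:
  assumes ab: "a \<le> b" "piecewise_C1_curve A \<gamma>1 a b" and be: "b \<le> e" "piecewise_C1_curve A \<gamma>2 b e"
    and join: "\<gamma>1 b = \<gamma>2 b"
  shows "riem_dist A g (\<gamma>1 a) (\<gamma>2 e) \<le> curve_length A g \<gamma>1 a b + curve_length A g \<gamma>2 b e"
proof -
  define \<gamma> where "\<gamma> s = (if s \<le> b then \<gamma>1 s else \<gamma>2 s)" for s
  have e1: "\<gamma>1 s = \<gamma> s" if "s \<le> b" for s using that by (simp add: \<gamma>_def)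
  have e2: "\<gamma>2 s = \<gamma> s" if "b \<le> s" for s using that join by (auto simp: \<gamma>_def)
  obtain T1 where T1: "finite T1"
    "\<forall>u v. a \<le> u \<and> u < v \<and> v \<le> b \<and> {u<..<v} \<inter> T1 = {} \<longrightarrow> C1_curve A \<gamma>1 u v"
    by (rule piecewise_C1_breaks[OF ab(2)]) (rule that)
  obtain T2 where T2: "finite T2"
    "\<forall>u v. b \<le> u \<and> u < v \<and> v \<le> e \<and> {u<..<v} \<inter> T2 = {} \<longrightarrow> C1_curve A \<gamma>2 u v"
    by (rule piecewise_C1_breaks[OF be(2)]) (rule that)
  have pw: "piecewise_C1_curve A \<gamma> a e"
    unfolding piecewise_C1_curve_def
  proof
    have "continuous_on {a..b} \<gamma>1" "continuous_on {b..e} \<gamma>2"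
      using ab be by (simp_all add: piecewise_C1_curve_def)
    then have "continuous_on {a..b} \<gamma>" "continuous_on {b..e} \<gamma>"
      by (subst continuous_on_cong[OF refl]; use e1 e2 in \<open>force\<close>)+
    then have "continuous_on ({a..b} \<union> {b..e}) \<gamma>" by (intro continuous_on_closed_Un) auto
    also have "{a..b} \<union> {b..e} = {a..e}" using ab be by auto
    finally show "continuous_on {a..e} \<gamma>" .
    have "C1_curve A \<gamma> u v"
      if uv: "a \<le> u \<and> u < v \<and> v \<le> e \<and> {u<..<v} \<inter> insert b (T1 \<union> T2) = {}" for u v
    proof -
      have "b \<notin> {u<..<v}" using uv by blast
      then consider "v \<le> b" | "b \<le> u" using uv by fastforce
      then show ?thesis
      proof cases
        case 1
        have "{u<..<v} \<inter> T1 = {}" using uv by blast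
        then have "C1_curve A \<gamma>1 u v" using T1(2) uv 1 by simp
        then show ?thesis by (rule C1_curve_cong[rotated]) (use 1 e1 in auto)
      next
        case 2
        have "{u<..<v} \<inter> T2 = {}" using uv by blast
        then have "C1_curve A \<gamma>2 u v" using T2(2) uv 2 by simp
        then show ?thesis by (rule C1_curve_cong[rotated]) (use 2 e2 in auto)
      qed
    qed
    then show "\<exists>T. finite T \<and> (\<forall>u v. a \<le> u \<and> u < v \<and> v \<le> e \<and> {u<..<v} \<inter> T = {} \<longrightarrow> C1_curve A \<gamma> u v)"
      using T1(1) T2(1) by (intro exI[of _ "insert b (T1 \<union> T2)"]) simp
  qed
  have s1: "speed A g \<gamma> s = speed A g \<gamma>1 s" if "s < b" for s
    by (rule speed_cong) (use eventually_nhds_in_open[of "{..<b}" s] that e1 in \<open>auto elim!: eventually_mono\<close>)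
  have s2: "speed A g \<gamma> s = speed A g \<gamma>2 s" if "s > b" for s
    by (rule speed_cong) (use eventually_nhds_in_open[of "{b<..}" s] that e2 in \<open>auto elim!: eventually_mono\<close>)
  have "riem_dist A g (\<gamma>1 a) (\<gamma>2 e) \<le> curve_length A g \<gamma> a e"
    by (rule riem_dist_le[OF _ pw]) (use ab be e1 e2 in auto)
  also have "\<dots> \<le> (\<integral>\<^sup>+s\<in>{..b}. (ennreal (speed A g \<gamma> s) * indicator {a..e} s) \<partial>lborel) +
      (\<integral>\<^sup>+s\<in>space lborel - {..b}. (ennreal (speed A g \<gamma> s) * indicator {a..e} s) \<partial>lborel)"
    unfolding curve_length_def by (rule nn_integral_split_le) simp
  also have "\<dots> = curve_length A g \<gamma>1 a b + curve_length A g \<gamma>2 b e"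
  proof (intro arg_cong2[where f = "(+)"])
    have AE: "AE s in lborel. s \<noteq> b" using AE_lborel_finite[of "{b}"] by simp
    show "(\<integral>\<^sup>+s\<in>{..b}. (ennreal (speed A g \<gamma> s) * indicator {a..e} s) \<partial>lborel) = curve_length A g \<gamma>1 a b"
      unfolding curve_length_def
      by (rule nn_integral_cong_AE, rule eventually_mono[OF AE]) (use ab be s1 in \<open>auto simp: indicator_def\<close>)
    show "(\<integral>\<^sup>+s\<in>space lborel - {..b}. (ennreal (speed A g \<gamma> s) * indicator {a..e} s) \<partial>lborel) = curve_length A g \<gamma>2 b e"
      unfolding curve_length_def
      by (rule nn_integral_cong_AE, rule eventually_mono[OF AE]) (use ab be s2 in \<open>auto simp: indicator_def\<close>)
  qed
  finally show ?thesis .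
qed

lemma riem_dist_triangle: "riem_dist A g x z \<le> riem_dist A g x y + riem_dist A g y z"
proof (cases "riem_dist A g x y = \<infinity> \<or> riem_dist A g y z = \<infinity>")
  case False
  show ?thesis
  proof (rule ennreal_le_epsilon)
    fix r :: real assume r: "0 < r"
    have ex: "\<exists>\<gamma> a b. a \<le> b \<and> piecewise_C1_curve A \<gamma> a b \<and> \<gamma> a = x \<and> \<gamma> b = y \<and>
        curve_length A g \<gamma> a b < riem_dist A g x y + ennreal (r / 2)"
      if "riem_dist A g x y \<noteq> \<infinity>" for x y
    proof -
      have "riem_dist A g x y < riem_dist A g x y + ennreal (r / 2)"
        using that r by (cases "riem_dist A g x y") (auto simp: ennreal_plus[symmetric] simp del: ennreal_plus intro!: ennreal_lessI)
      moreover define S where "S = {curve_length A g \<gamma> a b | \<gamma> a b.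
          a \<le> b \<and> piecewise_C1_curve A \<gamma> a b \<and> \<gamma> a = x \<and> \<gamma> b = y}"
      moreover have "riem_dist A g x y = Inf S" by (simp add: riem_dist_def S_def)
      ultimately obtain L where "L \<in> S" "L < riem_dist A g x y + ennreal (r / 2)"
        by (metis Inf_less_iff)
      then show ?thesis unfolding S_def by blast
    qed
    obtain \<gamma>1 a b where 1: "a \<le> b" "piecewise_C1_curve A \<gamma>1 a b" "\<gamma>1 a = x" "\<gamma>1 b = y"
      "curve_length A g \<gamma>1 a b < riem_dist A g x y + ennreal (r / 2)" using ex[of x y] False by auto
    obtain \<gamma>2 a' b' where 2: "a' \<le> b'" "piecewise_C1_curve A \<gamma>2 a' b'" "\<gamma>2 a' = y" "\<gamma>2 b' = z"
      "curve_length A g \<gamma>2 a' b' < riem_dist A g y z + ennreal (r / 2)" using ex[of y z] False by auto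
    define e where "e = b + (b' - a')"
    \<comment> \<open>shift the second curve so that it starts at the parameter where the first one ends\<close>
    have \<phi>: "s \<in> {b..e} \<longleftrightarrow> 1 * s + (a' - b) \<in> {a'..b'}" for s by (auto simp: e_def)
    have "riem_dist A g x z \<le> curve_length A g \<gamma>1 a b + curve_length A g (\<lambda>s. \<gamma>2 (1 * s + (a' - b))) b e"
      using riem_dist_concat[OF 1(1,2) _ piecewise_C1_curve_affine[OF 2(2) _ \<phi>]] 1 2 by (simp add: e_def)
    also have "\<dots> \<le> curve_length A g \<gamma>1 a b + curve_length A g \<gamma>2 a' b'"
      by (intro add_left_mono curve_length_affine_le[OF 2(2) _ \<phi>]) simp
    also have "\<dots> \<le> (riem_dist A g x y + ennreal (r / 2)) + (riem_dist A g y z + ennreal (r / 2))"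
      using 1 2 by (intro add_mono) (auto intro: less_imp_le)
    also have "\<dots> = riem_dist A g x y + riem_dist A g y z + (ennreal (r / 2) + ennreal (r / 2))"
      by (simp add: ac_simps)
    also have "ennreal (r / 2) + ennreal (r / 2) = ennreal r"
      using r by (subst ennreal_plus[symmetric]) auto
    finally show "riem_dist A g x z \<le> riem_dist A g x y + riem_dist A g y z + ennreal r" .
  qed
qed auto

text \<open>
  On a compact set of coordinates the metric is dominated by a multiple of the Euclidean one, so the
  coordinate segment between two close points is short. Hence the Riemannian distance is small near the
  diagonal, and with the triangle inequality the set of pairs at distance at most \<open>t\<close> is closed.
\<close>

lemma qform_bounded_on_compact:
  assumes c: "c \<in> A" and K: "compact K" "K \<subseteq> snd c ` fst c"
  shows "\<exists>B\<ge>0. \<forall>x\<in>K. \<forall>w. qform c (chart_inv c x) w \<le> B * (norm w)\<^sup>2"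
proof -
  let ?f = "\<lambda>z. snd z \<bullet> (g c (chart_inv c (fst z)) *v snd z)"
  have "continuous_on (K \<times> UNIV) (\<lambda>z. g c (chart_inv c (fst z)))"
    by (rule continuous_on_compose2[OF continuous_gram[OF c]]) (use K in \<open>auto intro!: continuous_intros\<close>)
  then have "continuous_on (K \<times> UNIV) ?f"
    unfolding inner_vec_def matrix_vector_mult_def by (intro continuous_intros)
  then have "continuous_on (K \<times> cball 0 1) ?f" by (rule continuous_on_subset) auto
  then have "bounded (?f ` (K \<times> cball 0 1))"
    using K by (intro compact_imp_bounded compact_continuous_image compact_Times) auto
  then obtain B where B: "\<And>x w. x \<in> K \<Longrightarrow> norm w \<le> 1 \<Longrightarrow> \<bar>qform c (chart_inv c x) w\<bar> \<le> B"
    unfolding bounded_iff qform_def by force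
  have "qform c (chart_inv c x) w \<le> max B 0 * (norm w)\<^sup>2" if x: "x \<in> K" for x w
  proof (cases "w = 0")
    case True
    then show ?thesis by (simp add: qform_def)
  next
    case False
    have "qform c (chart_inv c x) w = qform c (chart_inv c x) (norm w *\<^sub>R (w /\<^sub>R norm w))" using False by simp
    also have "\<dots> = (norm w)\<^sup>2 * qform c (chart_inv c x) (w /\<^sub>R norm w)" by (rule qform_scale)
    also have "\<dots> \<le> (norm w)\<^sup>2 * max B 0"
      using B[OF x, of "w /\<^sub>R norm w"] False by (intro mult_left_mono) auto
    finally show ?thesis by (simp add: mult.commute)
  qed
  then show ?thesis by (intro exI[of _ "max B 0"]) auto
qed

lemma riem_dist_chart_segment:
  assumes c: "c \<in> A" and x: "x \<in> fst c" and y: "y \<in> fst c"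
    and K: "convex K" "K \<subseteq> snd c ` fst c" "snd c x \<in> K" "snd c y \<in> K"
    and B: "\<And>z w. z \<in> K \<Longrightarrow> qform c (chart_inv c z) w \<le> B * (norm w)\<^sup>2" and B0: "B \<ge> 0"
  shows "riem_dist A g x y \<le> ennreal (sqrt B * norm (snd c y - snd c x))"
proof -
  define w where "w = snd c y - snd c x"
  define l where "l s = snd c x + s *\<^sub>R w" for s
  define \<gamma> where "\<gamma> s = chart_inv c (l s)" for s
  have lK: "l s \<in> K" if "s \<in> {0..1}" for s
  proof -
    have "l s = (1 - s) *\<^sub>R snd c x + s *\<^sub>R snd c y" by (simp add: l_def w_def algebra_simps)
    then show ?thesis using convexD[OF K(1) K(3,4), of "1 - s" s] that by simp
  qed
  have \<gamma>c: "\<gamma> s \<in> fst c" "snd c (\<gamma> s) = l s" if s: "s \<in> {0..1}" for s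
  proof -
    obtain p where "p \<in> fst c" "l s = snd c p" using lK[OF s] K(2) by blast
    then show "\<gamma> s \<in> fst c" "snd c (\<gamma> s) = l s" by (simp_all add: \<gamma>_def chart_inv[OF c])
  qed
  have ld: "(l has_vector_derivative w) (at s within I)" for s I
    unfolding l_def by (auto intro!: derivative_eq_intros)
  have cont: "continuous_on {0..1} \<gamma>"
    unfolding \<gamma>_def
  proof (rule continuous_on_compose2[OF homeomorphism_cont2[OF chart_homeomorphism[OF c]]])
    show "continuous_on {0..1} l" unfolding l_def by (intro continuous_intros)
    show "l ` {0..1} \<subseteq> snd c ` fst c" using lK K(2) by blast
  qed
  have d: "((snd c \<circ> \<gamma>) has_vector_derivative w) (at s within {u..v})"
    if "s \<in> {u..v}" "0 \<le> u" "v \<le> 1" for s u v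
    by (rule has_vector_derivative_transform[OF that(1) _ ld]) (use that \<gamma>c(2) in auto)
  have C1: "C1_curve A (id \<circ> \<gamma>) u v" if uv: "0 \<le> u" "u < v" "v \<le> 1" for u v
  proof (rule C1_curve_image[OF _ _ _ uv(2)])
    show "continuous_on {u..v} \<gamma>" using cont by (rule continuous_on_subset) (use uv in auto)
    fix s0 assume "s0 \<in> {u..v}"
    show "\<exists>c\<in>A. \<exists>V D. open V \<and> s0 \<in> V \<and> continuous_on (V \<inter> {u..v}) D \<and>
       (\<forall>s\<in>V \<inter> {u..v}. \<gamma> s \<in> fst c \<and> ((snd c \<circ> \<gamma>) has_vector_derivative D s) (at s within {u..v}))"
    proof (intro bexI[of _ c] exI[of _ UNIV] exI[of _ "\<lambda>_. w"] conjI ballI)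
      fix s assume s: "s \<in> UNIV \<inter> {u..v}"
      then have "s \<in> {0..1}" using uv by auto
      then show "\<gamma> s \<in> fst c" by (rule \<gamma>c)
      show "((snd c \<circ> \<gamma>) has_vector_derivative w) (at s within {u..v})" using s uv by (intro d) auto
    qed (use c in auto)
  qed (use smooth_id in \<open>auto simp: inv_id\<close>)
  have pw: "piecewise_C1_curve A \<gamma> 0 1"
    unfolding piecewise_C1_curve_def using cont C1 by (intro conjI exI[of _ "{}"]) auto
  have sp: "speed A g \<gamma> s \<le> sqrt B * norm w" if s: "s \<in> {0<..<1}" for s
  proof -
    have at: "at s within {0..1} = at s" using s by (intro at_within_interior) auto
    have "continuous (at s within {0..1}) \<gamma>" using cont s by (simp add: continuous_on_eq_continuous_within)
    then have "isCont \<gamma> s" by (simp add: at)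
    moreover have "((snd c \<circ> \<gamma>) has_vector_derivative w) (at s)"
      using d[of s 0 1] s by (simp add: at)
    ultimately have "speed A g \<gamma> s = sqrt (qform c (\<gamma> s) w)"
      using c \<gamma>c(1)[of s] s by (intro speed_eq) auto
    also have "\<dots> \<le> sqrt (B * (norm w)\<^sup>2)"
      using B[OF lK, of s w] s by (simp add: \<gamma>_def)
    also have "\<dots> = sqrt B * norm w" by (simp add: real_sqrt_mult)
    finally show ?thesis .
  qed
  have "riem_dist A g x y \<le> curve_length A g \<gamma> 0 1"
    by (rule riem_dist_le[OF _ pw]) (auto simp: \<gamma>_def l_def w_def chart_inv[OF c x] chart_inv[OF c y])
  also have "\<dots> \<le> (\<integral>\<^sup>+s. ennreal (sqrt B * norm w) * indicator {0..1::real} s \<partial>lborel)"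
    unfolding curve_length_def
  proof (rule nn_integral_mono_AE)
    have "AE s in lborel. s \<notin> {0, 1::real}" by (rule AE_lborel_finite) simp
    then show "AE s in lborel. ennreal (speed A g \<gamma> s) * indicator {0..1} s \<le> ennreal (sqrt B * norm w) * indicator {0..1} s"
    proof eventually_elim
      case (elim s)
      then show ?case using sp[of s] by (auto simp: indicator_def intro!: ennreal_leI)
    qed
  qed
  also have "\<dots> = ennreal (sqrt B * norm w)" by (subst nn_integral_cmult_indicator) auto
  finally show ?thesis by (simp add: w_def)
qed

lemma riem_dist_nhds:
  assumes e: "0 < (e::real)"
  shows "\<forall>\<^sub>F y in nhds x. riem_dist A g x y \<le> ennreal e"
proof -
  obtain c where c: "c \<in> A" "x \<in> fst c" using charts_cover by blast
  obtain r where r: "r > 0" "cball (snd c x) r \<subseteq> snd c ` fst c"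
    using open_chart_image[OF c(1)] c(2) by (meson imageI open_contains_cball)
  obtain B where B: "B \<ge> 0" "\<And>z w. z \<in> cball (snd c x) r \<Longrightarrow> qform c (chart_inv c z) w \<le> B * (norm w)\<^sup>2"
    using qform_bounded_on_compact[OF c(1) compact_cball r(2)] by blast
  define q where "q = min r (e / (sqrt B + 1))"
  have q: "q > 0" using r e B by (simp add: q_def add_nonneg_pos)
  have "isCont (snd c) x"
    using homeomorphism_cont1[OF chart_homeomorphism[OF c(1)]] open_chart[OF c(1)] c(2)
    by (simp add: continuous_on_eq_continuous_at)
  then have "(snd c \<longlongrightarrow> snd c x) (nhds x)"
    by (simp add: isCont_def tendsto_at_iff_tendsto_nhds)
  then have "\<forall>\<^sub>F y in nhds x. dist (snd c y) (snd c x) < q" using q by (rule tendstoD)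
  moreover have "\<forall>\<^sub>F y in nhds x. y \<in> fst c"
    using open_chart[OF c(1)] c(2) by (rule eventually_nhds_in_open)
  ultimately show ?thesis
  proof eventually_elim
    case (elim y)
    then have "norm (snd c y - snd c x) < q" by (simp add: dist_norm)
    then have n: "norm (snd c y - snd c x) \<le> r" "norm (snd c y - snd c x) \<le> e / (sqrt B + 1)" by (auto simp: q_def)
    have "riem_dist A g x y \<le> ennreal (sqrt B * norm (snd c y - snd c x))"
      by (rule riem_dist_chart_segment[OF c elim(2) convex_cball r(2) _ _ B(2,1)])
        (use r n(1) in \<open>auto simp: dist_norm norm_minus_commute\<close>)
    also have "\<dots> \<le> ennreal e"
    proof (rule ennreal_leI)
      have "sqrt B * norm (snd c y - snd c x) \<le> (sqrt B + 1) * (e / (sqrt B + 1))"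
        using n B e by (intro mult_mono) auto
      also have "\<dots> = e"
      proof -
        have "sqrt B + 1 \<noteq> 0" using B(1) by (smt (verit) real_sqrt_ge_zero)
        then show ?thesis by simp
      qed
      finally show "sqrt B * norm (snd c y - snd c x) \<le> e" .
    qed
    finally show ?case .
  qed
qed

lemma closed_riem_dist_le: "closed {z. riem_dist A g (fst z) (snd z) \<le> ennreal t}"
proof -
  have "open {z. ennreal t < riem_dist A g (fst z) (snd z)}"
  proof (subst open_subopen, intro ballI)
    fix z assume "z \<in> {z. ennreal t < riem_dist A g (fst z) (snd z)}"
    then obtain x y where z: "z = (x, y)" "ennreal t < riem_dist A g x y" by (cases z) auto
    obtain r where r: "ennreal t < r" "r < riem_dist A g x y" using dense[OF z(2)] by blast
    then have rfin: "r < \<infinity>" by (metis infinity_ennreal_def order_less_trans top.not_eq_extremum)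
    obtain e where e: "0 < (e::real)" "ennreal t + (ennreal e + ennreal e) \<le> r"
    proof -
      obtain r' where r': "r = ennreal r'" "0 \<le> r'" using rfin by (cases r) auto
      define t' where "t' = max t 0"
      have t': "ennreal t = ennreal t'" "0 \<le> t'" by (auto simp: t'_def ennreal_neg max_def)
      have lt: "t' < r'" using r(1) r' t' by (simp add: ennreal_less_iff)
      show ?thesis
      proof (rule that[of "(r' - t') / 2"])
        show "0 < (r' - t') / 2" using lt by simp
        have "ennreal t' + (ennreal ((r' - t') / 2) + ennreal ((r' - t') / 2)) = ennreal r'"
          using t' lt by (simp flip: ennreal_plus)
        then show "ennreal t + (ennreal ((r' - t') / 2) + ennreal ((r' - t') / 2)) \<le> r"
          using t' r' by simp
      qed
    qed
    obtain U where U: "open U" "x \<in> U" "\<And>x'. x' \<in> U \<Longrightarrow> riem_dist A g x x' \<le> ennreal e"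
      using riem_dist_nhds[OF e(1), of x] unfolding eventually_nhds by blast
    obtain V where V: "open V" "y \<in> V" "\<And>y'. y' \<in> V \<Longrightarrow> riem_dist A g y y' \<le> ennreal e"
      using riem_dist_nhds[OF e(1), of y] unfolding eventually_nhds by blast
    have "ennreal t < riem_dist A g x' y'" if "x' \<in> U" "y' \<in> V" for x' y'
    proof (rule ccontr)
      assume "\<not> ennreal t < riem_dist A g x' y'"
      then have le: "riem_dist A g x' y' \<le> ennreal t" by simp
      have "riem_dist A g x y \<le> riem_dist A g x x' + (riem_dist A g x' y' + riem_dist A g y' y)"
        using riem_dist_triangle[of x y x'] riem_dist_triangle[of x' y y'] by (meson add_left_mono order_trans)
      also have "\<dots> \<le> ennreal e + (ennreal t + ennreal e)"
        using U(3)[OF that(1)] V(3)[OF that(2)] le by (intro add_mono) (auto simp: riem_dist_sym)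
      also have "\<dots> = ennreal t + (ennreal e + ennreal e)" by (simp add: ac_simps)
      also have "\<dots> \<le> r" by (rule e)
      finally show False using r(2) by simp
    qed
    then show "\<exists>W. open W \<and> z \<in> W \<and> W \<subseteq> {z. ennreal t < riem_dist A g (fst z) (snd z)}"
      using U V z by (intro exI[of _ "U \<times> V"]) (auto intro: open_Times)
  qed
  then show ?thesis by (simp add: closed_def Compl_eq not_le)
qed

lemma riem_ball_borel: "{y. riem_dist A g x y \<le> ennreal t} \<in> sets borel"
proof -
  have "closed ((\<lambda>y. (x, y)) -` {z. riem_dist A g (fst z) (snd z) \<le> ennreal t})"
    by (rule closed_vimage[OF closed_riem_dist_le]) (intro continuous_intros)
  then show ?thesis by (simp add: vimage_def)
qed

text \<open>
  An isometry that maps \<open>x\<close> to \<open>y\<close> preserves the volume and maps the ball around \<open>x\<close> into the ball around \<open>y\<close>.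
\<close>

lemma ball_volume_le:
  assumes "homogeneous A g"
  shows "ball_volume A g t x \<le> ball_volume A g t y"
proof -
  obtain F where F: "riemannian_isometry A g F" "F x = y"
    using assms by (auto simp: homogeneous_def)
  have "ball_volume A g t x = emeasure (riem_volume A g) (F ` {z. riem_dist A g x z \<le> ennreal t})"
    unfolding ball_volume_def by (rule isometry_volume(2)[OF F(1) riem_ball_borel, symmetric])
  also have "\<dots> \<le> ball_volume A g t y"
    unfolding ball_volume_def
  proof (rule emeasure_mono)
    show "F ` {z. riem_dist A g x z \<le> ennreal t} \<subseteq> {z. riem_dist A g y z \<le> ennreal t}"
      using isometry_riem_dist_le[OF F(1)] F(2) by (auto intro: order_trans)
    show "{z. riem_dist A g y z \<le> ennreal t} \<in> sets (riem_volume A g)"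
      using riem_ball_borel by (simp add: sets_riem_volume)
  qed
  finally show ?thesis .
qed

lemma ball_volume_const: "homogeneous A g \<Longrightarrow> ball_volume A g t x = ball_volume A g t y"
  by (intro antisym ball_volume_le)

end

section \<open>Integer-valued measures are atomic\<close>

text \<open>
  If some mass were left outside the atoms, it would be at least 1. Halving the remaining set along the
  members of a countable basis and keeping a half of mass at least 1 leads to a decreasing sequence whose
  intersection has mass at least 1 but contains only one point, because the basis separates points. That
  point would be an atom.
\<close>

lemma integer_measure_atomic:
  fixes \<nu> :: "'m::{t2_space, second_countable_topology} measure"
  assumes sets: "sets \<nu> = sets borel"
    and int: "\<And>B. B \<in> sets borel \<Longrightarrow> emeasure \<nu> B \<in> insert \<infinity> (range of_nat)"
    and E: "E \<in> sets borel" "emeasure \<nu> E < \<infinity>"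
  shows "finite (graph_vertices \<nu> \<inter> E)" "emeasure \<nu> (E - graph_vertices \<nu>) = 0"
proof -
  let ?X = "graph_vertices \<nu> \<inter> E"
  have ge1: "1 \<le> emeasure \<nu> B" if B: "B \<in> sets borel" "emeasure \<nu> B \<noteq> 0" for B
  proof (cases "emeasure \<nu> B = \<infinity>")
    case False
    then obtain k where k: "emeasure \<nu> B = of_nat k" using int[OF B(1)] by auto
    then have "1 \<le> k" using B(2) by (cases k) auto
    then have "(of_nat 1 :: ennreal) \<le> of_nat k" by (simp only: of_nat_le_iff)
    then show ?thesis using k by simp
  qed simp
  obtain n where n: "emeasure \<nu> E = of_nat n" using int[OF E(1)] E(2) by auto
  have bound: "card Y \<le> n" if "Y \<subseteq> ?X" "finite Y" for Y
  proof -
    have "of_nat (card Y) = (\<Sum>x\<in>Y. 1 :: ennreal)" by simp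
    also have "\<dots> \<le> (\<Sum>x\<in>Y. emeasure \<nu> {x})"
      using that by (intro sum_mono ge1) (auto simp: graph_vertices_def)
    also have "\<dots> = emeasure \<nu> Y"
      using that(2) sets by (intro emeasure_eq_sum_singleton[symmetric]) auto
    also have "\<dots> \<le> of_nat n"
      unfolding n[symmetric] using that E sets by (intro emeasure_mono) auto
    finally show ?thesis by (simp only: of_nat_le_iff)
  qed
  show fin: "finite ?X"
    using finite_if_finite_subsets_card_bdd[of ?X n] bound by blast
  then have Xb: "?X \<in> sets borel" by (intro borel_closed finite_imp_closed)
  show "emeasure \<nu> (E - graph_vertices \<nu>) = 0"
  proof (rule ccontr)
    assume nz: "emeasure \<nu> (E - graph_vertices \<nu>) \<noteq> 0"
    obtain \<B> :: "'m set set" where \<B>: "countable \<B>" "topological_basis \<B>" using ex_countable_basis by blast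
    have ne: "\<B> \<noteq> {}" using \<B>(2) open_UNIV unfolding topological_basis_def by auto
    define b where "b = from_nat_into \<B>"
    have rb: "range b = \<B>" unfolding b_def using range_from_nat_into[OF ne \<B>(1)] .
    have b_borel: "b i \<in> sets borel" for i
      using rb \<B>(2) topological_basis_open by (intro borel_open) blast
    define D where "D = rec_nat (E - graph_vertices \<nu>)
       (\<lambda>i D. if emeasure \<nu> (D \<inter> b i) \<noteq> 0 then D \<inter> b i else D - b i)"
    have D0: "D 0 = E - graph_vertices \<nu>"
      and DS: "D (Suc i) = (if emeasure \<nu> (D i \<inter> b i) \<noteq> 0 then D i \<inter> b i else D i - b i)" for i
      by (simp_all add: D_def)
    have "E - graph_vertices \<nu> = E - ?X" by auto
    then have D0b: "D 0 \<in> sets borel" using E(1) Xb unfolding D0 by auto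
    have inv: "D i \<in> sets borel \<and> emeasure \<nu> (D i) \<noteq> 0" for i
    proof (induction i)
      case 0
      then show ?case using D0b nz D0 by simp
    next
      case (Suc i)
      have "emeasure \<nu> (D i) = emeasure \<nu> (D i \<inter> b i) + emeasure \<nu> (D i - b i)"
        using Suc sets b_borel[of i] by (subst plus_emeasure) (auto simp: Int_Diff_Un)
      then show ?case using Suc b_borel[of i] unfolding DS by auto
    qed
    have dec: "decseq D" by (rule decseq_SucI) (auto simp: DS)
    have "emeasure \<nu> (D i) \<noteq> \<infinity>" for i
    proof -
      have "D i \<subseteq> E" using decseqD[OF dec, of 0 i] D0 by auto
      then have "emeasure \<nu> (D i) \<le> emeasure \<nu> E" using E sets by (intro emeasure_mono) auto
      then show ?thesis using E(2) by auto
    qed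
    then have "(INF i. emeasure \<nu> (D i)) = emeasure \<nu> (\<Inter>i. D i)"
      using inv dec sets by (intro INF_emeasure_decseq) auto
    moreover have "1 \<le> (INF i. emeasure \<nu> (D i))" using inv ge1 by (intro INF_greatest) auto
    ultimately have one: "1 \<le> emeasure \<nu> (\<Inter>i. D i)" by simp
    then have "(\<Inter>i. D i) \<noteq> {}" by auto
    then obtain x where x: "\<And>i. x \<in> D i" by auto
    have "y = x" if y: "\<And>i. y \<in> D i" for y
    proof (rule ccontr)
      assume "y \<noteq> x"
      then obtain U where U: "open U" "x \<in> U" "y \<notin> U" using separation_t1[of x y] by blast
      then obtain B where "B \<in> \<B>" "x \<in> B" "B \<subseteq> U" using \<B>(2) topological_basisE by metis
      then obtain i where i: "x \<in> b i" "y \<notin> b i" using rb U(3) by (metis imageE subsetD)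
      then show False using x[of "Suc i"] y[of "Suc i"] by (simp add: DS split: if_splits)
    qed
    then have "(\<Inter>i. D i) = {x}" using x by auto
    then have "x \<in> graph_vertices \<nu>" using one by (auto simp: graph_vertices_def intro: less_le_trans[OF zero_less_one])
    then show False using x[of 0] D0 by simp
  qed
qed

section \<open>Factorial moment measures\<close>

lemma distinct_points_boxes:
  fixes f :: "nat \<Rightarrow> 'm::t2_space"
  assumes \<B>: "topological_basis \<B>" and inj: "inj_on f {..<k}"
  shows "\<exists>b. b \<in> {..<k} \<rightarrow>\<^sub>E \<B> \<and> disjoint_family_on b {..<k} \<and> (\<forall>i<k. f i \<in> b i)"
proof -
  have "\<exists>U V. open U \<and> open V \<and> f i \<in> U \<and> f j \<in> V \<and> U \<inter> V = {}" if "i < k" "j < k" "i \<noteq> j" for i j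
    using hausdorff[of "f i" "f j"] inj_onD[OF inj, of i j] that by auto
  then obtain U V where UV: "\<And>i j. i < k \<Longrightarrow> j < k \<Longrightarrow> i \<noteq> j \<Longrightarrow>
      open (U i j) \<and> open (V i j) \<and> f i \<in> U i j \<and> f j \<in> V i j \<and> U i j \<inter> V i j = {}"
    by metis
  define W where "W i = (\<Inter>j\<in>{..<k} - {i}. U i j \<inter> V j i)" for i
  have "\<exists>B\<in>\<B>. f i \<in> B \<and> B \<subseteq> W i" if "i < k" for i
  proof -
    have "open (W i)" "f i \<in> W i" using UV that by (auto simp: W_def)
    then show ?thesis using \<B> topological_basisE by metis
  qed
  then obtain b where b: "\<And>i. i < k \<Longrightarrow> b i \<in> \<B> \<and> f i \<in> b i \<and> b i \<subseteq> W i" by metis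
  have "b i \<inter> b j = {}" if ij: "i < k" "j < k" "i \<noteq> j" for i j
  proof -
    have "b i \<subseteq> U i j" "b j \<subseteq> V i j" using b[OF ij(1)] b[OF ij(2)] ij by (force simp: W_def)+
    then show ?thesis using UV[OF ij] by blast
  qed
  then show ?thesis using b
    by (intro exI[of _ "restrict b {..<k}"]) (auto simp: disjoint_family_on_def)
qed

lemma emeasure_density_indicator:
  assumes "A \<in> sets M" "C \<in> sets M"
  shows "emeasure (density M (indicator C)) A = emeasure M (A \<inter> C)"
proof -
  have "emeasure (density M (indicator C)) A = (\<integral>\<^sup>+x. indicator C x * indicator A x \<partial>M)"
    using assms by (intro emeasure_density) auto
  also have "\<dots> = (\<integral>\<^sup>+x. indicator (A \<inter> C) x \<partial>M)"
    by (intro nn_integral_cong) (auto simp: indicator_def)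
  also have "\<dots> = emeasure M (A \<inter> C)" using assms by (intro nn_integral_indicator) auto
  finally show ?thesis .
qed

text \<open>
  The only properties of a Poisson process that enter here are collected in a locale: the masses of
  disjoint sets have product moments as if they were independent with intensity \<open>M\<close>.
\<close>

locale random_finite_measure = prob_space P for P :: "'w measure" +
  fixes K :: "'w \<Rightarrow> 'm::{t2_space, second_countable_topology} measure" and M :: "'m measure"
  assumes sets_K [simp]: "\<And>\<omega>. sets (K \<omega>) = sets borel" and sets_M [simp]: "sets M = sets borel"
    and finite_K: "\<And>\<omega>. emeasure (K \<omega>) UNIV < \<infinity>" and finite_M: "emeasure M UNIV < \<infinity>"
    and measurable_K [measurable]: "\<And>B. B \<in> sets borel \<Longrightarrow> (\<lambda>\<omega>. emeasure (K \<omega>) B) \<in> borel_measurable P"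
    and disjoint_moments: "\<And>(k::nat) B. disjoint_family_on B {..<k} \<Longrightarrow> (\<And>i. i < k \<Longrightarrow> B i \<in> sets borel) \<Longrightarrow>
        (\<integral>\<^sup>+\<omega>. (\<Prod>i<k. emeasure (K \<omega>) (B i)) \<partial>P) = (\<Prod>i<k. emeasure M (B i))"
begin

lemma space_K [simp]: "space (K \<omega>) = UNIV" "space M = UNIV"
  using sets_eq_imp_space_eq[OF sets_K] sets_eq_imp_space_eq[OF sets_M] by auto

lemma finite_measure_K: "finite_measure (K \<omega>)" and finite_measure_M: "finite_measure M"
  by (rule finite_measureI; use finite_K[of \<omega>] finite_M in \<open>simp add: less_top\<close>)+

lemma product_sigma_finite_K: "product_sigma_finite (\<lambda>_::nat. K \<omega>)"
  using finite_measure_K by (auto simp: product_sigma_finite_def finite_measure_def)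

lemma product_sigma_finite_M: "product_sigma_finite (\<lambda>_::nat. M)"
  using finite_measure_M by (auto simp: product_sigma_finite_def finite_measure_def)

definition tuples :: "nat \<Rightarrow> (nat \<Rightarrow> 'm) measure" where
  "tuples k = PiM {..<k} (\<lambda>_. borel)"

definition Kpow :: "nat \<Rightarrow> 'w \<Rightarrow> (nat \<Rightarrow> 'm) measure" where
  "Kpow k \<omega> = PiM {..<k} (\<lambda>_. K \<omega>)"

definition Mpow :: "nat \<Rightarrow> (nat \<Rightarrow> 'm) measure" where
  "Mpow k = PiM {..<k} (\<lambda>_. M)"

lemma sets_pow [simp]: "sets (Kpow k \<omega>) = sets (tuples k)" "sets (Mpow k) = sets (tuples k)"
  unfolding Kpow_def Mpow_def tuples_def by (intro sets_PiM_cong; simp)+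

lemma space_pow [simp]: "space (Kpow k \<omega>) = space (tuples k)" "space (Mpow k) = space (tuples k)"
  using sets_eq_imp_space_eq[OF sets_pow(1)] sets_eq_imp_space_eq[OF sets_pow(2)] by auto

lemma space_tuples: "space (tuples k) = {..<k} \<rightarrow>\<^sub>E UNIV"
  by (simp add: tuples_def space_PiM)

lemma Kpow_rect: "(\<And>i. i < k \<Longrightarrow> B i \<in> sets borel) \<Longrightarrow> emeasure (Kpow k \<omega>) (Pi\<^sub>E {..<k} B) = (\<Prod>i<k. emeasure (K \<omega>) (B i))"
  unfolding Kpow_def by (intro product_sigma_finite.emeasure_PiM[OF product_sigma_finite_K]) auto

lemma Mpow_rect: "(\<And>i. i < k \<Longrightarrow> B i \<in> sets borel) \<Longrightarrow> emeasure (Mpow k) (Pi\<^sub>E {..<k} B) = (\<Prod>i<k. emeasure M (B i))"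
  unfolding Mpow_def by (intro product_sigma_finite.emeasure_PiM[OF product_sigma_finite_M]) auto

lemma rect_sets: "(\<And>i. i < k \<Longrightarrow> B i \<in> sets borel) \<Longrightarrow> Pi\<^sub>E {..<k} B \<in> sets (tuples k)"
  unfolding tuples_def by (intro sets_PiM_I_finite) auto

lemma Kpow_space: "emeasure (Kpow k \<omega>) (space (tuples k)) = emeasure (K \<omega>) UNIV ^ k"
  unfolding space_tuples by (subst Kpow_rect) auto

lemma Mpow_space: "emeasure (Mpow k) (space (tuples k)) = emeasure M UNIV ^ k"
  unfolding space_tuples by (subst Mpow_rect) auto

lemma finite_Kpow: "emeasure (Kpow k \<omega>) S < \<infinity>"
proof -
  have "emeasure (Kpow k \<omega>) S \<le> emeasure (K \<omega>) UNIV ^ k"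
    using emeasure_space[of "Kpow k \<omega>" S] by (simp add: Kpow_space)
  also have "\<dots> < \<infinity>" using finite_K by (simp add: power_less_top_ennreal)
  finally show ?thesis .
qed

text \<open>
  The sets for which this holds form a Dynkin system that contains the rectangles.
\<close>

lemma measurable_Kpow [measurable]:
  assumes "S \<in> sets (tuples k)"
  shows "(\<lambda>\<omega>. emeasure (Kpow k \<omega>) S) \<in> borel_measurable P"
proof -
  let ?\<Omega> = "\<Pi>\<^sub>E i\<in>{..<k}. space (borel :: 'm measure)"
  let ?G = "prod_algebra {..<k} (\<lambda>_. borel :: 'm measure)"
  have G: "\<exists>B. A = Pi\<^sub>E {..<k} B \<and> (\<forall>i<k. B i \<in> sets borel)" if "A \<in> ?G" for A
    using that by (subst (asm) prod_algebra_eq_finite) (auto simp: Pi_iff)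
  have "S \<in> sigma_sets ?\<Omega> ?G" using assms by (simp add: tuples_def sets_PiM)
  then show ?thesis
  proof (induction rule: sigma_sets_induct_disjoint[OF Int_stable_prod_algebra prod_algebra_sets_into_space,
      consumes 1, case_names basic empty compl union])
    case (basic A)
    then obtain B where B: "A = Pi\<^sub>E {..<k} B" "\<And>i. i < k \<Longrightarrow> B i \<in> sets borel" using G by blast
    then show ?case by (simp add: Kpow_rect)
  next
    case empty
    then show ?case by simp
  next
    case (compl A)
    then have A: "A \<in> sets (tuples k)" by (simp add: tuples_def sets_PiM)
    have "emeasure (Kpow k \<omega>) (?\<Omega> - A) = emeasure (K \<omega>) UNIV ^ k - emeasure (Kpow k \<omega>) A" for \<omega>
      using A finite_Kpow[of k \<omega> A] emeasure_compl[of A "Kpow k \<omega>"] by (simp add: Kpow_space) (simp add: space_tuples)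
    then show ?case using compl by simp
  next
    case (union A)
    then have A: "range A \<subseteq> sets (tuples k)" by (simp add: tuples_def sets_PiM)
    have "emeasure (Kpow k \<omega>) (\<Union>i. A i) = (\<Sum>i. emeasure (Kpow k \<omega>) (A i))" for \<omega>
      using A union by (intro suminf_emeasure[symmetric]) auto
    then show ?case using union by simp
  qed
qed

definition mean_pow :: "nat \<Rightarrow> (nat \<Rightarrow> 'm) set \<Rightarrow> ennreal" where
  "mean_pow k S = (\<integral>\<^sup>+\<omega>. emeasure (Kpow k \<omega>) S \<partial>P)"

lemma mean_pow_suminf:
  assumes "range A \<subseteq> sets (tuples k)" "disjoint_family A"
  shows "(\<Sum>i. mean_pow k (A i)) = mean_pow k (\<Union>i. A i)"
proof -
  have "mean_pow k (\<Union>i. A i) = (\<integral>\<^sup>+\<omega>. (\<Sum>i. emeasure (Kpow k \<omega>) (A i)) \<partial>P)"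
    unfolding mean_pow_def using assms by (intro nn_integral_cong suminf_emeasure[symmetric]) auto
  also have "\<dots> = (\<Sum>i. mean_pow k (A i))"
    unfolding mean_pow_def using assms by (intro nn_integral_suminf measurable_Kpow) auto
  finally show ?thesis ..
qed

text \<open>
  Inside a box with disjoint sides \<open>C i\<close> every rectangle has the disjoint sides \<open>A i \<inter> C i\<close>, so that both
  measures agree on all rectangles, hence everywhere inside the box.
\<close>

lemma mean_pow_box:
  assumes C: "disjoint_family_on C {..<k}" "\<And>i. i < k \<Longrightarrow> C i \<in> sets borel"
    and S: "S \<in> sets (tuples k)"
  shows "mean_pow k (S \<inter> Pi\<^sub>E {..<k} C) = emeasure (Mpow k) (S \<inter> Pi\<^sub>E {..<k} C)"
proof -
  let ?C = "Pi\<^sub>E {..<k} C"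
  have Cs: "?C \<in> sets (tuples k)" using C(2) by (rule rect_sets)
  define Q1 where "Q1 = measure_of (space (tuples k)) (sets (tuples k)) (\<lambda>S. mean_pow k (S \<inter> ?C))"
  define Q2 where "Q2 = density (Mpow k) (indicator ?C)"
  have s1: "sets Q1 = sets (tuples k)" unfolding Q1_def by (simp add: sets_measure_of sets.space_closed)
  have s2: "sets Q2 = sets (tuples k)" by (simp add: Q2_def)
  have e1: "emeasure Q1 A = mean_pow k (A \<inter> ?C)" if "A \<in> sets (tuples k)" for A
  proof (rule emeasure_measure_of[OF Q1_def])
    show "sets (tuples k) \<subseteq> Pow (space (tuples k))" by (rule sets.space_closed)
    show "A \<in> sets Q1" using that s1 by simp
    show "positive (sets Q1) (\<lambda>S. mean_pow k (S \<inter> ?C))" by (simp add: positive_def mean_pow_def)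
    show "countably_additive (sets Q1) (\<lambda>S. mean_pow k (S \<inter> ?C))"
    proof (rule countably_additiveI)
      fix A :: "nat \<Rightarrow> (nat \<Rightarrow> 'm) set" assume A: "range A \<subseteq> sets Q1" "disjoint_family A"
      have "(\<Sum>i. mean_pow k (A i \<inter> ?C)) = mean_pow k (\<Union>i. A i \<inter> ?C)"
        using A s1 Cs by (intro mean_pow_suminf) (auto simp: disjoint_family_on_def)
      then show "(\<Sum>i. mean_pow k (A i \<inter> ?C)) = mean_pow k (\<Union> (range A) \<inter> ?C)" by simp
    qed
  qed
  have e2: "emeasure Q2 A = emeasure (Mpow k) (A \<inter> ?C)" if "A \<in> sets (tuples k)" for A
    unfolding Q2_def using that Cs by (simp add: emeasure_density_indicator)
  define R where "R i = density M (indicator (C i))" for i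
  have R: "emeasure (R i) A = emeasure M (A \<inter> C i)" if "A \<in> sets borel" "i < k" for i A
    unfolding R_def using that C(2) by (simp add: emeasure_density_indicator)
  \<comment> \<open>outside \<open>{..<k}\<close> any finite measure will do\<close>
  define R' where "R' i = (if i < k then R i else M)" for i
  have sR: "sets (R' i) = sets borel" for i by (simp add: R'_def R_def)
  have spR: "space (R' i) = UNIV" for i using sets_eq_imp_space_eq[OF sR] by simp
  have "finite_measure (R' i)" for i
  proof (rule finite_measureI)
    show "emeasure (R' i) (space (R' i)) \<noteq> \<infinity>"
    proof (cases "i < k")
      case True
      have "emeasure M (C i) \<le> emeasure M UNIV" by (intro emeasure_mono) auto
      then have "emeasure M (C i) < \<infinity>" using finite_M by (rule le_less_trans)
      then show ?thesis using True R[of UNIV i] by (simp add: R'_def R_def less_top)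
    next
      case False
      then show ?thesis using finite_M by (simp add: R'_def)
    qed
  qed
  then interpret R: product_sigma_finite R'
    by (auto simp: product_sigma_finite_def finite_measure_def)
  have sP: "sets (PiM {..<k} R') = sets (tuples k)"
    unfolding tuples_def by (intro sets_PiM_cong) (auto simp: sR)
  have int: "Pi\<^sub>E {..<k} A \<inter> ?C = Pi\<^sub>E {..<k} (\<lambda>i. A i \<inter> C i)" for A by (rule PiE_Int)
  have "Q1 = PiM {..<k} R'"
  proof (rule R.PiM_eqI)
    fix A assume "\<And>i. i \<in> {..<k} \<Longrightarrow> A i \<in> sets (R' i)"
    then have A: "A i \<in> sets borel" if "i < k" for i using that sR by auto
    have rA: "Pi\<^sub>E {..<k} A \<in> sets (tuples k)" using A by (rule rect_sets)
    have AC: "i < k \<Longrightarrow> A i \<inter> C i \<in> sets borel" for i using A C(2) by auto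
    have "emeasure Q1 (Pi\<^sub>E {..<k} A) = (\<integral>\<^sup>+\<omega>. (\<Prod>i<k. emeasure (K \<omega>) (A i \<inter> C i)) \<partial>P)"
      unfolding e1[OF rA] int mean_pow_def using AC by (simp add: Kpow_rect)
    also have "\<dots> = (\<Prod>i<k. emeasure M (A i \<inter> C i))"
      using C(1) AC by (intro disjoint_moments) (auto simp: disjoint_family_on_def)
    also have "\<dots> = (\<Prod>i<k. emeasure (R' i) (A i))" using A R by (intro prod.cong) (auto simp: R'_def)
    finally show "emeasure Q1 (Pi\<^sub>E {..<k} A) = (\<Prod>i\<in>{..<k}. emeasure (R' i) (A i))" .
  qed (use s1 sP in auto)
  moreover have "Q2 = PiM {..<k} R'"
  proof (rule R.PiM_eqI)
    fix A assume "\<And>i. i \<in> {..<k} \<Longrightarrow> A i \<in> sets (R' i)"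
    then have A: "A i \<in> sets borel" if "i < k" for i using that sR by auto
    have rA: "Pi\<^sub>E {..<k} A \<in> sets (tuples k)" using A by (rule rect_sets)
    have AC: "i < k \<Longrightarrow> A i \<inter> C i \<in> sets borel" for i using A C(2) by auto
    have "emeasure Q2 (Pi\<^sub>E {..<k} A) = (\<Prod>i<k. emeasure M (A i \<inter> C i))"
      unfolding e2[OF rA] int using AC by (simp add: Mpow_rect)
    also have "\<dots> = (\<Prod>i<k. emeasure (R' i) (A i))" using A R by (intro prod.cong) (auto simp: R'_def)
    finally show "emeasure Q2 (Pi\<^sub>E {..<k} A) = (\<Prod>i\<in>{..<k}. emeasure (R' i) (A i))" .
  qed (use s2 sP in auto)
  ultimately show ?thesis using e1[OF S] e2[OF S] by simp
qed

text \<open>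
  By the Hausdorff property and second countability, the tuples of distinct points are covered by
  countably many boxes with disjoint sides, and inside each of them \<open>mean_pow_box\<close> applies.
\<close>

theorem factorial_moments:
  assumes S: "S \<in> sets (tuples k)" "S \<subseteq> {f. inj_on f {..<k}}"
  shows "mean_pow k S = emeasure (Mpow k) S"
proof -
  obtain \<B> :: "'m set set" where \<B>: "countable \<B>" "topological_basis \<B>" using ex_countable_basis by blast
  define \<C> where "\<C> = {b \<in> {..<k} \<rightarrow>\<^sub>E \<B>. disjoint_family_on b {..<k}}"
  have cC: "countable \<C>"
    by (rule countable_subset[of _ "{..<k} \<rightarrow>\<^sub>E \<B>"]) (auto simp: \<C>_def intro!: countable_PiE \<B>)
  show ?thesis
  proof (cases "\<C> = {}")
    case True
    have "S = {}"
    proof (rule equals0I)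
      fix f assume "f \<in> S"
      then have "inj_on f {..<k}" using S(2) by auto
      from distinct_points_boxes[OF \<B>(2) this] show False using True unfolding \<C>_def by blast
    qed
    then show ?thesis by (simp add: mean_pow_def)
  next
    case False
    define c where "c = from_nat_into \<C>"
    have rc: "range c = \<C>" unfolding c_def using range_from_nat_into[OF False cC] .
    have c: "disjoint_family_on (c n) {..<k}" "i < k \<Longrightarrow> c n i \<in> sets borel" for n i
    proof -
      have "c n \<in> \<C>" using rc by auto
      then have "c n \<in> {..<k} \<rightarrow>\<^sub>E \<B>" "disjoint_family_on (c n) {..<k}" by (auto simp: \<C>_def)
      then show "disjoint_family_on (c n) {..<k}" "i < k \<Longrightarrow> c n i \<in> sets borel"
        using \<B>(2) topological_basis_open by (auto intro!: borel_open)
    qed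
    define B where "B n = S \<inter> Pi\<^sub>E {..<k} (c n)" for n
    have Bs: "range B \<subseteq> sets (tuples k)" using S(1) c(2) rect_sets by (auto simp: B_def)
    have UB: "(\<Union>n. B n) = S"
    proof (rule antisym)
      show "S \<subseteq> (\<Union>n. B n)"
      proof
        fix f assume f: "f \<in> S"
        then have "inj_on f {..<k}" using S(2) by auto
        from distinct_points_boxes[OF \<B>(2) this] obtain b where b: "b \<in> \<C>" "\<forall>i<k. f i \<in> b i"
          unfolding \<C>_def by blast
        obtain n where n: "b = c n" using b(1) rc by blast
        have "f \<in> space (tuples k)" using f S(1) sets.sets_into_space by blast
        then have "f \<in> Pi\<^sub>E {..<k} b" using b(2) by (auto simp: space_tuples PiE_def)
        then show "f \<in> (\<Union>n. B n)" using f n by (auto simp: B_def)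
      qed
    qed (auto simp: B_def)
    let ?D = "disjointed B"
    have Ds: "range ?D \<subseteq> sets (tuples k)" using Bs by (rule sets.range_disjointed_sets)
    have eq: "mean_pow k (?D n) = emeasure (Mpow k) (?D n)" for n
    proof -
      have "?D n \<subseteq> Pi\<^sub>E {..<k} (c n)" using disjointed_subset[of B n] by (auto simp: B_def)
      then have "?D n \<inter> Pi\<^sub>E {..<k} (c n) = ?D n" by blast
      then show ?thesis using mean_pow_box[of "c n" k "?D n"] c Ds by auto
    qed
    have "mean_pow k S = (\<Sum>n. mean_pow k (?D n))"
      using mean_pow_suminf[OF Ds disjoint_family_disjointed] by (simp add: UN_disjointed_eq UB)
    also have "\<dots> = (\<Sum>n. emeasure (Mpow k) (?D n))" by (simp add: eq)
    also have "\<dots> = emeasure (Mpow k) S"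
      using Ds by (subst suminf_emeasure) (auto simp: disjoint_family_disjointed UN_disjointed_eq UB)
    finally show ?thesis .
  qed
qed

end

section \<open>A Poisson process in a window of finite volume\<close>

lemma poisson_moment_sums:
  fixes m :: real
  shows "(\<lambda>k. m ^ k / fact k * exp (- m)) sums 1"
    and "(\<lambda>k. real k * (m ^ k / fact k * exp (- m))) sums m"
    and "(\<lambda>k. (real k)\<^sup>2 * (m ^ k / fact k * exp (- m))) sums (m + m\<^sup>2)"
proof -
  have "(\<lambda>k. m ^ k / fact k) sums exp m"
    using exp_converges[of m] by (simp add: divide_inverse mult.commute)
  from sums_mult2[OF this, of "exp (- m)"]
  show 0: "(\<lambda>k. m ^ k / fact k * exp (- m)) sums 1" by (simp flip: exp_add)
  have shift: "real (Suc k) * (m ^ Suc k / fact (Suc k) * exp (- m)) = m * (m ^ k / fact k * exp (- m))" for k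
    by (simp add: field_simps del: of_nat_Suc)
  have "(\<lambda>k. real (Suc k) * (m ^ Suc k / fact (Suc k) * exp (- m))) sums m"
    unfolding shift using sums_mult[OF 0, of m] by simp
  then show 1: "(\<lambda>k. real k * (m ^ k / fact k * exp (- m))) sums m"
    by (subst (asm) sums_Suc_iff) simp
  have shift2: "(real (Suc k))\<^sup>2 * (m ^ Suc k / fact (Suc k) * exp (- m)) =
      m * (real k * (m ^ k / fact k * exp (- m)) + m ^ k / fact k * exp (- m))" for k
  proof -
    have "(real (Suc k))\<^sup>2 * (m ^ Suc k / fact (Suc k) * exp (- m)) =
        real (Suc k) * (m * (m ^ k / fact k * exp (- m)))"
      unfolding shift[symmetric] by (simp add: power2_eq_square mult.assoc del: of_nat_Suc)
    also have "\<dots> = m * (real k * (m ^ k / fact k * exp (- m)) + m ^ k / fact k * exp (- m))"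
      unfolding of_nat_Suc by (simp only: distrib_right distrib_left mult_1 mult.left_commute)
    finally show ?thesis .
  qed
  have "(\<lambda>k. (real (Suc k))\<^sup>2 * (m ^ Suc k / fact (Suc k) * exp (- m))) sums (m + m\<^sup>2)"
    unfolding shift2 using sums_mult[OF sums_add[OF 1 0], of m] by (simp add: algebra_simps power2_eq_square)
  then show "(\<lambda>k. (real k)\<^sup>2 * (m ^ k / fact k * exp (- m))) sums (m + m\<^sup>2)"
    by (subst (asm) sums_Suc_iff) simp
qed

text \<open>
  The random number \<open>Z\<close> takes values in \<open>{0, 1, \<dots>, \<infinity>}\<close>, and \<open>H\<close> is the function whose mean is computed; \<open>h\<close> gives
  its values on the natural numbers. That the probabilities add up to 1 excludes the value \<open>\<infinity>\<close>.
\<close>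

lemma poisson_expectation:
  fixes Z :: "'w \<Rightarrow> ennreal" and h :: "nat \<Rightarrow> real"
  assumes "prob_space P" and Z [measurable]: "Z \<in> borel_measurable P"
    and dist: "\<And>k. measure P {\<omega> \<in> space P. Z \<omega> = of_nat k} = m ^ k / fact k * exp (- m)"
    and m: "0 \<le> m" and h: "\<And>k. 0 \<le> h k" "(\<lambda>k. h k * (m ^ k / fact k * exp (- m))) sums s"
    and H: "\<And>k. H (of_nat k) = ennreal (h k)"
  shows "AE \<omega> in P. Z \<omega> \<in> range of_nat" "(\<integral>\<^sup>+\<omega>. H (Z \<omega>) \<partial>P) = ennreal s"
proof -
  interpret prob_space P by fact
  define Q where "Q k = {\<omega> \<in> space P. Z \<omega> = of_nat k}" for k :: nat
  have Q [measurable]: "Q k \<in> sets P" for k unfolding Q_def by measurable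
  have disj: "disjoint_family Q" by (auto simp: disjoint_family_on_def Q_def)
  have "(\<lambda>k. prob (Q k)) sums prob (\<Union>k. Q k)"
    using disj by (intro finite_measure_UNION) auto
  moreover have "(\<lambda>k. prob (Q k)) sums 1"
    unfolding Q_def dist by (rule poisson_moment_sums)
  ultimately have "prob (\<Union>k. Q k) = 1" using sums_unique2 by blast
  then have "AE \<omega> in P. \<omega> \<in> (\<Union>k. Q k)" by (rule AE_prob_1)
  then show AE: "AE \<omega> in P. Z \<omega> \<in> range of_nat"
    by eventually_elim (auto simp: Q_def)
  have "(\<integral>\<^sup>+\<omega>. H (Z \<omega>) \<partial>P) = (\<integral>\<^sup>+\<omega>. (\<Sum>k. ennreal (h k) * indicator (Q k) \<omega>) \<partial>P)"
  proof (rule nn_integral_cong_AE)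
    show "AE \<omega> in P. H (Z \<omega>) = (\<Sum>k. ennreal (h k) * indicator (Q k) \<omega>)"
      using AE AE_space
    proof eventually_elim
      case (elim \<omega>)
      then obtain k where k: "Z \<omega> = of_nat k" by auto
      have "(\<Sum>j. ennreal (h j) * indicator (Q j) \<omega>) = (\<Sum>j\<in>{k}. ennreal (h j) * indicator (Q j) \<omega>)"
        using k by (intro suminf_finite) (auto simp: Q_def)
      then show ?case using k elim by (simp add: H Q_def)
    qed
  qed
  also have "\<dots> = (\<Sum>k. ennreal (h k) * emeasure P (Q k))"
    by (subst nn_integral_suminf) (auto simp: nn_integral_cmult_indicator)
  also have "\<dots> = (\<Sum>k. ennreal (h k * (m ^ k / fact k * exp (- m))))"
    using h(1) by (intro suminf_cong) (simp only: emeasure_eq_measure dist[folded Q_def] ennreal_mult'[symmetric])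
  also have "\<dots> = ennreal s"
  proof (rule sums_unique[symmetric])
    have nn: "0 \<le> h k * (m ^ k / fact k * exp (- m))" for k using h(1) m by simp
    then have "0 \<le> s" by (rule sums_le[OF _ sums_zero h(2)])
    with nn h(2) show "(\<lambda>k. ennreal (h k * (m ^ k / fact k * exp (- m)))) sums ennreal s"
      by (simp add: sums_ennreal)
  qed
  finally show "(\<integral>\<^sup>+\<omega>. H (Z \<omega>) \<partial>P) = ennreal s" .
qed

locale poisson_window =
  fixes P :: "'w measure" and N :: "'w \<Rightarrow> 'm::{t2_space, second_countable_topology} measure"
    and \<mu> :: "'m measure" and E :: "'m set"
  assumes poisson: "poisson_process P N \<mu>" and sets_mu: "sets \<mu> = sets borel"
    and E: "E \<in> sets borel" "emeasure \<mu> E < \<infinity>" and diffuse: "\<And>x. emeasure \<mu> {x} = 0"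
begin

lemma prob_space_P: "prob_space P" and point_process: "point_process P N"
  using poisson by (auto simp: poisson_process_def point_process_def)

lemma sets_N: "\<omega> \<in> space P \<Longrightarrow> sets (N \<omega>) = sets borel"
  using point_process by (auto simp: point_process_def)

lemma measurable_N [measurable]: "B \<in> sets borel \<Longrightarrow> (\<lambda>\<omega>. emeasure (N \<omega>) B) \<in> borel_measurable P"
  using point_process by (auto simp: point_process_def)

lemma N_moments:
  assumes B: "B \<in> sets borel" "emeasure \<mu> B < \<infinity>"
  shows "AE \<omega> in P. emeasure (N \<omega>) B < \<infinity>"
    "(\<integral>\<^sup>+\<omega>. emeasure (N \<omega>) B \<partial>P) = emeasure \<mu> B"
    "(\<integral>\<^sup>+\<omega>. (emeasure (N \<omega>) B)\<^sup>2 \<partial>P) = emeasure \<mu> B + (emeasure \<mu> B)\<^sup>2"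
proof -
  have d: "measure P {\<omega> \<in> space P. emeasure (N \<omega>) B = of_nat k} =
      measure \<mu> B ^ k / fact k * exp (- measure \<mu> B)" for k
    using poisson B unfolding poisson_process_def by blast
  have em: "emeasure \<mu> B = ennreal (measure \<mu> B)" using B(2) by (intro emeasure_eq_ennreal_measure) auto
  note pe = poisson_expectation[OF prob_space_P measurable_N[OF B(1)] d measure_nonneg]
  have nat: "ennreal (real k) = of_nat k" for k by (rule ennreal_of_nat_eq_real_of_nat[symmetric])
  show "(\<integral>\<^sup>+\<omega>. emeasure (N \<omega>) B \<partial>P) = emeasure \<mu> B"
    unfolding em by (rule pe(2)[where h = real and H = "\<lambda>z. z"]) (use poisson_moment_sums(2)[of "measure \<mu> B"] nat in simp_all)
  have "(\<integral>\<^sup>+\<omega>. (emeasure (N \<omega>) B)\<^sup>2 \<partial>P) = ennreal (measure \<mu> B + (measure \<mu> B)\<^sup>2)"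
    by (rule pe(2)[where h = "\<lambda>k. (real k)\<^sup>2" and H = "\<lambda>z. z\<^sup>2"])
      (use poisson_moment_sums(3)[of "measure \<mu> B"] in \<open>simp_all add: nat[symmetric] ennreal_power del: ennreal_of_nat_eq_real_of_nat\<close>)
  then show "(\<integral>\<^sup>+\<omega>. (emeasure (N \<omega>) B)\<^sup>2 \<partial>P) = emeasure \<mu> B + (emeasure \<mu> B)\<^sup>2"
    unfolding em by (simp add: ennreal_power)
  have "AE \<omega> in P. emeasure (N \<omega>) B \<in> range of_nat"
    by (rule pe(1)[where h = real and H = "\<lambda>z. z"]) (use poisson_moment_sums(2)[of "measure \<mu> B"] nat in simp_all)
  then show "AE \<omega> in P. emeasure (N \<omega>) B < \<infinity>"
    by eventually_elim (auto simp: of_nat_less_top)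
qed

text \<open>
  The process restricted to the window, modified on a null set so that it is finite without exception;
  \<open>M\<close> is its intensity.
\<close>

definition K :: "'w \<Rightarrow> 'm measure" where
  "K \<omega> = (if \<omega> \<in> space P \<and> emeasure (N \<omega>) E < \<infinity> then density (N \<omega>) (indicator E) else null_measure borel)"

definition M :: "'m measure" where "M = density \<mu> (indicator E)"

lemma sets_KM: "sets (K \<omega>) = sets borel" "sets M = sets borel"
  by (simp_all add: K_def M_def sets_N sets_mu)

lemma emeasure_K:
  assumes "B \<in> sets borel"
  shows "emeasure (K \<omega>) B = (if \<omega> \<in> space P \<and> emeasure (N \<omega>) E < \<infinity> then emeasure (N \<omega>) (B \<inter> E) else 0)"
  using assms E by (simp add: K_def emeasure_density_indicator sets_N)

lemma emeasure_M: "B \<in> sets borel \<Longrightarrow> emeasure M B = emeasure \<mu> (B \<inter> E)"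
  using E by (simp add: M_def emeasure_density_indicator sets_mu)

lemma mu_Int_finite: "B \<in> sets borel \<Longrightarrow> emeasure \<mu> (B \<inter> E) < \<infinity>"
  using E sets_mu by (intro le_less_trans[OF emeasure_mono[of "B \<inter> E" E] E(2)]) auto

lemma AE_K_eq: "AE \<omega> in P. \<forall>B\<in>sets borel. emeasure (K \<omega>) B = emeasure (N \<omega>) (B \<inter> E)"
  using N_moments(1)[OF E] AE_space by eventually_elim (simp add: emeasure_K)

sublocale random_finite_measure P K M
proof (intro random_finite_measure.intro prob_space_P random_finite_measure_axioms.intro)
  interpret prob_space P by (rule prob_space_P)
  show "sets (K \<omega>) = sets borel" "sets M = sets borel" for \<omega> by (rule sets_KM)+
  show "emeasure (K \<omega>) UNIV < \<infinity>" for \<omega> by (simp add: emeasure_K)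
  show "emeasure M UNIV < \<infinity>" using E by (simp add: emeasure_M)
  show "(\<lambda>\<omega>. emeasure (K \<omega>) B) \<in> borel_measurable P" if B: "B \<in> sets borel" for B
  proof -
    have [measurable]: "B \<inter> E \<in> sets borel" "E \<in> sets borel" using B E by auto
    have "(\<lambda>\<omega>. if emeasure (N \<omega>) E < \<infinity> then emeasure (N \<omega>) (B \<inter> E) else 0) \<in> borel_measurable P"
      by measurable
    then show ?thesis by (rule measurable_cong[THEN iffD1, rotated]) (simp add: emeasure_K B)
  qed
  fix k :: nat and B :: "nat \<Rightarrow> 'm set"
  assume disj: "disjoint_family_on B {..<k}" and B: "\<And>i. i < k \<Longrightarrow> B i \<in> sets borel"
  have BE: "B i \<inter> E \<in> sets borel" if "i < k" for i using B[OF that] E by auto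
  have ind: "indep_vars (\<lambda>_. borel) (\<lambda>i \<omega>. emeasure (N \<omega>) (B i \<inter> E)) {..<k}"
  proof -
    have all: "\<forall>(I::nat set) B. finite I \<and> disjoint_family_on B I \<and> (\<forall>i\<in>I. B i \<in> sets borel) \<longrightarrow>
        indep_vars (\<lambda>_. borel) (\<lambda>i \<omega>. emeasure (N \<omega>) (B i)) I"
      using poisson unfolding poisson_process_def by (elim conjE)
    have "disjoint_family_on (\<lambda>i. B i \<inter> E) {..<k}" using disj by (auto simp: disjoint_family_on_def)
    then show ?thesis using all[THEN spec, THEN spec, of "{..<k}" "\<lambda>i. B i \<inter> E"] BE by simp
  qed
  have "(\<integral>\<^sup>+\<omega>. (\<Prod>i<k. emeasure (K \<omega>) (B i)) \<partial>P) = (\<integral>\<^sup>+\<omega>. (\<Prod>i<k. emeasure (N \<omega>) (B i \<inter> E)) \<partial>P)"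
  proof (rule nn_integral_cong_AE)
    show "AE \<omega> in P. (\<Prod>i<k. emeasure (K \<omega>) (B i)) = (\<Prod>i<k. emeasure (N \<omega>) (B i \<inter> E))"
      using AE_K_eq by eventually_elim (simp add: B)
  qed
  also have "\<dots> = (\<Prod>i<k. \<integral>\<^sup>+\<omega>. emeasure (N \<omega>) (B i \<inter> E) \<partial>P)"
    by (rule indep_vars_nn_integral[OF _ ind]) auto
  also have "\<dots> = (\<Prod>i<k. emeasure M (B i))"
    using B BE mu_Int_finite by (intro prod.cong) (simp_all add: N_moments emeasure_M)
  finally show "(\<integral>\<^sup>+\<omega>. (\<Prod>i<k. emeasure (K \<omega>) (B i)) \<partial>P) = (\<Prod>i<k. emeasure M (B i))" .
qed

abbreviation X :: "'w \<Rightarrow> 'm set" where "X \<omega> \<equiv> graph_vertices (K \<omega>)"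

lemma singleton_borel: "{x :: 'm} \<in> sets borel" by simp

lemma integer_K: "B \<in> sets borel \<Longrightarrow> emeasure (K \<omega>) B \<in> range of_nat"
proof -
  assume B: "B \<in> sets borel"
  show ?thesis
  proof (cases "\<omega> \<in> space P \<and> emeasure (N \<omega>) E < \<infinity>")
    case True
    have BE: "B \<inter> E \<in> sets borel" using B E by auto
    have "emeasure (N \<omega>) (B \<inter> E) \<le> emeasure (N \<omega>) E"
      using True E sets_N by (intro emeasure_mono) auto
    then have "emeasure (N \<omega>) (B \<inter> E) < \<infinity>" using True by (auto intro: le_less_trans)
    moreover have "emeasure (N \<omega>) (B \<inter> E) \<in> insert \<infinity> (range of_nat)"
      using point_process True BE unfolding point_process_def by blast
    ultimately show ?thesis using True B by (auto simp: emeasure_K)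
  next
    case False
    then have "emeasure (K \<omega>) B = of_nat 0" using B by (auto simp: emeasure_K)
    then show ?thesis by blast
  qed
qed

lemma finite_X: "finite (X \<omega>)" and K_off_X: "emeasure (K \<omega>) (- X \<omega>) = 0"
proof -
  have "emeasure (K \<omega>) B \<in> insert \<infinity> (range of_nat)" if "B \<in> sets borel" for B
    using integer_K[OF that] by auto
  from integer_measure_atomic[OF sets_K this, of UNIV]
  show "finite (X \<omega>)" "emeasure (K \<omega>) (- X \<omega>) = 0" using finite_K by (simp_all add: Compl_eq_Diff_UNIV)
qed

lemma X_sets: "B \<subseteq> X \<omega> \<Longrightarrow> B \<in> sets borel"
  using finite_X[of \<omega>] by (meson borel_closed finite_imp_closed finite_subset)

lemma K_UNIV: "emeasure (K \<omega>) UNIV = (\<Sum>x\<in>X \<omega>. emeasure (K \<omega>) {x})"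
proof -
  have "emeasure (K \<omega>) UNIV = emeasure (K \<omega>) (X \<omega>) + emeasure (K \<omega>) (- X \<omega>)"
    using X_sets[of "X \<omega>" \<omega>] by (subst plus_emeasure) auto
  also have "\<dots> = (\<Sum>x\<in>X \<omega>. emeasure (K \<omega>) {x})"
    using finite_X by (subst emeasure_eq_sum_singleton) (auto simp: K_off_X)
  finally show ?thesis .
qed

lemma singleton_tuple: "f \<in> space (tuples k) \<Longrightarrow> {f} = Pi\<^sub>E {..<k} (\<lambda>i. {f i})"
  by (auto simp: space_tuples PiE_def extensional_def fun_eq_iff Pi_iff) (metis lessThan_iff)

text \<open>
  As the restricted process is atomic, its powers are sums over tuples of atoms.
\<close>

lemma Kpow_eq_sum:
  assumes S: "S \<in> sets (tuples k)"
  shows "emeasure (Kpow k \<omega>) S = (\<Sum>f\<in>S \<inter> ({..<k} \<rightarrow>\<^sub>E X \<omega>). \<Prod>i<k. emeasure (K \<omega>) {f i})"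
proof -
  let ?Y = "{..<k} \<rightarrow>\<^sub>E X \<omega>"
  have Xb: "X \<omega> \<in> sets borel" by (rule X_sets[OF order_refl])
  have Y: "?Y \<in> sets (tuples k)" using Xb by (intro rect_sets)
  have KX: "emeasure (K \<omega>) (X \<omega>) = emeasure (K \<omega>) UNIV"
    unfolding K_UNIV using finite_X by (subst emeasure_eq_sum_singleton) auto
  have "emeasure (Kpow k \<omega>) ?Y = emeasure (Kpow k \<omega>) (space (tuples k))"
    using Xb by (simp add: Kpow_rect Kpow_space KX)
  then have null: "emeasure (Kpow k \<omega>) (space (tuples k) - ?Y) = 0"
    using emeasure_compl[of ?Y "Kpow k \<omega>"] Y finite_Kpow[of k \<omega> ?Y] by simp
  have "emeasure (Kpow k \<omega>) (S - ?Y) \<le> emeasure (Kpow k \<omega>) (space (tuples k) - ?Y)"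
    using S Y sets.sets_into_space[OF S] by (intro emeasure_mono) auto
  then have "emeasure (Kpow k \<omega>) (S - ?Y) = 0" using null by simp
  moreover have "emeasure (Kpow k \<omega>) S = emeasure (Kpow k \<omega>) (S \<inter> ?Y) + emeasure (Kpow k \<omega>) (S - ?Y)"
    using S Y by (subst plus_emeasure) (auto simp: Int_Diff_Un)
  ultimately have "emeasure (Kpow k \<omega>) S = emeasure (Kpow k \<omega>) (S \<inter> ?Y)" by simp
  also have "\<dots> = (\<Sum>f\<in>S \<inter> ?Y. emeasure (Kpow k \<omega>) {f})"
  proof (rule emeasure_eq_sum_singleton)
    show "finite (S \<inter> ?Y)" using finite_X by (intro finite_Int disjI2 finite_PiE) auto
    fix f assume "f \<in> S \<inter> ?Y"
    then have "f \<in> space (tuples k)" using sets.sets_into_space[OF S] by auto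
    then show "{f} \<in> sets (Kpow k \<omega>)" by (simp add: singleton_tuple rect_sets)
  qed
  also have "\<dots> = (\<Sum>f\<in>S \<inter> ?Y. \<Prod>i<k. emeasure (K \<omega>) {f i})"
  proof (rule sum.cong[OF refl])
    fix f assume "f \<in> S \<inter> ?Y"
    then have "f \<in> space (tuples k)" using sets.sets_into_space[OF S] by auto
    then show "emeasure (Kpow k \<omega>) {f} = (\<Prod>i<k. emeasure (K \<omega>) {f i})"
      by (simp add: singleton_tuple Kpow_rect)
  qed
  finally show ?thesis .
qed

lemma nn_integral_Mpow_Suc:
  assumes "f \<in> borel_measurable (tuples (Suc k))"
  shows "(\<integral>\<^sup>+x. f x \<partial>Mpow (Suc k)) = (\<integral>\<^sup>+x. \<integral>\<^sup>+y. f (x(k := y)) \<partial>M \<partial>Mpow k)"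
proof -
  have s: "sets (PiM (insert k {..<k}) (\<lambda>_. M)) = sets (tuples (Suc k))"
    unfolding tuples_def lessThan_Suc by (intro sets_PiM_cong) auto
  have "f \<in> borel_measurable (PiM (insert k {..<k}) (\<lambda>_. M))"
    using assms by (simp cong: measurable_cong_sets add: measurable_cong_sets[OF s refl])
  then show ?thesis
    unfolding Mpow_def lessThan_Suc
    by (intro product_sigma_finite.product_nn_integral_insert[OF product_sigma_finite_M]) auto
qed

lemma nn_integral_Mpow_0: "(\<integral>\<^sup>+x. f x \<partial>Mpow 0) = f (\<lambda>_. undefined)"
  unfolding Mpow_def by (simp add: PiM_empty nn_integral_count_space_finite)

lemma measurable_coord [measurable]: "i < k \<Longrightarrow> (\<lambda>f. f i) \<in> measurable (tuples k) borel"
  unfolding tuples_def by (rule measurable_component_singleton) simp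

lemma measurable_coord_pair:
  assumes "i < k" "j < k" and D: "D \<in> sets (borel :: ('m \<times> 'm) measure)"
  shows "{f \<in> space (tuples k). (f i, f j) \<in> D} \<in> sets (tuples k)"
proof -
  have "(\<lambda>f. (f i, f j)) \<in> measurable (tuples k) (borel \<Otimes>\<^sub>M borel)"
    using assms by (intro measurable_Pair measurable_coord)
  then have "(\<lambda>f. (f i, f j)) \<in> measurable (tuples k) borel" by (simp add: borel_prod)
  from measurable_sets[OF this D] show ?thesis by (simp add: vimage_def Int_def conj_commute)
qed

lemma diagonal_borel: "{z :: 'm \<times> 'm. fst z = snd z} \<in> sets borel"
  by (intro borel_closed closed_Collect_eq continuous_intros)

text \<open>
  For a set \<open>D\<close> of pairs, \<open>deg D x\<close> is the mean number of points in the window that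
  are related to \<open>x\<close>. The lemmas \<open>Mpow_2\<close> to \<open>Mpow_4\<close> express through it the intensities of related pairs, of
  two related pairs with the same first point, and of two related pairs chosen independently.
\<close>

definition deg :: "('m \<times> 'm) set \<Rightarrow> 'm \<Rightarrow> ennreal" where
  "deg D x = (\<integral>\<^sup>+y. indicator D (x, y) \<partial>M)"

lemma measurable_deg:
  assumes "D \<in> sets borel"
  shows "deg D \<in> borel_measurable borel"
proof -
  interpret M: sigma_finite_measure M using finite_measure_M by (simp add: finite_measure_def)
  have "sets (borel \<Otimes>\<^sub>M M) = sets (borel :: ('m \<times> 'm) measure)"
    unfolding borel_prod[symmetric] by (intro sets_pair_measure_cong) auto
  then have "D \<in> sets (borel \<Otimes>\<^sub>M M)" using assms by metis
  then have "(indicator D :: _ \<Rightarrow> ennreal) \<in> borel_measurable (borel \<Otimes>\<^sub>M M)" by (rule borel_measurable_indicator)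
  moreover have "(indicator D :: _ \<Rightarrow> ennreal) = case_prod (\<lambda>x y. indicator D (x, y))" by auto
  ultimately have "case_prod (\<lambda>x y. indicator D (x, y) :: ennreal) \<in> borel_measurable (borel \<Otimes>\<^sub>M M)" by metis
  then show ?thesis unfolding deg_def by (rule M.borel_measurable_nn_integral)
qed

context
  fixes D :: "('m \<times> 'm) set"
  assumes D: "D \<in> sets borel"
begin

lemma measurable_indicator_pair [measurable]:
  assumes "i < k" "j < k"
  shows "(\<lambda>f. indicator D (f i, f j) :: ennreal) \<in> borel_measurable (tuples k)"
proof -
  have "(\<lambda>f. (f i, f j)) \<in> measurable (tuples k) (borel \<Otimes>\<^sub>M borel)"
    using assms by (intro measurable_Pair measurable_coord)
  then have "(\<lambda>f. (f i, f j)) \<in> measurable (tuples k) borel" by (simp add: borel_prod)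
  then show ?thesis by (rule measurable_compose) (use D in simp)
qed

lemma measurable_deg_coord [measurable]:
  "i < k \<Longrightarrow> (\<lambda>f. deg D (f i)) \<in> borel_measurable (tuples k)"
  by (rule measurable_compose[OF measurable_coord measurable_deg[OF D]])

lemma indicator_section_measurable: "(\<lambda>y. indicator D (x, y) :: ennreal) \<in> borel_measurable M"
proof -
  have "(\<lambda>y. (x, y)) \<in> measurable borel borel"
    by (intro borel_measurable_continuous_onI continuous_intros)
  then have "(\<lambda>y. indicator D (x, y) :: ennreal) \<in> borel_measurable borel"
    by (rule measurable_compose) (use D in simp)
  then show ?thesis by (simp add: measurable_cong_sets[OF sets_M refl])
qed

lemma deg_measurable_M: "deg D \<in> borel_measurable M"
  using measurable_deg[OF D] unfolding measurable_cong_sets[OF sets_M refl] .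

lemma Mpow_1: "f \<in> borel_measurable borel \<Longrightarrow> (\<integral>\<^sup>+x. f (x 0) \<partial>Mpow 1) = (\<integral>\<^sup>+x. f x \<partial>M)"
proof -
  assume f: "f \<in> borel_measurable borel"
  have "(\<lambda>x. f (x 0)) \<in> borel_measurable (tuples (Suc 0))"
    by (rule measurable_compose[OF measurable_coord f]) simp
  from nn_integral_Mpow_Suc[OF this] show ?thesis
    unfolding nn_integral_Mpow_0 One_nat_def by (simp only: fun_upd_same)
qed

lemma Mpow_2: "(\<integral>\<^sup>+f. indicator D (f 0, f 1) \<partial>Mpow 2) = (\<integral>\<^sup>+x. deg D x \<partial>M)"
proof -
  have "(\<integral>\<^sup>+f. indicator D (f 0, f 1) \<partial>Mpow (Suc 1)) = (\<integral>\<^sup>+x. deg D (x 0) \<partial>Mpow 1)"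
    by (subst nn_integral_Mpow_Suc) (auto simp: deg_def)
  then show ?thesis using Mpow_1[OF measurable_deg[OF D]] by (simp add: numeral_2_eq_2)
qed

lemma Mpow_3: "(\<integral>\<^sup>+f. indicator D (f 0, f 1) * indicator D (f 0, f 2) \<partial>Mpow 3) = (\<integral>\<^sup>+x. deg D x * deg D x \<partial>M)"
proof -
  have "(\<integral>\<^sup>+f. indicator D (f 0, f 1) * indicator D (f 0, f 2) \<partial>Mpow (Suc 2)) =
      (\<integral>\<^sup>+x. indicator D (x 0, x 1) * deg D (x 0) \<partial>Mpow 2)"
    by (subst nn_integral_Mpow_Suc) (auto simp: deg_def nn_integral_cmult indicator_section_measurable)
  also have "\<dots> = (\<integral>\<^sup>+x. indicator D (x 0, x 1) * deg D (x 0) \<partial>Mpow (Suc 1))" by (simp add: numeral_2_eq_2)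
  also have "\<dots> = (\<integral>\<^sup>+x. deg D (x 0) * deg D (x 0) \<partial>Mpow 1)"
  proof (subst nn_integral_Mpow_Suc)
    show "(\<lambda>x. indicator D (x 0, x 1) * deg D (x 0)) \<in> borel_measurable (tuples (Suc 1))"
      by (intro borel_measurable_times_ennreal measurable_indicator_pair measurable_deg_coord) auto
  qed (simp add: nn_integral_multc indicator_section_measurable flip: deg_def del: One_nat_def)
  also have "\<dots> = (\<integral>\<^sup>+x. deg D x * deg D x \<partial>M)"
    using measurable_deg[OF D] by (intro Mpow_1) simp
  finally show ?thesis by (simp add: eval_nat_numeral)
qed

lemma Mpow_4: "(\<integral>\<^sup>+f. indicator D (f 0, f 1) * indicator D (f 2, f 3) \<partial>Mpow 4) = (\<integral>\<^sup>+x. deg D x \<partial>M)\<^sup>2"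
proof -
  have "(\<integral>\<^sup>+f. indicator D (f 0, f 1) * indicator D (f 2, f 3) \<partial>Mpow (Suc 3)) =
      (\<integral>\<^sup>+x. indicator D (x 0, x 1) * deg D (x 2) \<partial>Mpow 3)"
    by (subst nn_integral_Mpow_Suc) (auto simp: deg_def nn_integral_cmult indicator_section_measurable)
  also have "\<dots> = (\<integral>\<^sup>+x. indicator D (x 0, x 1) * deg D (x 2) \<partial>Mpow (Suc 2))" by (simp add: eval_nat_numeral)
  also have "\<dots> = (\<integral>\<^sup>+x. indicator D (x 0, x 1) * (\<integral>\<^sup>+x. deg D x \<partial>M) \<partial>Mpow 2)"
    by (subst nn_integral_Mpow_Suc) (auto simp: nn_integral_cmult deg_measurable_M)
  also have "\<dots> = (\<integral>\<^sup>+x. deg D x \<partial>M)\<^sup>2"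
    by (subst nn_integral_multc)
      (auto simp: Mpow_2 power2_eq_square measurable_cong_sets[OF sets_pow(2) refl] simp del: One_nat_def)
  finally show ?thesis by (simp add: eval_nat_numeral)
qed

end

lemma K_moments:
  "(\<integral>\<^sup>+\<omega>. emeasure (K \<omega>) UNIV \<partial>P) = emeasure M UNIV"
  "(\<integral>\<^sup>+\<omega>. (emeasure (K \<omega>) UNIV)\<^sup>2 \<partial>P) = emeasure M UNIV + (emeasure M UNIV)\<^sup>2"
proof -
  have eq: "AE \<omega> in P. emeasure (K \<omega>) UNIV = emeasure (N \<omega>) E"
    using AE_K_eq by eventually_elim simp
  have "(\<integral>\<^sup>+\<omega>. emeasure (K \<omega>) UNIV \<partial>P) = (\<integral>\<^sup>+\<omega>. emeasure (N \<omega>) E \<partial>P)"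
    by (rule nn_integral_cong_AE[OF eq])
  then show "(\<integral>\<^sup>+\<omega>. emeasure (K \<omega>) UNIV \<partial>P) = emeasure M UNIV"
    by (simp add: N_moments[OF E] emeasure_M)
  have "(\<integral>\<^sup>+\<omega>. (emeasure (K \<omega>) UNIV)\<^sup>2 \<partial>P) = (\<integral>\<^sup>+\<omega>. (emeasure (N \<omega>) E)\<^sup>2 \<partial>P)"
    by (rule nn_integral_cong_AE) (use eq in eventually_elim, simp)
  then show "(\<integral>\<^sup>+\<omega>. (emeasure (K \<omega>) UNIV)\<^sup>2 \<partial>P) = emeasure M UNIV + (emeasure M UNIV)\<^sup>2"
    by (simp add: N_moments[OF E] emeasure_M)
qed

text \<open>
  No point carries mass more than 1. If \<open>Z\<close> is the total mass and \<open>m\<close> its mean, then \<open>Z\<^sup>2\<close> has mean \<open>m + m\<^sup>2\<close>,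
  and the off-diagonal part of the squared process contributes exactly \<open>m\<^sup>2\<close>, the diagonal being null for
  the intensity. So the diagonal part, the sum of the squared masses, has the same mean \<open>m\<close> as the sum of
  the masses; as the masses are natural numbers, almost surely each equals its square.
\<close>

lemma simple_points: "AE \<omega> in P. \<forall>x\<in>X \<omega>. emeasure (K \<omega>) {x} = 1"
proof -
  let ?d = "{z :: 'm \<times> 'm. fst z = snd z}"
  define Diag where "Diag = {f \<in> space (tuples 2). (f 0, f 1) \<in> ?d}"
  have Diag [measurable]: "Diag \<in> sets (tuples 2)"
    unfolding Diag_def by (rule measurable_coord_pair[OF _ _ diagonal_borel]) auto
  let ?O = "space (tuples 2) - Diag" and ?m = "emeasure M UNIV"
  have m: "?m < \<infinity>" by (rule finite_M)
  have "deg ?d x = 0" for x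
  proof -
    have "deg ?d x = (\<integral>\<^sup>+y. indicator {x} y \<partial>M)"
      unfolding deg_def by (intro nn_integral_cong) (auto simp: indicator_def)
    also have "\<dots> = emeasure \<mu> ({x} \<inter> E)" by (simp add: emeasure_M)
    also have "\<dots> \<le> emeasure \<mu> {x}" by (intro emeasure_mono) (auto simp: sets_mu)
    finally show ?thesis by (simp add: diffuse)
  qed
  then have "(\<integral>\<^sup>+f. indicator ?d (f 0, f 1) \<partial>Mpow 2) = 0" by (simp add: Mpow_2[OF diagonal_borel] del: One_nat_def)
  moreover have "(\<integral>\<^sup>+f. indicator ?d (f 0, f 1) \<partial>Mpow 2) = (\<integral>\<^sup>+f. indicator Diag f \<partial>Mpow 2)"
    by (intro nn_integral_cong) (auto simp: Diag_def indicator_def)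
  ultimately have MD: "emeasure (Mpow 2) Diag = 0" by simp
  have "emeasure (Mpow 2) ?O = ?m\<^sup>2"
    using emeasure_compl[of Diag "Mpow 2"] MD by (simp add: Mpow_space)
  moreover have "mean_pow 2 ?O = emeasure (Mpow 2) ?O"
    by (rule factorial_moments) (auto simp: Diag_def inj_on_def numeral_2_eq_2 less_Suc_eq)
  ultimately have O: "mean_pow 2 ?O = ?m\<^sup>2" by simp
  have "(emeasure (K \<omega>) UNIV)\<^sup>2 = emeasure (Kpow 2 \<omega>) Diag + emeasure (Kpow 2 \<omega>) ?O" for \<omega>
    unfolding Kpow_space[symmetric] using sets.sets_into_space[OF Diag]
    by (subst plus_emeasure) (auto intro!: arg_cong[where f = "emeasure (Kpow 2 \<omega>)"])
  then have "?m + ?m\<^sup>2 = (\<integral>\<^sup>+\<omega>. emeasure (Kpow 2 \<omega>) Diag + emeasure (Kpow 2 \<omega>) ?O \<partial>P)"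
    unfolding K_moments(2)[symmetric] by simp
  also have "\<dots> = mean_pow 2 Diag + mean_pow 2 ?O"
    unfolding mean_pow_def by (rule nn_integral_add) auto
  finally have "mean_pow 2 Diag + ?m\<^sup>2 = ?m + ?m\<^sup>2" unfolding O by (rule sym)
  moreover have "?m\<^sup>2 < \<infinity>" using m by (simp add: power_less_top_ennreal)
  ultimately have mD: "mean_pow 2 Diag = ?m" by auto
  have KD: "emeasure (Kpow 2 \<omega>) Diag = (\<Sum>x\<in>X \<omega>. (emeasure (K \<omega>) {x})\<^sup>2)" for \<omega>
  proof -
    have "(\<Sum>f\<in>Diag \<inter> ({..<2} \<rightarrow>\<^sub>E X \<omega>). \<Prod>i<2. emeasure (K \<omega>) {f i}) = (\<Sum>x\<in>X \<omega>. (emeasure (K \<omega>) {x})\<^sup>2)"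
    proof (rule sum.reindex_bij_witness[where i = "\<lambda>x. \<lambda>i\<in>{..<2}. x" and j = "\<lambda>f. f 0"])
      fix f assume f: "f \<in> Diag \<inter> ({..<2} \<rightarrow>\<^sub>E X \<omega>)"
      then have f01: "f 0 = f 1" and ext: "f \<in> extensional {..<2}" by (auto simp: Diag_def PiE_def)
      show "(\<lambda>i\<in>{..<2}. f 0) = f"
      proof (rule extensionalityI[OF restrict_extensional ext])
        fix i :: nat assume "i \<in> {..<2}"
        then have "i = 0 \<or> i = 1" by auto
        then show "(\<lambda>i\<in>{..<2}. f 0) i = f i" using f01 by auto
      qed
      show "f 0 \<in> X \<omega>" by (rule PiE_mem[of f "{..<2}" "\<lambda>_. X \<omega>"]) (use f in simp_all)
      show "(emeasure (K \<omega>) {f 0})\<^sup>2 = (\<Prod>i<2. emeasure (K \<omega>) {f i})"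
        using f01 by (simp add: numeral_2_eq_2 power2_eq_square)
    qed (auto simp: Diag_def space_tuples)
    then show ?thesis by (simp add: Kpow_eq_sum[OF Diag])
  qed
  have nat: "\<exists>n. emeasure (K \<omega>) {x} = of_nat n \<and> n \<le> n\<^sup>2" for \<omega> x
  proof -
    obtain n where "emeasure (K \<omega>) {x} = of_nat n" using integer_K[OF singleton_borel, of \<omega> x] by auto
    then show ?thesis by (intro exI[of _ n]) (auto simp: power2_eq_square)
  qed
  have le: "emeasure (K \<omega>) UNIV \<le> emeasure (Kpow 2 \<omega>) Diag" for \<omega>
    unfolding K_UNIV KD
  proof (rule sum_mono)
    fix x
    obtain n where "emeasure (K \<omega>) {x} = of_nat n" "n \<le> n\<^sup>2" using nat by blast
    then show "emeasure (K \<omega>) {x} \<le> (emeasure (K \<omega>) {x})\<^sup>2" by (simp flip: of_nat_power)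
  qed
  have "(\<integral>\<^sup>+\<omega>. emeasure (Kpow 2 \<omega>) Diag - emeasure (K \<omega>) UNIV \<partial>P) = ?m - ?m"
    using m le by (subst nn_integral_diff) (auto simp: K_moments(1) mD[unfolded mean_pow_def])
  also have "\<dots> = 0" using m by simp
  finally have "AE \<omega> in P. emeasure (Kpow 2 \<omega>) Diag - emeasure (K \<omega>) UNIV = 0"
    by (subst (asm) nn_integral_0_iff_AE) auto
  then show ?thesis
  proof eventually_elim
    case (elim \<omega>)
    then have "emeasure (Kpow 2 \<omega>) Diag \<le> emeasure (K \<omega>) UNIV"
      using finite_K[of \<omega>] by (simp add: diff_eq_0_iff_ennreal)
    then have eq: "emeasure (Kpow 2 \<omega>) Diag = emeasure (K \<omega>) UNIV" using le by (simp add: antisym)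
    obtain n where n: "\<And>x. emeasure (K \<omega>) {x} = of_nat (n x)" "\<And>x. n x \<le> (n x)\<^sup>2"
      using nat[of \<omega>] by metis
    have "(of_nat (\<Sum>x\<in>X \<omega>. n x) :: ennreal) = of_nat (\<Sum>x\<in>X \<omega>. (n x)\<^sup>2)"
      using eq unfolding KD K_UNIV n(1) by simp
    then have s: "(\<Sum>x\<in>X \<omega>. n x) = (\<Sum>x\<in>X \<omega>. (n x)\<^sup>2)" by (simp only: of_nat_eq_iff)
    show ?case
    proof
      fix x assume x: "x \<in> X \<omega>"
      have "n x = (n x)\<^sup>2" by (rule sum_mono_inv[OF s n(2) x finite_X])
      moreover have "n x \<noteq> 0" using x n(1)[of x] by (auto simp: graph_vertices_def)
      ultimately have "n x = 1" by (simp add: power2_eq_square)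
      then show "emeasure (K \<omega>) {x} = 1" using n(1) by simp
    qed
  qed
qed

end

section \<open>Deviation of the numbers of vertices and edges\<close>

text \<open>
  Two ordered pairs either consist of four distinct points, or they share a point in one of four ways. In
  the latter case symmetry allows the common point to be the first one of both pairs; these
  configurations are counted by \<open>R\<close>, together with \<open>Q2\<close> if the two remaining points coincide as well.
\<close>

lemma card_pairs_square_le:
  assumes fin: "finite X" and sym: "\<And>x y. (x, y) \<in> D \<Longrightarrow> (y, x) \<in> D" and irr: "\<And>x. (x, x) \<notin> D"
  defines "Q \<equiv> {(x, y, z, w) \<in> X \<times> X \<times> X \<times> X. distinct [x, y, z, w] \<and> (x, y) \<in> D \<and> (z, w) \<in> D}"
    and "R \<equiv> {(x, y, z) \<in> X \<times> X \<times> X. distinct [x, y, z] \<and> (x, y) \<in> D \<and> (x, z) \<in> D}"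
    and "Q2 \<equiv> D \<inter> X \<times> X"
  shows "(card Q2)\<^sup>2 \<le> card Q + 4 * (card R + card Q2)"
proof -
  define F where "F = {(x, y, z) \<in> X \<times> X \<times> X. (x, y) \<in> D \<and> (x, z) \<in> D}"
  have finF: "finite F" by (rule finite_subset[of _ "X \<times> X \<times> X"]) (use fin in \<open>auto simp: F_def\<close>)
  have finQ: "finite Q" by (rule finite_subset[of _ "X \<times> X \<times> X \<times> X"]) (use fin in \<open>auto simp: Q_def\<close>)
  have finR: "finite R" by (rule finite_subset[of _ "X \<times> X \<times> X"]) (use fin in \<open>auto simp: R_def\<close>)
  have finQ2: "finite Q2" using fin by (auto simp: Q2_def)
  have "F \<subseteq> R \<union> (\<lambda>(x, y). (x, y, y)) ` Q2"
    using irr by (auto simp: F_def R_def Q2_def image_iff)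
  then have "card F \<le> card (R \<union> (\<lambda>(x, y). (x, y, y)) ` Q2)"
    using finR finQ2 by (intro card_mono) auto
  also have "\<dots> \<le> card R + card ((\<lambda>(x, y). (x, y, y)) ` Q2)" by (rule card_Un_le)
  also have "\<dots> \<le> card R + card Q2" using finQ2 by (intro add_left_mono card_image_le)
  finally have F: "card F \<le> card R + card Q2" .
  let ?g = "\<lambda>(x, y, z, w). ((x, y), (z, w))"
  let ?h1 = "\<lambda>(x, y, w). ((x, y), (x, w))" and ?h2 = "\<lambda>(x, y, z). ((x, y), (z, x))"
    and ?h3 = "\<lambda>(y, x, w). ((x, y), (y, w))" and ?h4 = "\<lambda>(y, x, z). ((x, y), (z, y))"
  have "Q2 \<times> Q2 \<subseteq> ?g ` Q \<union> (?h1 ` F \<union> ?h2 ` F \<union> (?h3 ` F \<union> ?h4 ` F))"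
  proof
    fix p assume p: "p \<in> Q2 \<times> Q2"
    obtain x y z w where p_eq: "p = ((x, y), (z, w))" by (metis surj_pair)
    have xy: "(x, y) \<in> D" "(z, w) \<in> D" "(y, x) \<in> D" "(w, z) \<in> D" "x \<in> X" "y \<in> X" "z \<in> X" "w \<in> X"
      using p sym by (auto simp: p_eq Q2_def)
    then have ne: "x \<noteq> y" "z \<noteq> w" using irr by auto
    consider "z = x" | "w = x" | "z = y" | "w = y" | "distinct [x, y, z, w]" using ne by auto
    then show "p \<in> ?g ` Q \<union> (?h1 ` F \<union> ?h2 ` F \<union> (?h3 ` F \<union> ?h4 ` F))"
    proof cases
      case 1
      then have "(x, y, w) \<in> F" "p = ?h1 (x, y, w)" using xy by (auto simp: F_def p_eq)
      then show ?thesis by blast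
    next
      case 2
      then have "(x, y, z) \<in> F" "p = ?h2 (x, y, z)" using xy by (auto simp: F_def p_eq)
      then show ?thesis by blast
    next
      case 3
      then have "(y, x, w) \<in> F" "p = ?h3 (y, x, w)" using xy by (auto simp: F_def p_eq)
      then show ?thesis by blast
    next
      case 4
      then have "(y, x, z) \<in> F" "p = ?h4 (y, x, z)" using xy by (auto simp: F_def p_eq)
      then show ?thesis by blast
    next
      case 5
      then have "(x, y, z, w) \<in> Q" "p = ?g (x, y, z, w)" using xy by (auto simp: Q_def p_eq)
      then show ?thesis by blast
    qed
  qed
  then have "card (Q2 \<times> Q2) \<le> card (?g ` Q \<union> (?h1 ` F \<union> ?h2 ` F \<union> (?h3 ` F \<union> ?h4 ` F)))"
    using finF finQ by (intro card_mono) auto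
  also have "\<dots> \<le> card (?g ` Q) + ((card (?h1 ` F) + card (?h2 ` F)) + (card (?h3 ` F) + card (?h4 ` F)))"
    by (intro order_trans[OF card_Un_le] add_mono order_refl card_Un_le)
  also have "\<dots> \<le> card Q + ((card F + card F) + (card F + card F))"
    using finF finQ by (intro add_mono card_image_le)
  finally show ?thesis using F by (simp add: card_cartesian_product power2_eq_square)
qed

lemma card_unordered_pairs_le:
  assumes fin: "finite Q" and sym: "\<And>x y. (x, y) \<in> Q \<Longrightarrow> (y, x) \<in> Q" and irr: "\<And>x. (x, x) \<notin> Q"
  shows "2 * card ((\<lambda>(x, y). {x, y}) ` Q) \<le> card Q"
proof -
  let ?e = "\<lambda>(x, y). {x, y}"
  have "2 * card (?e ` Q) = (\<Sum>e\<in>?e ` Q. 2)" by simp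
  also have "\<dots> \<le> (\<Sum>e\<in>?e ` Q. card {p \<in> Q. ?e p = e})"
  proof (rule sum_mono)
    fix e assume "e \<in> ?e ` Q"
    then obtain x y where xy: "(x, y) \<in> Q" "e = {x, y}" by auto
    have "card {(x, y), (y, x)} \<le> card {p \<in> Q. ?e p = e}"
      using xy sym fin by (intro card_mono) auto
    moreover have "x \<noteq> y" using xy irr by auto
    ultimately show "2 \<le> card {p \<in> Q. ?e p = e}" by simp
  qed
  also have "\<dots> = card (\<Union>e\<in>?e ` Q. {p \<in> Q. ?e p = e})"
    using fin by (intro card_UN_disjoint[symmetric]) auto
  also have "(\<Union>e\<in>?e ` Q. {p \<in> Q. ?e p = e}) = Q" by auto
  finally show ?thesis .
qed

lemma (in prob_space) chebyshev_ennreal: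
  assumes Z [measurable]: "Z \<in> borel_measurable M" and fin: "\<And>\<omega>. Z \<omega> < \<infinity>"
    and mean: "(\<integral>\<^sup>+\<omega>. Z \<omega> \<partial>M) = ennreal a" and a: "0 \<le> a"
    and second: "(\<integral>\<^sup>+\<omega>. (Z \<omega>)\<^sup>2 \<partial>M) \<le> ennreal (a\<^sup>2 + v)" and v: "0 \<le> v" and r: "0 < r"
  shows "prob {\<omega> \<in> space M. r \<le> \<bar>enn2real (Z \<omega>) - a\<bar>} \<le> v / r\<^sup>2"
proof -
  let ?z = "\<lambda>\<omega>. enn2real (Z \<omega>)"
  have e: "ennreal (?z \<omega>) = Z \<omega>" for \<omega> using fin by simp
  have e2: "ennreal ((?z \<omega>)\<^sup>2) = (Z \<omega>)\<^sup>2" for \<omega> by (simp add: e flip: ennreal_power)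
  have int: "integrable M ?z" by (rule integrableI_nonneg) (auto simp: e mean)
  have int2: "integrable M (\<lambda>\<omega>. (?z \<omega>)\<^sup>2)"
    by (rule integrableI_nonneg) (use second in \<open>auto simp: e2 intro: le_less_trans\<close>)
  have ex: "expectation ?z = a"
    using a by (subst integral_eq_nn_integral) (auto simp: e mean)
  have ex2: "expectation (\<lambda>\<omega>. (?z \<omega>)\<^sup>2) \<le> a\<^sup>2 + v"
    using second v by (subst integral_eq_nn_integral) (auto simp: e2 intro!: enn2real_leI)
  have "variance ?z \<le> v" using variance_eq[OF int int2] ex ex2 by simp
  then have "variance ?z / r\<^sup>2 \<le> v / r\<^sup>2" by (intro divide_right_mono) auto
  then show ?thesis
    using Chebyshev_inequality[of ?z r] int2 r ex by simp
qed

text \<open>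
  The edges of the threshold model for an arbitrary relation \<open>R\<close> in place of distance at most \<open>t\<close>.
\<close>

definition pair_edges :: "('m \<Rightarrow> 'm \<Rightarrow> bool) \<Rightarrow> 'm measure \<Rightarrow> 'm set set" where
  "pair_edges R \<nu> = {{x, y} | x y. x \<in> graph_vertices \<nu> \<and> y \<in> graph_vertices \<nu> \<and> x \<noteq> y \<and> R x y}"

context poisson_window
begin

lemma Kpow_simple:
  assumes "\<forall>x\<in>X \<omega>. emeasure (K \<omega>) {x} = 1" and S: "S \<in> sets (tuples k)"
  shows "emeasure (Kpow k \<omega>) S = of_nat (card (S \<inter> ({..<k} \<rightarrow>\<^sub>E X \<omega>)))"
proof -
  have "(\<Sum>f\<in>S \<inter> ({..<k} \<rightarrow>\<^sub>E X \<omega>). \<Prod>i<k. emeasure (K \<omega>) {f i}) = (\<Sum>f\<in>S \<inter> ({..<k} \<rightarrow>\<^sub>E X \<omega>). 1)"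
    using assms(1) by (intro sum.cong prod.neutral) auto
  then show ?thesis by (simp add: Kpow_eq_sum[OF S])
qed

lemma inj_tuples_sets: "{f \<in> space (tuples k). inj_on f {..<k}} \<in> sets (tuples k)"
proof -
  have "{f \<in> space (tuples k). inj_on f {..<k}} =
      {f \<in> space (tuples k). \<forall>i\<in>{..<k}. \<forall>j\<in>{..<k} - {i}. (f i, f j) \<in> - {z. fst z = snd z}}"
    by (auto simp: inj_on_def)
  also have "\<dots> \<in> sets (tuples k)"
    using diagonal_borel by (intro sets.sets_Collect_finite_All measurable_coord_pair) auto
  finally show ?thesis .
qed

definition tuple :: "'m list \<Rightarrow> nat \<Rightarrow> 'm" where
  "tuple xs = (\<lambda>i\<in>{..<length xs}. xs ! i)"

lemma tuple_inject: "length xs = length ys \<Longrightarrow> tuple xs = tuple ys \<Longrightarrow> xs = ys"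
  by (rule nth_equalityI) (auto simp: tuple_def fun_eq_iff restrict_def split: if_splits)

lemma tuple_mem: "set xs \<subseteq> Y \<Longrightarrow> length xs = k \<Longrightarrow> tuple xs \<in> {..<k} \<rightarrow>\<^sub>E Y"
  by (auto simp: tuple_def)

lemma tuple_nth: "i < length xs \<Longrightarrow> tuple xs i = xs ! i"
  by (simp add: tuple_def)

lemma tuple_space: "length xs = k \<Longrightarrow> tuple xs \<in> space (tuples k)"
  unfolding space_tuples by (rule tuple_mem) auto

lemma tuple_inj_on: "distinct xs \<Longrightarrow> length xs = k \<Longrightarrow> inj_on (tuple xs) {..<k}"
  by (auto simp: inj_on_def tuple_nth nth_eq_iff_index_eq)

text \<open>
  The number \<open>T\<close> of ordered pairs of neighbours has mean \<open>a \<le> c m\<close>, where \<open>m\<close> is the mean number of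
  points. By \<open>card_pairs_square_le\<close> and the factorial moments of order 4, 3 and 2, its variance is at most
  \<open>4 (c a + a)\<close>, hence of order \<open>m\<close>; the variance of the number \<open>Z\<close> of points is \<open>m\<close>. By Chebyshev's
  inequality both deviate from their means by a multiple of \<open>m\<close> only with probability of order \<open>1 / m\<close>.
  For simple configurations \<open>T\<close> is at least twice the number of edges.
\<close>

lemma edge_count_deviation:
  fixes R :: "'m \<Rightarrow> 'm \<Rightarrow> bool"
  assumes symR: "\<And>x y. R x y \<Longrightarrow> R y x" and R: "{z. R (fst z) (snd z)} \<in> sets borel"
    and c: "0 \<le> c" "\<And>x. emeasure \<mu> {y. R x y} \<le> ennreal c"
    and \<epsilon>: "0 < \<epsilon>" and m0: "0 < measure \<mu> E"
  shows "\<exists>A\<in>sets P. measure P A \<le> ((c + 2 * \<epsilon>)\<^sup>2 + 4 * (c * c + c)) / \<epsilon>\<^sup>2 / measure \<mu> E \<and>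
     (\<forall>\<omega>\<in>space P - A. ecount {e \<in> pair_edges R (N \<omega>). e \<subseteq> E} \<le>
        (ennreal (c / 2) + ennreal \<epsilon>) * vertex_count (N \<omega>) E)"
proof -
  interpret prob_space P by (rule prob_space_P)
  define m where "m = measure \<mu> E"
  have m: "m > 0" "emeasure M UNIV = ennreal m"
  proof -
    have "emeasure M UNIV = emeasure \<mu> E" by (simp add: emeasure_M)
    also have "\<dots> = ennreal m" unfolding m_def using E(2) by (intro emeasure_eq_ennreal_measure) auto
    finally show "emeasure M UNIV = ennreal m" .
  qed (use m0 in \<open>simp add: m_def\<close>)
  define D where "D = {z. R (fst z) (snd z)} - {z. fst z = snd z}"
  have D: "D \<in> sets borel" using R diagonal_borel by (auto simp: D_def)
  have symD: "(x, y) \<in> D \<Longrightarrow> (y, x) \<in> D" and irrD: "(x, x) \<notin> D" for x y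
    using symR by (auto simp: D_def)
  have degc: "deg D x \<le> ennreal c" for x
  proof -
    have 1: "(\<lambda>y. (x, y)) \<in> measurable borel borel" by (intro borel_measurable_continuous_onI continuous_intros)
    have s: "{y. (x, y) \<in> D} \<in> sets borel" "{y. R x y} \<in> sets borel"
      using measurable_sets[OF 1 D] measurable_sets[OF 1 R] by (auto simp: vimage_def)
    have "deg D x = (\<integral>\<^sup>+y. indicator {y. (x, y) \<in> D} y \<partial>M)"
      unfolding deg_def by (intro nn_integral_cong) (auto simp: indicator_def)
    also have "\<dots> = emeasure \<mu> ({y. (x, y) \<in> D} \<inter> E)" using s by (simp add: emeasure_M)
    also have "\<dots> \<le> emeasure \<mu> {y. R x y}"
      using s by (intro emeasure_mono) (auto simp: sets_mu D_def)
    finally show ?thesis using c(2) order_trans by blast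
  qed
  define S2 where "S2 = {f \<in> space (tuples 2). (f 0, f 1) \<in> D}"
  define S3 where "S3 = {f \<in> space (tuples 3). inj_on f {..<3}} \<inter>
    ({f \<in> space (tuples 3). (f 0, f 1) \<in> D} \<inter> {f \<in> space (tuples 3). (f 0, f 2) \<in> D})"
  define S4 where "S4 = {f \<in> space (tuples 4). inj_on f {..<4}} \<inter>
    ({f \<in> space (tuples 4). (f 0, f 1) \<in> D} \<inter> {f \<in> space (tuples 4). (f 2, f 3) \<in> D})"
  have S [measurable]: "S2 \<in> sets (tuples 2)" "S3 \<in> sets (tuples 3)" "S4 \<in> sets (tuples 4)"
    unfolding S2_def S3_def S4_def by (intro sets.Int inj_tuples_sets measurable_coord_pair D; simp)+
  define a where "a = (\<integral>\<^sup>+x. deg D x \<partial>M)"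
  have a_le: "a \<le> ennreal c * ennreal m"
  proof -
    have "a \<le> (\<integral>\<^sup>+x. ennreal c \<partial>M)" unfolding a_def using degc by (intro nn_integral_mono)
    then show ?thesis by (simp add: m)
  qed
  then have a_fin: "a < \<infinity>" by (rule le_less_trans) (simp add: ennreal_mult_less_top)
  define a' where "a' = enn2real a"
  have a': "a = ennreal a'" "0 \<le> a'" using a_fin by (simp_all add: a'_def)
  have a'_le: "a' \<le> c * m"
    using a_le c(1) m(1) unfolding a' by (simp add: ennreal_mult[symmetric] ennreal_le_iff)
  have mean2: "mean_pow 2 S2 = a"
  proof -
    have "inj_on f {..<2}" if "f \<in> S2" for f :: "nat \<Rightarrow> 'm"
      using that irrD by (auto simp: S2_def inj_on_def numeral_2_eq_2 less_Suc_eq)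
    then have "mean_pow 2 S2 = emeasure (Mpow 2) S2" by (intro factorial_moments S) auto
    also have "\<dots> = (\<integral>\<^sup>+f. indicator S2 f \<partial>Mpow 2)" using S by simp
    also have "\<dots> = (\<integral>\<^sup>+f. indicator D (f 0, f 1) \<partial>Mpow 2)"
      by (intro nn_integral_cong) (auto simp: S2_def indicator_def)
    finally show ?thesis unfolding a_def Mpow_2[OF D] .
  qed
  have mean3: "mean_pow 3 S3 \<le> ennreal c * a"
  proof -
    have "mean_pow 3 S3 = emeasure (Mpow 3) S3" by (intro factorial_moments S) (auto simp: S3_def)
    also have "\<dots> = (\<integral>\<^sup>+f. indicator S3 f \<partial>Mpow 3)" using S by simp
    also have "\<dots> \<le> (\<integral>\<^sup>+f. indicator D (f 0, f 1) * indicator D (f 0, f 2) \<partial>Mpow 3)"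
      by (intro nn_integral_mono) (auto simp: S3_def indicator_def)
    also have "\<dots> = (\<integral>\<^sup>+x. deg D x * deg D x \<partial>M)" by (rule Mpow_3[OF D])
    also have "\<dots> \<le> (\<integral>\<^sup>+x. ennreal c * deg D x \<partial>M)"
      using degc by (intro nn_integral_mono mult_right_mono) auto
    also have "\<dots> = ennreal c * a" unfolding a_def by (rule nn_integral_cmult[OF deg_measurable_M[OF D]])
    finally show ?thesis .
  qed
  have mean4: "mean_pow 4 S4 \<le> a\<^sup>2"
  proof -
    have "mean_pow 4 S4 = emeasure (Mpow 4) S4" by (intro factorial_moments S) (auto simp: S4_def)
    also have "\<dots> = (\<integral>\<^sup>+f. indicator S4 f \<partial>Mpow 4)" using S by simp
    also have "\<dots> \<le> (\<integral>\<^sup>+f. indicator D (f 0, f 1) * indicator D (f 2, f 3) \<partial>Mpow 4)"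
      by (intro nn_integral_mono) (auto simp: S4_def indicator_def)
    finally show ?thesis unfolding a_def Mpow_4[OF D] .
  qed
  define T where "T \<omega> = emeasure (Kpow 2 \<omega>) S2" for \<omega>
  have T_card: "T \<omega> = of_nat (card (D \<inter> X \<omega> \<times> X \<omega>))"
    if simple: "\<forall>x\<in>X \<omega>. emeasure (K \<omega>) {x} = 1" for \<omega>
  proof -
    have "bij_betw (\<lambda>(x, y). tuple [x, y]) (D \<inter> X \<omega> \<times> X \<omega>) (S2 \<inter> ({..<2} \<rightarrow>\<^sub>E X \<omega>))"
    proof (rule bij_betw_byWitness[where f' = "\<lambda>f. (f 0, f 1)"])
      show "\<forall>f\<in>S2 \<inter> ({..<2} \<rightarrow>\<^sub>E X \<omega>). (case (f 0, f 1) of (x, y) \<Rightarrow> tuple [x, y]) = f"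
        by (auto simp: tuple_def fun_eq_iff PiE_def extensional_def restrict_def numeral_2_eq_2 less_Suc_eq)
      show "(\<lambda>(x, y). tuple [x, y]) ` (D \<inter> X \<omega> \<times> X \<omega>) \<subseteq> S2 \<inter> ({..<2} \<rightarrow>\<^sub>E X \<omega>)"
        by (auto simp: S2_def tuple_nth intro!: tuple_space tuple_mem)
      show "\<forall>p\<in>D \<inter> X \<omega> \<times> X \<omega>. (\<lambda>f. (f 0, f 1)) (case p of (x, y) \<Rightarrow> tuple [x, y]) = p"
        by (simp add: tuple_nth split: prod.split)
      show "(\<lambda>f. (f 0, f 1)) ` (S2 \<inter> ({..<2} \<rightarrow>\<^sub>E X \<omega>)) \<subseteq> D \<inter> X \<omega> \<times> X \<omega>"
      proof
        fix p assume "p \<in> (\<lambda>f. (f 0, f 1)) ` (S2 \<inter> ({..<2} \<rightarrow>\<^sub>E X \<omega>))"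
        then obtain f where p: "p = (f 0, f 1)" and f: "f \<in> S2" "f \<in> {..<2} \<rightarrow>\<^sub>E X \<omega>" by blast
        have "f 0 \<in> X \<omega>" "f 1 \<in> X \<omega>" by (rule PiE_mem[OF f(2)]; simp)+
        then show "p \<in> D \<inter> X \<omega> \<times> X \<omega>" using f(1) by (simp add: p S2_def)
      qed
    qed
    then show ?thesis
      unfolding T_def Kpow_simple[OF simple S(1)] by (simp add: bij_betw_same_card)
  qed
  have T_square: "(T \<omega>)\<^sup>2 \<le> emeasure (Kpow 4 \<omega>) S4 + 4 * (emeasure (Kpow 3 \<omega>) S3 + T \<omega>)"
    if simple: "\<forall>x\<in>X \<omega>. emeasure (K \<omega>) {x} = 1" for \<omega>
  proof -
    let ?X = "X \<omega>"
    let ?Q = "{(x, y, z, w) \<in> ?X \<times> ?X \<times> ?X \<times> ?X. distinct [x, y, z, w] \<and> (x, y) \<in> D \<and> (z, w) \<in> D}"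
    let ?R = "{(x, y, z) \<in> ?X \<times> ?X \<times> ?X. distinct [x, y, z] \<and> (x, y) \<in> D \<and> (x, z) \<in> D}"
    have f: "finite (S \<inter> ({..<k} \<rightarrow>\<^sub>E ?X))" for S and k :: nat
      using finite_X by (intro finite_Int disjI2 finite_PiE) auto
    have Q: "card ?Q \<le> card (S4 \<inter> ({..<4} \<rightarrow>\<^sub>E ?X))"
    proof (rule card_inj_on_le[OF _ _ f])
      show "inj_on (\<lambda>(x, y, z, w). tuple [x, y, z, w]) ?Q"
        by (auto simp: inj_on_def dest!: tuple_inject[rotated])
      show "(\<lambda>(x, y, z, w). tuple [x, y, z, w]) ` ?Q \<subseteq> S4 \<inter> ({..<4} \<rightarrow>\<^sub>E ?X)"
        unfolding S4_def
        by (auto simp: tuple_nth eval_nat_numeral simp del: distinct.simps intro!: tuple_space tuple_mem tuple_inj_on) 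
    qed
    have R: "card ?R \<le> card (S3 \<inter> ({..<3} \<rightarrow>\<^sub>E ?X))"
    proof (rule card_inj_on_le[OF _ _ f])
      show "inj_on (\<lambda>(x, y, z). tuple [x, y, z]) ?R"
        by (auto simp: inj_on_def dest!: tuple_inject[rotated])
      show "(\<lambda>(x, y, z). tuple [x, y, z]) ` ?R \<subseteq> S3 \<inter> ({..<3} \<rightarrow>\<^sub>E ?X)"
        unfolding S3_def
        by (auto simp: tuple_nth eval_nat_numeral simp del: distinct.simps intro!: tuple_space tuple_mem tuple_inj_on)
    qed
    have "(card (D \<inter> ?X \<times> ?X))\<^sup>2 \<le> card ?Q + 4 * (card ?R + card (D \<inter> ?X \<times> ?X))"
      by (rule card_pairs_square_le[OF finite_X symD irrD])
    also have "\<dots> \<le> card (S4 \<inter> ({..<4} \<rightarrow>\<^sub>E ?X)) + 4 * (card (S3 \<inter> ({..<3} \<rightarrow>\<^sub>E ?X)) + card (D \<inter> ?X \<times> ?X))"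
      using Q R by (intro add_mono mult_left_mono) simp_all
    finally have "(of_nat ((card (D \<inter> ?X \<times> ?X))\<^sup>2) :: ennreal) \<le>
        of_nat (card (S4 \<inter> ({..<4} \<rightarrow>\<^sub>E ?X)) + 4 * (card (S3 \<inter> ({..<3} \<rightarrow>\<^sub>E ?X)) + card (D \<inter> ?X \<times> ?X)))"
      by (simp only: of_nat_le_iff)
    then show ?thesis
      by (simp add: T_card[OF simple] Kpow_simple[OF simple] S)
  qed
  have T_meas [measurable]: "T \<in> borel_measurable P" unfolding T_def by measurable
  have second: "(\<integral>\<^sup>+\<omega>. (T \<omega>)\<^sup>2 \<partial>P) \<le> ennreal (a'\<^sup>2 + 4 * (c * a' + a'))"
  proof -
    have "(\<integral>\<^sup>+\<omega>. (T \<omega>)\<^sup>2 \<partial>P) \<le> (\<integral>\<^sup>+\<omega>. emeasure (Kpow 4 \<omega>) S4 + 4 * (emeasure (Kpow 3 \<omega>) S3 + T \<omega>) \<partial>P)"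
      by (rule nn_integral_mono_AE, rule eventually_mono[OF simple_points], erule T_square)
    also have "\<dots> = mean_pow 4 S4 + 4 * (mean_pow 3 S3 + mean_pow 2 S2)"
      unfolding mean_pow_def T_def by (simp add: nn_integral_add nn_integral_cmult)
    also have "\<dots> \<le> a\<^sup>2 + 4 * (ennreal c * a + a)"
      unfolding mean2 using mean3 mean4 by (intro add_mono mult_left_mono) auto
    also have "\<dots> = ennreal (a'\<^sup>2 + 4 * (c * a' + a'))"
    proof -
      have q: "0 \<le> c * a' + a'" using c(1) a'(2) by simp
      have "ennreal c * a + a = ennreal (c * a' + a')"
        using a'(2) c(1) unfolding a'(1) by (simp add: ennreal_mult)
      moreover have "4 * ennreal (c * a' + a') = ennreal (4 * (c * a' + a'))"
        by (subst ennreal_mult'[of 4]) simp_all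
      moreover have "a\<^sup>2 = ennreal (a'\<^sup>2)" using a'(2) by (simp add: a'(1) ennreal_power)
      ultimately show ?thesis using q by (simp only: ennreal_plus zero_le_power2 mult_nonneg_nonneg zero_le_numeral)
    qed
    finally show ?thesis .
  qed
  define A1 where "A1 = {\<omega> \<in> space P. \<epsilon> * m \<le> \<bar>enn2real (T \<omega>) - a'\<bar>}"
  have pA1: "prob A1 \<le> 4 * (c * a' + a') / (\<epsilon> * m)\<^sup>2"
    unfolding A1_def
  proof (rule chebyshev_ennreal[OF T_meas])
    show "T \<omega> < \<infinity>" for \<omega> unfolding T_def by (rule finite_Kpow)
    show "(\<integral>\<^sup>+\<omega>. T \<omega> \<partial>P) = ennreal a'" using mean2 by (simp add: mean_pow_def T_def a'(1))
  qed (use a' c \<epsilon> m second in auto)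
  have pA1': "prob A1 \<le> 4 * (c * c + c) / \<epsilon>\<^sup>2 / m"
  proof -
    have "4 * (c * a' + a') \<le> 4 * (c * c + c) * m"
      using mult_left_mono[OF a'_le c(1)] a'_le by (simp add: algebra_simps)
    then have "4 * (c * a' + a') / (\<epsilon> * m)\<^sup>2 \<le> 4 * (c * c + c) * m / (\<epsilon> * m)\<^sup>2"
      by (intro divide_right_mono) auto
    also have "\<dots> = 4 * (c * c + c) / \<epsilon>\<^sup>2 / m" using m(1) \<epsilon> by (simp add: power2_eq_square field_simps)
    finally show ?thesis using pA1 by linarith
  qed
  \<comment> \<open>chosen such that \<open>(c + 2 \<epsilon>) (1 - \<eta>) = c + \<epsilon>\<close>, to balance both deviations at the end\<close>
  define \<eta> where "\<eta> = \<epsilon> / (c + 2 * \<epsilon>)"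
  have \<eta>: "\<eta> > 0" "(c + 2 * \<epsilon>) * \<eta> = \<epsilon>" using \<epsilon> c(1) by (simp_all add: \<eta>_def add_nonneg_pos)
  define Z where "Z \<omega> = emeasure (K \<omega>) UNIV" for \<omega>
  define A2 where "A2 = {\<omega> \<in> space P. \<eta> * m \<le> \<bar>enn2real (Z \<omega>) - m\<bar>}"
  have Z_meas [measurable]: "Z \<in> borel_measurable P" unfolding Z_def by measurable
  have pA2: "prob A2 \<le> m / (\<eta> * m)\<^sup>2"
    unfolding A2_def
  proof (rule chebyshev_ennreal[OF Z_meas])
    show "Z \<omega> < \<infinity>" for \<omega> unfolding Z_def by (rule finite_K)
    show "(\<integral>\<^sup>+\<omega>. Z \<omega> \<partial>P) = ennreal m" unfolding Z_def K_moments m ..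
    show "(\<integral>\<^sup>+\<omega>. (Z \<omega>)\<^sup>2 \<partial>P) \<le> ennreal (m\<^sup>2 + m)"
      unfolding Z_def K_moments m using m(1) by (simp add: ennreal_power add.commute)
  qed (use m \<eta> in auto)
  have "m / (\<eta> * m)\<^sup>2 = (c + 2 * \<epsilon>)\<^sup>2 / \<epsilon>\<^sup>2 / m"
    using m(1) \<epsilon> c(1) by (simp add: \<eta>_def power2_eq_square field_simps)
  with pA2 have pA2': "prob A2 \<le> (c + 2 * \<epsilon>)\<^sup>2 / \<epsilon>\<^sup>2 / m" by simp
  obtain A0 where A0: "A0 \<in> null_sets P"
    "{\<omega> \<in> space P. \<not> ((\<forall>x\<in>X \<omega>. emeasure (K \<omega>) {x} = 1) \<and>
        (\<forall>B\<in>sets borel. emeasure (K \<omega>) B = emeasure (N \<omega>) (B \<inter> E)))} \<subseteq> A0"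
  proof -
    have "AE \<omega> in P. (\<forall>x\<in>X \<omega>. emeasure (K \<omega>) {x} = 1) \<and>
        (\<forall>B\<in>sets borel. emeasure (K \<omega>) B = emeasure (N \<omega>) (B \<inter> E))"
      using simple_points AE_K_eq by eventually_elim blast
    then show ?thesis by (rule AE_E) (auto intro: that simp: null_sets_def)
  qed
  have As: "A1 \<in> sets P" "A2 \<in> sets P" "A0 \<in> sets P"
    using A0 by (auto simp: A1_def A2_def null_sets_def)
  show ?thesis
  proof (intro bexI[of _ "A0 \<union> (A1 \<union> A2)"] conjI ballI)
    show "A0 \<union> (A1 \<union> A2) \<in> sets P" using As by auto
    have "prob (A0 \<union> (A1 \<union> A2)) \<le> prob A0 + (prob A1 + prob A2)"
      using As by (intro order_trans[OF measure_Un_le] add_left_mono measure_Un_le) auto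
    also have "prob A0 = 0" using A0(1) by (simp add: measure_eq_0_null_sets)
    finally have "prob (A0 \<union> (A1 \<union> A2)) \<le> 4 * (c * c + c) / \<epsilon>\<^sup>2 / m + (c + 2 * \<epsilon>)\<^sup>2 / \<epsilon>\<^sup>2 / m"
      using pA1' pA2' by linarith
    then show "prob (A0 \<union> (A1 \<union> A2)) \<le> ((c + 2 * \<epsilon>)\<^sup>2 + 4 * (c * c + c)) / \<epsilon>\<^sup>2 / measure \<mu> E"
      by (simp add: add_divide_distrib m_def add.commute)
    fix \<omega> assume \<omega>: "\<omega> \<in> space P - (A0 \<union> (A1 \<union> A2))"
    then have simple: "\<forall>x\<in>X \<omega>. emeasure (K \<omega>) {x} = 1"
      and KN: "\<And>B. B \<in> sets borel \<Longrightarrow> emeasure (K \<omega>) B = emeasure (N \<omega>) (B \<inter> E)"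
      using A0(2) by blast+
    have XE: "X \<omega> = graph_vertices (N \<omega>) \<inter> E"
    proof (rule set_eqI)
      fix x
      show "x \<in> X \<omega> \<longleftrightarrow> x \<in> graph_vertices (N \<omega>) \<inter> E"
        using KN[OF singleton_borel, of x] by (cases "x \<in> E") (auto simp: graph_vertices_def)
    qed
    have Zc: "Z \<omega> = of_nat (card (X \<omega>))" unfolding Z_def K_UNIV using simple by simp
    have Zr: "enn2real (Z \<omega>) = real (card (X \<omega>))" unfolding Zc by (simp add: ennreal_of_nat_eq_real_of_nat)
    have v: "vertex_count (N \<omega>) E = ennreal (real (card (X \<omega>)))"
      unfolding vertex_count_def ecount_def XE[symmetric] using finite_X
      by (simp add: emeasure_count_space_finite ennreal_of_nat_eq_real_of_nat)
    let ?Q = "D \<inter> X \<omega> \<times> X \<omega>"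
    have finQ: "finite ?Q" using finite_X by auto
    have Tr: "enn2real (T \<omega>) = real (card ?Q)"
      unfolding T_card[OF simple] by (simp add: ennreal_of_nat_eq_real_of_nat)
    have edges: "{e \<in> pair_edges R (N \<omega>). e \<subseteq> E} = (\<lambda>(x, y). {x, y}) ` ?Q"
      unfolding pair_edges_def XE D_def by force
    have e: "ecount {e \<in> pair_edges R (N \<omega>). e \<subseteq> E} = ennreal (real (card ((\<lambda>(x, y). {x, y}) ` ?Q)))"
      unfolding edges ecount_def using finQ
      by (simp add: emeasure_count_space_finite ennreal_of_nat_eq_real_of_nat)
    have le: "2 * card ((\<lambda>(x, y). {x, y}) ` ?Q) \<le> card ?Q"
      by (rule card_unordered_pairs_le[OF finQ]) (use symD irrD in auto)
    have t: "real (card ?Q) < a' + \<epsilon> * m" using \<omega> Tr by (auto simp: A1_def)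
    have z: "m - \<eta> * m < real (card (X \<omega>))" using \<omega> Zr by (auto simp: A2_def)
    have "2 * real (card ((\<lambda>(x, y). {x, y}) ` ?Q)) \<le> real (card ?Q)" using le by linarith
    also have "\<dots> \<le> c * m + \<epsilon> * m" using t a'_le by linarith
    also have "\<dots> = (c + 2 * \<epsilon>) * (m - \<eta> * m)"
    proof -
      have "(c + 2 * \<epsilon>) * (m - \<eta> * m) = (c + 2 * \<epsilon>) * m - ((c + 2 * \<epsilon>) * \<eta>) * m" by (simp add: algebra_simps)
      then show ?thesis unfolding \<eta>(2) by (simp add: algebra_simps)
    qed
    also have "\<dots> \<le> (c + 2 * \<epsilon>) * real (card (X \<omega>))"
      using z c(1) \<epsilon> by (intro mult_left_mono) auto
    finally have "real (card ((\<lambda>(x, y). {x, y}) ` ?Q)) \<le> (c / 2 + \<epsilon>) * real (card (X \<omega>))"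
      by (simp add: algebra_simps)
    then show "ecount {e \<in> pair_edges R (N \<omega>). e \<subseteq> E} \<le> (ennreal (c / 2) + ennreal \<epsilon>) * vertex_count (N \<omega>) E"
      unfolding e v using c(1) \<epsilon>
      by (simp add: ennreal_plus[symmetric] ennreal_mult[symmetric] ennreal_leI del: ennreal_plus)
  qed
qed

end

section \<open>The ratio of edges to vertices\<close>

lemma ennreal_divide_le_of_le_mult:
  fixes e v b :: ennreal
  assumes "e \<le> b * v"
  shows "e / v \<le> b"
proof (cases "v = 0")
  case True
  then show ?thesis using assms by simp
next
  case False
  then show ?thesis using assms by (intro divide_le_posI_ennreal) (auto simp: mult.commute zero_less_iff_neq_zero)
qed

theorem proposition31:
  fixes A :: "('m::{t2_space, second_countable_topology}, 'n::finite) chart set"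
    and g :: "('m, 'n) metric_tensor"
    and P :: "'w measure"
    and N :: "'w \<Rightarrow> 'm measure"
    and E :: "nat \<Rightarrow> 'm set"
    and \<delta> t :: real
    and x0 :: 'm
  assumes "riemannian_manifold A g"
    and "connected (UNIV :: 'm set)"
    and "homogeneous A g"
    and "emeasure (riem_volume A g) UNIV = \<infinity>"
    and "\<delta> > 0" and "t > 0"
    and "poisson_process P N (scale_measure (ennreal \<delta>) (riem_volume A g))"
    and "\<And>n. E n \<in> sets borel"
    and "\<And>n. emeasure (riem_volume A g) (E n) < \<infinity>"
    and "incseq E" and "(\<Union>n. E n) = UNIV"
  shows "(\<forall>\<epsilon>>0. (\<lambda>n. measure P {\<omega> \<in> space P.
             edge_count A g t (N \<omega>) (E n) >
             (ennreal \<delta> * ball_volume A g t x0 / 2 + ennreal \<epsilon>) * vertex_count (N \<omega>) (E n)})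
           \<longlonglongrightarrow> 0) \<and>
         ((\<Sum>n. 1 / emeasure (riem_volume A g) (E n)) < \<infinity> \<longrightarrow>
           (AE \<omega> in P. limsup (\<lambda>n. edge_vertex_ratio A g t (N \<omega>) (E n)) \<le>
             ennreal \<delta> * ball_volume A g t x0 / 2))"
proof -
  interpret riemannian A g by standard fact
  let ?vol = "riem_volume A g" and ?\<mu> = "scale_measure (ennreal \<delta>) (riem_volume A g)"
  let ?b = "ennreal \<delta> * ball_volume A g t x0 / 2"
  let ?e = "\<lambda>\<omega> n. edge_count A g t (N \<omega>) (E n)" and ?v = "\<lambda>\<omega> n. vertex_count (N \<omega>) (E n)"
  interpret P: prob_space P
    using assms(7) by (auto simp: poisson_process_def point_process_def)
  have edges: "graph_edges A g t \<nu> = pair_edges (\<lambda>x y. riem_dist A g x y \<le> ennreal t) \<nu>" for \<nu>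
    unfolding graph_edges_def pair_edges_def ..
  have no_vertices: "?e \<omega> n = 0" if "?v \<omega> n = 0" for \<omega> n
  proof -
    have "graph_vertices (N \<omega>) \<inter> E n = {}"
      using that by (simp add: vertex_count_def ecount_def emeasure_count_space split: if_splits)
    then have "{e \<in> graph_edges A g t (N \<omega>). e \<subseteq> E n} = {}" unfolding graph_edges_def by fastforce
    then show ?thesis by (simp only: edge_count_def ecount_def emeasure_empty)
  qed
  show ?thesis
  proof (cases "ball_volume A g t x0 = \<infinity>")
    case True
    \<comment> \<open>balls of infinite volume make both bounds trivial\<close>
    have b: "?b = \<infinity>" using assms(5) unfolding True by (simp add: ennreal_mult_top ennreal_top_divide)
    have "\<not> ?e \<omega> n > (?b + ennreal \<epsilon>) * ?v \<omega> n" for \<omega> n \<epsilon>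
      using no_vertices[of \<omega> n] unfolding b by (cases "?v \<omega> n = 0") (simp_all add: ennreal_top_mult)
    then show ?thesis unfolding b by simp
  next
    case False
    define V where "V = enn2real (ball_volume A g t x0)"
    have V: "ball_volume A g t x0 = ennreal V" "0 \<le> V" using False by (simp_all add: V_def less_top)
    define c where "c = \<delta> * V"
    have c: "0 \<le> c" using V assms(5) by (simp add: c_def)
    have b: "?b = ennreal (c / 2)"
    proof -
      have "?b = ennreal c / ennreal 2" using V assms(5) by (simp add: c_def ennreal_mult)
      also have "\<dots> = ennreal (c / 2)" using c by (intro divide_ennreal) auto
      finally show ?thesis .
    qed
    define L where "L n = measure ?vol (E n)" for n
    have L: "emeasure ?vol (E n) = ennreal (L n)" for n
      unfolding L_def using assms(9)[of n] by (intro emeasure_eq_ennreal_measure) auto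
    have L0: "0 \<le> L n" for n by (simp add: L_def)
    define C where "C \<epsilon> = ((c + 2 * \<epsilon>)\<^sup>2 + 4 * (c * c + c)) / \<epsilon>\<^sup>2 / \<delta>" for \<epsilon>
    \<comment> \<open>an event of probability of order \<open>1 / L n\<close> outside of which the bound holds; it need not equal the bad event, whose measurability is thereby left open\<close>
    have bad: "\<exists>B\<in>sets P. measure P B \<le> C \<epsilon> / L n \<and>
        (\<forall>\<omega>\<in>space P - B. ?e \<omega> n \<le> (?b + ennreal \<epsilon>) * ?v \<omega> n)"
      if \<epsilon>: "0 < \<epsilon>" and Ln: "0 < L n" for \<epsilon> n
    proof -
      have "poisson_window P N ?\<mu> (E n)"
      proof
        show "sets ?\<mu> = sets borel" by (simp add: sets_riem_volume)
        show "emeasure ?\<mu> (E n) < \<infinity>" using assms(9)[of n] by (simp add: ennreal_mult_less_top)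
      qed (use assms(7,8) in \<open>simp_all add: riem_volume_singleton\<close>)
      then interpret W: poisson_window P N ?\<mu> "E n" .
      have m: "measure ?\<mu> (E n) = \<delta> * L n"
        using assms(5) by (simp add: measure_scale_measure L_def)
      have "\<exists>B\<in>sets P. measure P B \<le> ((c + 2 * \<epsilon>)\<^sup>2 + 4 * (c * c + c)) / \<epsilon>\<^sup>2 / measure ?\<mu> (E n) \<and>
        (\<forall>\<omega>\<in>space P - B. ecount {e \<in> pair_edges (\<lambda>x y. riem_dist A g x y \<le> ennreal t) (N \<omega>). e \<subseteq> E n} \<le>
           (ennreal (c / 2) + ennreal \<epsilon>) * ?v \<omega> n)"
      proof (rule W.edge_count_deviation[OF _ _ c _ \<epsilon>])
        show "riem_dist A g y x \<le> ennreal t" if "riem_dist A g x y \<le> ennreal t" for x y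
          using that by (simp add: riem_dist_sym)
        show "{z. riem_dist A g (fst z) (snd z) \<le> ennreal t} \<in> sets borel"
          by (rule borel_closed[OF closed_riem_dist_le])
        show "emeasure ?\<mu> {y. riem_dist A g x y \<le> ennreal t} \<le> ennreal c" for x
        proof -
          have "emeasure ?\<mu> {y. riem_dist A g x y \<le> ennreal t} = ennreal \<delta> * ball_volume A g t x"
            by (simp add: ball_volume_def)
          also have "ball_volume A g t x = ennreal V" using ball_volume_const[OF assms(3)] V by metis
          finally show ?thesis using V assms(5) by (simp add: c_def ennreal_mult)
        qed
        show "0 < measure ?\<mu> (E n)" using Ln assms(5) by (simp add: m)
      qed
      moreover have "((c + 2 * \<epsilon>)\<^sup>2 + 4 * (c * c + c)) / \<epsilon>\<^sup>2 / measure ?\<mu> (E n) = C \<epsilon> / L n"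
        unfolding m C_def by (simp only: divide_divide_eq_left mult.assoc)
      ultimately show ?thesis unfolding b edge_count_def edges by (simp only:)
    qed
    have Lim: "filterlim L at_top sequentially"
    proof -
      have "(\<lambda>n. emeasure ?vol (E n)) \<longlonglongrightarrow> emeasure ?vol (\<Union>n. E n)"
        using assms(8,10) by (intro Lim_emeasure_incseq) (auto simp: sets_riem_volume)
      then have lim: "(\<lambda>n. ennreal (L n)) \<longlonglongrightarrow> \<infinity>" using assms(4,11) by (simp add: L)
      show ?thesis
        unfolding filterlim_at_top
      proof
        fix Z :: real
        have "\<forall>\<^sub>F n in sequentially. ennreal Z < ennreal (L n)"
          using lim by (rule order_tendstoD) simp
        then show "\<forall>\<^sub>F n in sequentially. Z \<le> L n"
        proof eventually_elim
          case (elim n)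
          then have "\<not> L n \<le> Z" using ennreal_leI[of "L n" Z] leD by blast
          then show ?case by simp
        qed
      qed
    qed
    show ?thesis
    proof (intro conjI allI impI)
      fix \<epsilon> :: real assume \<epsilon>: "0 < \<epsilon>"
      let ?p = "\<lambda>n. measure P {\<omega> \<in> space P. ?e \<omega> n > (?b + ennreal \<epsilon>) * ?v \<omega> n}"
      have "\<forall>\<^sub>F n in sequentially. 0 < L n" using Lim by (simp add: filterlim_at_top_dense)
      then have up: "\<forall>\<^sub>F n in sequentially. ?p n \<le> C \<epsilon> / L n"
      proof eventually_elim
        case (elim n)
        obtain B where B: "B \<in> sets P" "measure P B \<le> C \<epsilon> / L n"
          "\<forall>\<omega>\<in>space P - B. ?e \<omega> n \<le> (?b + ennreal \<epsilon>) * ?v \<omega> n" using bad[OF \<epsilon> elim] by blast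
        have "{\<omega> \<in> space P. ?e \<omega> n > (?b + ennreal \<epsilon>) * ?v \<omega> n} \<subseteq> B"
          using B(3) by (auto simp: not_le[symmetric])
        then have "?p n \<le> measure P B" using B(1) by (rule P.finite_measure_mono)
        then show ?case using B(2) by linarith
      qed
      have lim0: "(\<lambda>n. C \<epsilon> / L n) \<longlonglongrightarrow> 0"
        using Lim by (intro tendsto_divide_0[OF tendsto_const] filterlim_at_top_imp_at_infinity)
      show "?p \<longlonglongrightarrow> 0"
        by (rule tendsto_sandwich[OF always_eventually up tendsto_const lim0]) simp
    next
      assume fin: "(\<Sum>n. 1 / emeasure ?vol (E n)) < \<infinity>"
      have Lpos: "0 < L n" for n
      proof (rule ccontr)
        assume "\<not> 0 < L n"
        then have "1 / emeasure ?vol (E n) = \<infinity>" using L0[of n] by (simp add: L ennreal_divide_zero less_le)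
        moreover have "1 / emeasure ?vol (E n) \<le> (\<Sum>n. 1 / emeasure ?vol (E n))"
          using sum_le_suminf[of "\<lambda>n. 1 / emeasure ?vol (E n)" "{n}"] by simp
        ultimately show False using fin by simp
      qed
      have inv: "1 / emeasure ?vol (E n) = ennreal (1 / L n)" for n
        using divide_ennreal[of 1 "L n"] Lpos[of n] by (simp add: L)
      have summ: "summable (\<lambda>n. 1 / L n)"
        using fin L0 unfolding inv by (intro summable_suminf_not_top) (auto simp: less_top)
      have ev: "AE \<omega> in P. \<forall>\<^sub>F n in sequentially. edge_vertex_ratio A g t (N \<omega>) (E n) \<le> ?b + ennreal (1 / real (Suc j))" for j
      proof -
        let ?\<epsilon> = "1 / real (Suc j)"
        have "\<forall>n. \<exists>B. B \<in> sets P \<and> measure P B \<le> C ?\<epsilon> / L n \<and>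
            (\<forall>\<omega>\<in>space P - B. ?e \<omega> n \<le> (?b + ennreal ?\<epsilon>) * ?v \<omega> n)"
          using bad[of ?\<epsilon>] Lpos by (auto simp: Bex_def)
        then obtain B where B: "\<And>n. B n \<in> sets P" "\<And>n. measure P (B n) \<le> C ?\<epsilon> / L n"
          "\<And>n. \<forall>\<omega>\<in>space P - B n. ?e \<omega> n \<le> (?b + ennreal ?\<epsilon>) * ?v \<omega> n" by metis
        have "summable (\<lambda>n. C ?\<epsilon> * (1 / L n))" using summ by (rule summable_mult)
        then have "summable (\<lambda>n. measure P (B n))"
          by (rule summable_comparison_test[rotated]) (use B(2) in \<open>auto intro!: exI[of _ 0]\<close>)
        then have "AE \<omega> in P. \<forall>\<^sub>F n in sequentially. \<omega> \<in> space P - B n"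
          using B(1) by (intro borel_cantelli_AE1) (auto simp: P.emeasure_eq_measure)
        then show ?thesis
        proof eventually_elim
          case (elim \<omega>)
          then show ?case
          proof eventually_elim
            case (elim n)
            then show ?case unfolding edge_vertex_ratio_def using B(3)[of n] by (intro ennreal_divide_le_of_le_mult) blast
          qed
        qed
      qed
      then have "AE \<omega> in P. \<forall>j. \<forall>\<^sub>F n in sequentially. edge_vertex_ratio A g t (N \<omega>) (E n) \<le> ?b + ennreal (1 / real (Suc j))"
        by (simp add: AE_all_countable)
      then show "AE \<omega> in P. limsup (\<lambda>n. edge_vertex_ratio A g t (N \<omega>) (E n)) \<le> ?b"
      proof eventually_elim
        case (elim \<omega>)
        have le: "limsup (\<lambda>n. edge_vertex_ratio A g t (N \<omega>) (E n)) \<le> ?b + ennreal (1 / real (Suc j))" for j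
          using elim by (intro Limsup_bounded) auto
        show ?case
        proof (rule ennreal_le_epsilon)
          fix r :: real assume "0 < r"
          then obtain j where "1 / real (Suc j) < r" using nat_approx_posE by blast
          then have "?b + ennreal (1 / real (Suc j)) \<le> ?b + ennreal r" by (intro add_left_mono ennreal_leI) simp
          with le[of j] show "limsup (\<lambda>n. edge_vertex_ratio A g t (N \<omega>) (E n)) \<le> ?b + ennreal r"
            by (rule order_trans)
        qed
      qed
    qed
  qed
qed

end
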